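(* Let $(f,g):(\mathbb{C}^n,0)\to(\mathbb{C}^2,0)$ be a holomorphic map germ. Let $f=h\hat f$, $g=h\hat g$, where $h=\gcd(f,g)\in\mathfrak{m}_n$, and such that $\hat f$ and $\hat g$ are not units. If $\dim Z(h)\cap Z(\beta\hat f+\alpha\hat g)=n-2$ for any $[\alpha:\beta]\in\mathbb{P}^1$, then $(\operatorname{Im}(f,g),0)=(\mathbb{C}^2,0)$.
   Context: $\mathcal{O}_n$ is the ring of holomorphic function germs at $0\in\mathbb{C}^n$ and $\mathfrak{m}_n$ is its maximal ideal; the greatest common divisor is taken in $\mathcal{O}_n$, up to invertible elements. $Z(\cdot)$ denotes the germ at $0$ of the zero set of a function germ, and dimensions are those of germs at $0$. $\mathbb{P}^1$ is the complex projective line. $(\operatorname{Im}(f,g),0)=(\mathbb{C}^2,0)$ means that the map germ is locally open: for every open neighbourhood $U$ of $0\in\mathbb{C}^n$ (in the domain of a representative), $0$ is an interior point of $(f,g)(U)$ in $\mathbb{C}^2$. *)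

theory Defs
  imports "HOL-Analysis.Analysis"
begin

section \<open>Holomorphic functions of several variables\<close>

text \<open>On open sets, holomorphic means complex Frechet differentiable at every point;
  \<open>*s\<close> is the complex scalar multiplication of \<open>complex ^ 'n\<close>.\<close>

definition holomorphic_cn :: "(complex ^ 'n \<Rightarrow> complex) \<Rightarrow> (complex ^ 'n) set \<Rightarrow> bool" where
  "holomorphic_cn f U \<longleftrightarrow>
     (\<forall>z\<in>U. \<exists>D. (f has_derivative D) (at z) \<and> (\<forall>c v. D (c *s v) = c * D v))"

lemma holomorphic_cn_subset: "holomorphic_cn f U \<Longrightarrow> V \<subseteq> U \<Longrightarrow> holomorphic_cn f V"
  unfolding holomorphic_cn_def by blast

lemma holomorphic_cn_const: "holomorphic_cn (\<lambda>z. c) U"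
  unfolding holomorphic_cn_def using has_derivative_const by fastforce

lemma holomorphic_cn_add:
  assumes "holomorphic_cn f U" "holomorphic_cn g U"
  shows "holomorphic_cn (\<lambda>z. f z + g z) U"
  unfolding holomorphic_cn_def
proof
  fix z assume "z \<in> U"
  then obtain D E where D: "(f has_derivative D) (at z)" "\<forall>c v. D (c *s v) = c * D v"
    and E: "(g has_derivative E) (at z)" "\<forall>c v. E (c *s v) = c * E v"
    using assms unfolding holomorphic_cn_def by meson
  have "\<forall>c v. D (c *s v) + E (c *s v) = c * (D v + E v)"
    using D(2) E(2) by (simp add: distrib_left)
  with has_derivative_add[OF D(1) E(1)]
  show "\<exists>D. ((\<lambda>z. f z + g z) has_derivative D) (at z) \<and> (\<forall>c v. D (c *s v) = c * D v)"
    by (intro exI conjI)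
qed

lemma holomorphic_cn_mult:
  assumes "holomorphic_cn f U" "holomorphic_cn g U"
  shows "holomorphic_cn (\<lambda>z. f z * g z) U"
  unfolding holomorphic_cn_def
proof
  fix z assume "z \<in> U"
  then obtain D E where D: "(f has_derivative D) (at z)" "\<forall>c v. D (c *s v) = c * D v"
    and E: "(g has_derivative E) (at z)" "\<forall>c v. E (c *s v) = c * E v"
    using assms unfolding holomorphic_cn_def by meson
  have "\<forall>c v. f z * E (c *s v) + D (c *s v) * g z = c * (f z * E v + D v * g z)"
    using D(2) E(2) by (simp add: algebra_simps)
  with has_derivative_mult[OF D(1) E(1)]
  show "\<exists>D. ((\<lambda>z. f z * g z) has_derivative D) (at z) \<and> (\<forall>c v. D (c *s v) = c * D v)"
    by (intro exI conjI)
qed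

lemma holomorphic_cn_inverse:
  assumes "holomorphic_cn f U" "\<forall>z\<in>U. f z \<noteq> 0"
  shows "holomorphic_cn (\<lambda>z. inverse (f z)) U"
  unfolding holomorphic_cn_def
proof
  fix z assume z: "z \<in> U"
  then obtain D where D: "(f has_derivative D) (at z)" "\<forall>c v. D (c *s v) = c * D v"
    using assms unfolding holomorphic_cn_def by meson
  have "\<forall>c v. - (inverse (f z) * D (c *s v) * inverse (f z)) =
      c * - (inverse (f z) * D v * inverse (f z))"
    using D(2) by simp
  with Deriv.has_derivative_inverse[OF bspec[OF assms(2) z] D(1)]
  show "\<exists>D. ((\<lambda>z. inverse (f z)) has_derivative D) (at z) \<and> (\<forall>c v. D (c *s v) = c * D v)"
    by (intro exI conjI)
qed


section \<open>The ring of holomorphic function germs at the origin\<close>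

text \<open>Germs are represented by total functions that are holomorphic on some open neighbourhood
  of the origin; their values elsewhere are irrelevant.\<close>

definition holomorphic_near0 :: "(complex ^ 'n \<Rightarrow> complex) \<Rightarrow> bool" where
  "holomorphic_near0 f \<longleftrightarrow> (\<exists>U. open U \<and> 0 \<in> U \<and> holomorphic_cn f U)"

definition germ_rel :: "(complex ^ 'n \<Rightarrow> complex) \<Rightarrow> (complex ^ 'n \<Rightarrow> complex) \<Rightarrow> bool" where
  "germ_rel f g \<longleftrightarrow> holomorphic_near0 f \<and> holomorphic_near0 g \<and>
     eventually (\<lambda>z. f z = g z) (nhds 0)"

lemma holomorphic_near0_const: "holomorphic_near0 (\<lambda>z. c)"
  unfolding holomorphic_near0_def using holomorphic_cn_const by blast

lemma holomorphic_near0_binop: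
  assumes "holomorphic_near0 f" "holomorphic_near0 g"
    and "\<And>U. holomorphic_cn f U \<Longrightarrow> holomorphic_cn g U \<Longrightarrow> holomorphic_cn h U"
  shows "holomorphic_near0 h"
proof -
  obtain U V where "open U" "0 \<in> U" "holomorphic_cn f U" "open V" "0 \<in> V" "holomorphic_cn g V"
    using assms(1,2) unfolding holomorphic_near0_def by auto
  then have "open (U \<inter> V)" "0 \<in> U \<inter> V" "holomorphic_cn h (U \<inter> V)"
    by (auto intro: assms(3) holomorphic_cn_subset)
  then show ?thesis unfolding holomorphic_near0_def by blast
qed

lemma holomorphic_near0_add:
  "holomorphic_near0 f \<Longrightarrow> holomorphic_near0 g \<Longrightarrow> holomorphic_near0 (\<lambda>z. f z + g z)"
  by (erule (1) holomorphic_near0_binop) (rule holomorphic_cn_add)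

lemma holomorphic_near0_mult:
  "holomorphic_near0 f \<Longrightarrow> holomorphic_near0 g \<Longrightarrow> holomorphic_near0 (\<lambda>z. f z * g z)"
  by (erule (1) holomorphic_near0_binop) (rule holomorphic_cn_mult)

lemma holomorphic_near0_uminus:
  "holomorphic_near0 f \<Longrightarrow> holomorphic_near0 (\<lambda>z. - f z)"
  using holomorphic_near0_mult[OF holomorphic_near0_const[of "-1"], of f] by simp

lemma holomorphic_near0_diff:
  "holomorphic_near0 f \<Longrightarrow> holomorphic_near0 g \<Longrightarrow> holomorphic_near0 (\<lambda>z. f z - g z)"
  using holomorphic_near0_add[OF _ holomorphic_near0_uminus, of f g] by simp

lemma germ_rel_refl_iff: "germ_rel f f \<longleftrightarrow> holomorphic_near0 f"
  by (simp add: germ_rel_def)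

lemma germ_rel_pointwise: "holomorphic_near0 f \<Longrightarrow> (\<And>z. f z = g z) \<Longrightarrow> germ_rel f g"
  using ext[of f g] by (metis germ_rel_refl_iff)

lemma germ_rel_binop:
  fixes f f' g g' :: "complex ^ 'n \<Rightarrow> complex"
  assumes "\<And>F G :: complex ^ 'n \<Rightarrow> complex. holomorphic_near0 F \<Longrightarrow> holomorphic_near0 G \<Longrightarrow>
      holomorphic_near0 (\<lambda>z. P (F z) (G z))"
    and "germ_rel f f'" "germ_rel g g'"
  shows "germ_rel (\<lambda>z. P (f z) (g z)) (\<lambda>z. P (f' z) (g' z))"
proof -
  have "eventually (\<lambda>z. f z = f' z) (nhds 0)" "eventually (\<lambda>z. g z = g' z) (nhds 0)"
    using assms unfolding germ_rel_def by blast+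
  then have "eventually (\<lambda>z. P (f z) (g z) = P (f' z) (g' z)) (nhds 0)"
    by eventually_elim simp
  with assms show ?thesis unfolding germ_rel_def by blast
qed

quotient_type 'n hol_germ = "complex ^ 'n \<Rightarrow> complex" / partial: germ_rel
proof (rule part_equivpI)
  show "\<exists>f :: complex ^ 'n \<Rightarrow> complex. germ_rel f f"
    unfolding germ_rel_def using holomorphic_near0_const by auto
  show "symp (germ_rel :: (complex ^ 'n \<Rightarrow> complex) \<Rightarrow> _)"
    unfolding germ_rel_def symp_def by (auto elim: eventually_mono)
  show "transp (germ_rel :: (complex ^ 'n \<Rightarrow> complex) \<Rightarrow> _)"
  proof (rule transpI)
    fix f g h :: "complex ^ 'n \<Rightarrow> complex"
    assume fg: "germ_rel f g" and gh: "germ_rel g h"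
    have "eventually (\<lambda>z. f z = g z) (nhds 0)" "eventually (\<lambda>z. g z = h z) (nhds 0)"
      using fg gh unfolding germ_rel_def by blast+
    then have "eventually (\<lambda>z. f z = h z) (nhds 0)" by eventually_elim simp
    with fg gh show "germ_rel f h" unfolding germ_rel_def by blast
  qed
qed

instantiation hol_germ :: (finite) comm_ring_1
begin

lift_definition zero_hol_germ :: "'a hol_germ" is "\<lambda>z. 0"
  by (simp add: germ_rel_def holomorphic_near0_const)

lift_definition one_hol_germ :: "'a hol_germ" is "\<lambda>z. 1"
  by (simp add: germ_rel_def holomorphic_near0_const)

lift_definition plus_hol_germ :: "'a hol_germ \<Rightarrow> 'a hol_germ \<Rightarrow> 'a hol_germ"
  is "\<lambda>f g z. f z + g z"
  by (rule germ_rel_binop[OF holomorphic_near0_add])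

lift_definition minus_hol_germ :: "'a hol_germ \<Rightarrow> 'a hol_germ \<Rightarrow> 'a hol_germ"
  is "\<lambda>f g z. f z - g z"
  by (rule germ_rel_binop[OF holomorphic_near0_diff])

lift_definition times_hol_germ :: "'a hol_germ \<Rightarrow> 'a hol_germ \<Rightarrow> 'a hol_germ"
  is "\<lambda>f g z. f z * g z"
  by (rule germ_rel_binop[OF holomorphic_near0_mult])

lift_definition uminus_hol_germ :: "'a hol_germ \<Rightarrow> 'a hol_germ"
  is "\<lambda>f z. - f z"
  using germ_rel_binop[where P = "\<lambda>x _. - x"] holomorphic_near0_uminus by blast

instance
proof
  fix a b c :: "'a hol_germ"
  note [intro] = germ_rel_pointwise holomorphic_near0_const holomorphic_near0_add
    holomorphic_near0_mult holomorphic_near0_diff holomorphic_near0_uminus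
  show "a * b * c = a * (b * c)" by transfer (auto simp: germ_rel_refl_iff mult.assoc)
  show "a * b = b * a" by transfer (auto simp: germ_rel_refl_iff mult.commute)
  show "1 * a = a" by transfer (auto simp: germ_rel_refl_iff)
  show "a + b + c = a + (b + c)" by transfer (auto simp: germ_rel_refl_iff add.assoc)
  show "a + b = b + a" by transfer (auto simp: germ_rel_refl_iff add.commute)
  show "0 + a = a" by transfer (auto simp: germ_rel_refl_iff)
  show "- a + a = 0" by transfer (auto simp: germ_rel_refl_iff)
  show "a - b = a + - b" by transfer (auto simp: germ_rel_refl_iff)
  show "(a + b) * c = a * c + b * c" by transfer (auto simp: germ_rel_refl_iff distrib_right)
  show "(0 :: 'a hol_germ) \<noteq> 1"
    by transfer (auto simp: germ_rel_def dest: eventually_nhds_x_imp_x)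
qed

end

lift_definition germ_const :: "complex \<Rightarrow> 'n::finite hol_germ" is "\<lambda>c z. c"
  by (simp add: germ_rel_def holomorphic_near0_const)

lift_definition germ_at0 :: "'n::finite hol_germ \<Rightarrow> complex" is "\<lambda>f. f 0"
  by (auto simp: germ_rel_def dest: eventually_nhds_x_imp_x)

definition max_ideal :: "'n::finite hol_germ set" where
  "max_ideal = {f. germ_at0 f = 0}"

lemma max_ideal_iff_not_unit: "f \<in> max_ideal \<longleftrightarrow> \<not> f dvd 1"
proof -
  have "germ_at0 f \<noteq> 0 \<Longrightarrow> \<exists>g. f * g = 1"
  proof transfer
    fix f :: "complex ^ 'a \<Rightarrow> complex"
    assume f: "germ_rel f f" and "f 0 \<noteq> 0"
    obtain U where U: "open U" "0 \<in> U" "holomorphic_cn f U"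
      using f unfolding germ_rel_def holomorphic_near0_def by blast
    have "continuous_on U f"
      using U unfolding holomorphic_cn_def
      by (meson continuous_at_imp_continuous_on has_derivative_continuous)
    then have op: "open (U \<inter> f -` (- {0}))"
      using U(1) by (intro continuous_open_preimage) auto
    define V where "V = U \<inter> f -` (- {0})"
    have V: "open V" "0 \<in> V" "holomorphic_cn f V" "\<forall>z\<in>V. f z \<noteq> 0"
      using op U \<open>f 0 \<noteq> 0\<close> holomorphic_cn_subset unfolding V_def by blast+
    then have g: "holomorphic_near0 (\<lambda>z. inverse (f z))"
      unfolding holomorphic_near0_def using holomorphic_cn_inverse by blast
    have "eventually (\<lambda>z. f z * inverse (f z) = 1) (nhds 0)"
      unfolding eventually_nhds using V by (intro exI[of _ V]) auto
    moreover have "holomorphic_near0 f" using f by (simp add: germ_rel_def)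
    ultimately have "germ_rel (\<lambda>z. f z * inverse (f z)) (\<lambda>z. 1)"
      unfolding germ_rel_def
      by (intro conjI holomorphic_near0_mult holomorphic_near0_const g)
    moreover have "germ_rel (\<lambda>z. inverse (f z)) (\<lambda>z. inverse (f z))"
      using g by (simp add: germ_rel_refl_iff)
    ultimately show "\<exists>g\<in>{f. germ_rel f f}. germ_rel (\<lambda>z. f z * g z) (\<lambda>z. 1)"
      by (intro bexI[of _ "\<lambda>z. inverse (f z)"]) simp_all
  qed
  then have unit: "f dvd 1" if "germ_at0 f \<noteq> 0"
    using that by (metis dvd_triv_left)
  have at0: "germ_at0 (f * g) = germ_at0 f * germ_at0 g" "germ_at0 (1 :: 'a hol_germ) = 1" for g
    by (transfer; simp)+
  have "germ_at0 f \<noteq> 0" if unit_f: "f dvd 1"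
  proof
    assume "germ_at0 f = 0"
    moreover obtain g where "1 = f * g" using unit_f by (rule dvdE)
    ultimately show False using at0 by (metis mult_zero_left zero_neq_one)
  qed
  with unit show ?thesis unfolding max_ideal_def by blast
qed

text \<open>Greatest common divisors are determined only up to units, so this is a relation.\<close>

definition is_gcd :: "'a::comm_semiring_1 \<Rightarrow> 'a \<Rightarrow> 'a \<Rightarrow> bool" where
  "is_gcd h f g \<longleftrightarrow> h dvd f \<and> h dvd g \<and> (\<forall>d. d dvd f \<and> d dvd g \<longrightarrow> d dvd h)"


section \<open>Germs of sets at the origin and their dimension\<close>

definition biholomorphic_cn ::
  "(complex ^ 'n \<Rightarrow> complex ^ 'n) \<Rightarrow> (complex ^ 'n) set \<Rightarrow> (complex ^ 'n) set \<Rightarrow> bool" where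
  "biholomorphic_cn \<phi> U V \<longleftrightarrow> open U \<and> open V \<and> bij_betw \<phi> U V \<and>
     (\<forall>i. holomorphic_cn (\<lambda>z. \<phi> z $ i) U) \<and>
     (\<forall>i. holomorphic_cn (\<lambda>w. inv_into U \<phi> w $ i) V)"

text \<open>A nonempty set that near each of its points is flattened by a biholomorphic chart of the
  ambient space to a coordinate subspace of dimension \<open>d\<close>.\<close>

definition complex_submanifold :: "nat \<Rightarrow> (complex ^ 'n) set \<Rightarrow> bool" where
  "complex_submanifold d M \<longleftrightarrow> M \<noteq> {} \<and>
     (\<forall>a\<in>M. \<exists>\<phi> U V I. a \<in> U \<and> biholomorphic_cn \<phi> U V \<and> card I = d \<and>
        \<phi> ` (M \<inter> U) = {w \<in> V. \<forall>i. i \<notin> I \<longrightarrow> w $ i = 0})"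

text \<open>The dimension of a set is the largest dimension of a submanifold contained in it
  (this is the convention of Lojasiewicz; the empty set has dimension \<open>-\<infinity>\<close>), and the
  dimension of a germ is the smallest dimension of a representative. For analytic germs this
  agrees with the dimension defined through regular points and with the Krull dimension of
  the local ring.\<close>

definition set_dim :: "(complex ^ 'n) set \<Rightarrow> ereal" where
  "set_dim E = (SUP d \<in> {d. \<exists>M. complex_submanifold d M \<and> M \<subseteq> E}. ereal (real d))"

definition set_dim_at0 :: "(complex ^ 'n) set \<Rightarrow> ereal" where
  "set_dim_at0 E = (INF U \<in> {U. open U \<and> 0 \<in> U}. set_dim (E \<inter> U))"

definition set_germ_rel :: "(complex ^ 'n) set \<Rightarrow> (complex ^ 'n) set \<Rightarrow> bool" where
  "set_germ_rel A B \<longleftrightarrow> eventually (\<lambda>z. z \<in> A \<longleftrightarrow> z \<in> B) (nhds 0)"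

quotient_type 'n set_germ = "(complex ^ 'n) set" / set_germ_rel
proof (rule equivpI)
  show "reflp (set_germ_rel :: (complex ^ 'n) set \<Rightarrow> _)"
    unfolding set_germ_rel_def reflp_def by auto
  show "symp (set_germ_rel :: (complex ^ 'n) set \<Rightarrow> _)"
    unfolding set_germ_rel_def symp_def by (auto elim: eventually_mono)
  show "transp (set_germ_rel :: (complex ^ 'n) set \<Rightarrow> _)"
  proof (rule transpI)
    fix A B C :: "(complex ^ 'n) set"
    assume "set_germ_rel A B" "set_germ_rel B C"
    then show "set_germ_rel A C" unfolding set_germ_rel_def by eventually_elim simp
  qed
qed

lemma set_dim_mono: "A \<subseteq> B \<Longrightarrow> set_dim A \<le> set_dim B"
  unfolding set_dim_def by (rule SUP_subset_mono) auto

lemma set_dim_at0_le: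
  fixes A B :: "(complex ^ 'n) set"
  assumes "set_germ_rel A B"
  shows "set_dim_at0 A \<le> set_dim_at0 B"
proof -
  obtain W where W: "open W" "0 \<in> W" "\<And>z. z \<in> W \<Longrightarrow> z \<in> A \<longleftrightarrow> z \<in> B"
    using assms unfolding set_germ_rel_def eventually_nhds by auto
  show ?thesis
    unfolding set_dim_at0_def
  proof (rule INF_mono)
    fix U :: "(complex ^ 'n) set" assume "U \<in> {U. open U \<and> 0 \<in> U}"
    then show "\<exists>V \<in> {U. open U \<and> 0 \<in> U}. set_dim (A \<inter> V) \<le> set_dim (B \<inter> U)"
      using W by (intro bexI[of _ "U \<inter> W"] set_dim_mono) auto
  qed
qed

lift_definition germ_dim :: "'n::finite set_germ \<Rightarrow> ereal" is set_dim_at0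
proof -
  fix A B :: "(complex ^ 'n) set" assume *: "set_germ_rel A B"
  then have "set_germ_rel B A" by (simp add: set_germ_rel_def eq_commute)
  with * show "set_dim_at0 A = set_dim_at0 B" using set_dim_at0_le by (metis antisym)
qed

lift_definition germ_Int :: "'n::finite set_germ \<Rightarrow> 'n set_germ \<Rightarrow> 'n set_germ" is "(\<inter>)"
proof -
  fix A A' B B' :: "(complex ^ 'n) set"
  assume "set_germ_rel A A'" "set_germ_rel B B'"
  then show "set_germ_rel (A \<inter> B) (A' \<inter> B')"
    unfolding set_germ_rel_def by eventually_elim simp
qed

lift_definition zero_germ :: "'n::finite hol_germ \<Rightarrow> 'n set_germ" is "\<lambda>f. {z. f z = 0}"
  by (auto simp: germ_rel_def set_germ_rel_def elim: eventually_mono)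


section \<open>Locally open map germs\<close>

text \<open>\<open>U\<close> need not lie in the domain of holomorphy of the representatives: the condition is
  monotone in \<open>U\<close>, so it holds for all neighbourhoods iff it holds for the small ones.
  \<open>complex \<times> complex\<close> carries the product topology of \<open>\<complex>\<close>-squared.\<close>

definition locally_open0 ::
  "(complex ^ 'n \<Rightarrow> complex) \<Rightarrow> (complex ^ 'n \<Rightarrow> complex) \<Rightarrow> bool" where
  "locally_open0 f g \<longleftrightarrow>
     (\<forall>U. open U \<and> 0 \<in> U \<longrightarrow> (0, 0) \<in> interior ((\<lambda>z. (f z, g z)) ` U))"

lemma locally_open0_cong:
  fixes f g f' g' :: "complex ^ 'n \<Rightarrow> complex"
  assumes "eventually (\<lambda>z. f z = f' z) (nhds 0)" "eventually (\<lambda>z. g z = g' z) (nhds 0)"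
    and "locally_open0 f g"
  shows "locally_open0 f' g'"
  unfolding locally_open0_def
proof (intro allI impI)
  fix U :: "(complex ^ 'n) set" assume U: "open U \<and> 0 \<in> U"
  have "eventually (\<lambda>z. f z = f' z \<and> g z = g' z) (nhds 0)"
    using assms by (auto intro: eventually_conj)
  then obtain W where W: "open W" "0 \<in> W" "\<And>z. z \<in> W \<Longrightarrow> f z = f' z \<and> g z = g' z"
    unfolding eventually_nhds by auto
  have "(0, 0) \<in> interior ((\<lambda>z. (f z, g z)) ` (U \<inter> W))"
    using assms(3) U W unfolding locally_open0_def by auto
  moreover have "(\<lambda>z. (f z, g z)) ` (U \<inter> W) \<subseteq> (\<lambda>z. (f' z, g' z)) ` U"
    using W(3) by force
  ultimately show "(0, 0) \<in> interior ((\<lambda>z. (f' z, g' z)) ` U)"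
    using interior_mono by blast
qed

lift_definition germ_locally_open :: "'n::finite hol_germ \<Rightarrow> 'n hol_germ \<Rightarrow> bool" is locally_open0
proof -
  fix f f' g g' :: "complex ^ 'n \<Rightarrow> complex"
  assume "germ_rel f f'" "germ_rel g g'"
  then have "eventually (\<lambda>z. f z = f' z) (nhds 0)" "eventually (\<lambda>z. g z = g' z) (nhds 0)"
    and "eventually (\<lambda>z. f' z = f z) (nhds 0)" "eventually (\<lambda>z. g' z = g z) (nhds 0)"
    by (simp_all add: germ_rel_def eq_commute)
  then show "locally_open0 f g = locally_open0 f' g'"
    using locally_open0_cong by blast
qed

end

theory Submission
  imports Defs "HOL-Complex_Analysis.Complex_Analysis"
    "HOL-Computational_Algebra.Fundamental_Theorem_Algebra"
begin

text \<open>For a unit vector \<open>q = (a, b)\<close> put \<open>F = b fhat - a ghat\<close> and \<open>k = cnj a fhat + cnj b ghat\<close>. On the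
  hypersurface \<open>F = 0\<close> the map \<open>(f, g)\<close> equals \<open>(h k) q\<close>, so it suffices to solve \<open>F = 0\<close>, \<open>h k = s\<close> for
  all small \<open>s\<close>, uniformly for \<open>q\<close> in the compact unit sphere. The dimension hypothesis says that
  \<open>F\<close> and \<open>h\<close> have no common component, and the gcd hypothesis that \<open>F\<close> and \<open>k\<close> have none (they
  span the same space as \<open>fhat\<close> and \<open>ghat\<close>); hence there is a plane through the origin on which
  the origin is an isolated common zero of \<open>F\<close> and \<open>h k\<close>. In that plane the maximum principle on the
  curve \<open>F = 0\<close>, applied to \<open>1 / (h k - s)\<close>, yields a solution, with bounds that persist for
  nearby \<open>q\<close>.

  That two functions without common factor have no common component is proved without the
  factoriality of the ring of germs: a common component contains the graph of a
  holomorphic function, whose minimal polynomial divides both functions by Weierstrass division.\<close>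


section \<open>Holomorphic functions of several variables\<close>

text \<open>Every nonzero value is \<open>s q\<close> with a unit vector \<open>q\<close>, so the
  image contains a ball once a disc of values \<open>s\<close>, of radius independent of
  \<open>q\<close>, is reached in each direction; compactness supplies the independence.

  The obstacle is to find the plane without irreducible components or dimension theory. Fix a
  direction \<open>v\<close> on which \<open>F\<close> is not identically zero, and consider the
  lines parallel to \<open>v\<close>, indexed by base points \<open>x\<close>. If \<open>F\<close>
  and \<open>h k\<close> had a common zero near the origin on each of these lines, some branch of
  zeros of \<open>F\<close> would be a holomorphic graph over an open set of \<open>x\<close> on
  which \<open>h\<close> or \<open>k\<close> vanishes. Such a graph in \<open>h = 0\<close> contains
  a submanifold of dimension n - 1; one in \<open>k = 0\<close> yields a common factor. Hence the
  product of \<open>h k\<close> over the zeros of \<open>F\<close>, which is holomorphic in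
  \<open>x\<close> because symmetric functions of the zeros are, does not vanish identically. It is
  nonzero on a punctured disc of some line through the origin, which spans the plane together with
  \<open>v\<close>.\<close>

lemma continuous_on_compose_pair:
  assumes "continuous_on (A \<times> B) (\<lambda>(x, y). F x y)"
    and "continuous_on S f" and "continuous_on S g"
    and "\<And>s. s \<in> S \<Longrightarrow> f s \<in> A \<and> g s \<in> B"
  shows "continuous_on S (\<lambda>s. F (f s) (g s))"
  using continuous_on_compose2[OF assms(1) continuous_on_Pair[OF assms(2,3)]] assms(4)
  by (auto simp: image_subset_iff)

section \<open>Circle integrals that depend on parameters\<close>

lemma circlepath_in_sphere: "0 \<le> r \<Longrightarrow> circlepath c r x \<in> sphere c r"
  by (simp add: circlepath dist_norm norm_mult norm_exp_eq_Re)

lemma continuous_on_contour_integral_circlepath: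
  assumes "continuous_on (P \<times> sphere c r) (\<lambda>(p, u). h p u)" and "0 \<le> r"
  shows "continuous_on P (\<lambda>p. contour_integral (circlepath c r) (h p))"
proof -
  have "continuous_on (P \<times> cbox 0 1) (\<lambda>(p, t). h p (circlepath c r t) *
      vector_derivative (circlepath c r) (at t))"
    unfolding split_beta vector_derivative_circlepath
    by (intro continuous_intros continuous_on_compose2[OF assms(1),
          where f = "\<lambda>z. (fst z, circlepath c r (snd z))", unfolded split_beta fst_conv snd_conv])
      (auto simp: circlepath circlepath_in_sphere[OF assms(2), unfolded circlepath] simp del: mem_sphere
        intro!: continuous_intros)
  from integral_continuous_on_param[OF this] show ?thesis
    by (simp add: contour_integral_integral)
qed

text \<open>Cauchy's formula on one fixed circle around \<open>y0\<close> expresses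
  \<open>deriv (g k) y\<close> for all nearby \<open>y\<close>, and its integrand is jointly
  continuous. Differentiation under the integral sign and the additivity in Osgood's lemma both rely
  on this joint continuity.\<close>

lemma continuous_on_deriv_param:
  fixes g :: "'a::metric_space \<Rightarrow> complex \<Rightarrow> complex"
  assumes cont: "continuous_on (K \<times> S) (\<lambda>(k, y). g k y)" and "open S"
    and hol: "\<And>k. k \<in> K \<Longrightarrow> g k holomorphic_on S"
  shows "continuous_on (K \<times> S) (\<lambda>(k, y). deriv (g k) y)"
  unfolding continuous_on_eq_continuous_within
proof
  fix p assume p: "p \<in> K \<times> S"
  then obtain k0 y0 where p_eq: "p = (k0, y0)" "k0 \<in> K" "y0 \<in> S" by auto
  then obtain r where r: "r > 0" "cball y0 r \<subseteq> S"
    using \<open>open S\<close> open_contains_cball by blast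
  have sph: "sphere y0 r \<subseteq> S" "ball y0 r \<subseteq> S" using r(2) by auto
  have c: "continuous_on ((K \<times> ball y0 r) \<times> sphere y0 r) (\<lambda>(q, u). g (fst q) u / (u - snd q)\<^sup>2)"
    unfolding split_beta using sph
    by (intro continuous_intros continuous_on_compose2[OF cont,
          where f = "\<lambda>z. (fst (fst z), snd z)", unfolded split_beta fst_conv snd_conv]) 
       (auto simp: dist_norm)
  have eq: "deriv (g k) y = contour_integral (circlepath y0 r) (\<lambda>u. g k u / (u - y)\<^sup>2) / (2 * pi * \<i>)"
    if "k \<in> K" "y \<in> ball y0 r" for k y
  proof -
    have "continuous_on (cball y0 r) (g k)" "g k holomorphic_on ball y0 r"
      using hol[OF that(1)] r(2) sph holomorphic_on_subset holomorphic_on_imp_continuous_on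
      by blast+
    from Cauchy_contour_integral_circlepath_2[OF this that(2)] show ?thesis
      by (simp add: field_simps)
  qed
  have "continuous_on (K \<times> ball y0 r) (\<lambda>(k, y). deriv (g k) y)"
    using continuous_on_contour_integral_circlepath[OF c] r(1)
    by (subst continuous_on_cong[OF refl, where g = "\<lambda>q. contour_integral (circlepath y0 r)
         (\<lambda>u. g (fst q) u / (u - snd q)\<^sup>2) / (2 * pi * \<i>)"]) (auto simp: eq intro!: continuous_intros)
  then have "continuous (at p within K \<times> ball y0 r) (\<lambda>(k, y). deriv (g k) y)"
    using p_eq r(1) by (simp add: continuous_on_eq_continuous_within)
  moreover have "at p within K \<times> S = at p within K \<times> ball y0 r"
    by (rule at_within_nhd[of _ "UNIV \<times> ball y0 r"]) (use p_eq r sph in \<open>auto intro!: open_Times\<close>)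
  ultimately show "continuous (at p within K \<times> S) (\<lambda>(k, y). deriv (g k) y)" by simp
qed

lemma holomorphic_on_contour_integral_circlepath:
  assumes cont: "continuous_on (U \<times> sphere c r) (\<lambda>(t, u). h t u)" and "0 \<le> r" and "open U"
    and hol: "\<And>u. u \<in> sphere c r \<Longrightarrow> (\<lambda>t. h t u) holomorphic_on U"
  shows "(\<lambda>t. contour_integral (circlepath c r) (h t)) holomorphic_on U"
proof -
  have "\<exists>B. open B \<and> z \<in> B \<and> (\<lambda>t. contour_integral (circlepath c r) (h t)) holomorphic_on B"
    if z: "z \<in> U" for z
  proof -
    obtain d where d: "d > 0" "ball z d \<subseteq> U" using \<open>open U\<close> z open_contains_ball by blast
    have swap: "continuous_on (sphere c r \<times> U) (\<lambda>(u, t). h t u)"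
      unfolding split_beta by (intro continuous_on_compose_pair[OF cont] continuous_intros) auto
    have cderiv: "continuous_on (sphere c r \<times> U) (\<lambda>(u, t). deriv (\<lambda>t. h t u) t)"
      using swap \<open>open U\<close> hol by (rule continuous_on_deriv_param)
    have in_sphere: "circlepath c r x \<in> sphere c r" for x
      using \<open>0 \<le> r\<close> by (rule circlepath_in_sphere)
    have "(\<lambda>t. integral (cbox 0 1) (\<lambda>x. h t (circlepath c r x) *
      (2 * pi * \<i> * r * exp (2 * of_real pi * \<i> * of_real x)))) holomorphic_on ball z d"
    proof (rule leibniz_rule_holomorphic[where fx = "\<lambda>t x. deriv (\<lambda>t. h t (circlepath c r x)) t *
      (2 * pi * \<i> * r * exp (2 * of_real pi * \<i> * of_real x))"])
      fix t :: complex and x :: real assume t: "t \<in> ball z d"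
      have "((\<lambda>t. h t (circlepath c r x)) has_field_derivative
          deriv (\<lambda>t. h t (circlepath c r x)) t) (at t)"
        using hol[OF in_sphere] \<open>open U\<close> t d holomorphic_derivI by blast
      from has_field_derivative_at_within[OF DERIV_cmult_right[OF this]]
      show "((\<lambda>t. h t (circlepath c r x) * (2 * pi * \<i> * r * exp (2 * of_real pi * \<i> * of_real x)))
        has_field_derivative deriv (\<lambda>t. h t (circlepath c r x)) t *
          (2 * pi * \<i> * r * exp (2 * of_real pi * \<i> * of_real x))) (at t within ball z d)" .
    next
      fix t assume t: "t \<in> ball z d"
      show "(\<lambda>x. h t (circlepath c r x) * (2 * pi * \<i> * r * exp (2 * of_real pi * \<i> * of_real x)))
          integrable_on cbox 0 1"
        using t d in_sphere
        by (intro integrable_continuous continuous_intros continuous_on_compose2[OF cont,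
          where f = "\<lambda>x. (t, circlepath c r x)", unfolded split_beta fst_conv snd_conv])
          (auto simp: circlepath simp del: mem_sphere intro!: continuous_intros)
    next
      show "continuous_on (ball z d \<times> cbox 0 1) (\<lambda>(t, x). deriv (\<lambda>t. h t (circlepath c r x)) t *
          (2 * pi * \<i> * r * exp (2 * of_real pi * \<i> * of_real x)))"
        unfolding split_beta using d in_sphere
        by (intro continuous_intros continuous_on_compose2[OF cderiv,
          where f = "\<lambda>z. (circlepath c r (snd z), fst z)", unfolded split_beta fst_conv snd_conv])
          (auto simp: circlepath simp del: mem_sphere intro!: continuous_intros)
    qed auto
    then show ?thesis using d
      by (intro exI[of _ "ball z d"]) (simp add: contour_integral_integral vector_derivative_circlepath)
  qed
  then show ?thesis
    by (subst analytic_on_open[OF \<open>open U\<close>, symmetric], subst analytic_on_analytic_at)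
      (auto simp: analytic_at)
qed

section \<open>Restriction to complex lines and Osgood's lemma\<close>

lemma bounded_linear_complex_scale: "bounded_linear (\<lambda>t::complex. t *s (v :: complex ^ 'n))"
  by (subst linear_conv_bounded_linear[symmetric], rule linearI)
    (simp_all add: vec_eq_iff algebra_simps)

lemma norm_complex_scale: "norm (t *s (v :: complex ^ 'n)) = norm t * norm v"
  by (simp add: norm_vec_def norm_mult L2_set_right_distrib)

lemma continuous_on_complex_scale [continuous_intros]:
  assumes "continuous_on A f" and "continuous_on A g"
  shows "continuous_on A (\<lambda>x. f x *s (g x :: complex ^ 'n))"
  unfolding vector_scalar_mult_def using assms
  by (intro continuous_on_vec_lambda continuous_intros) auto

lemma open_line_vimage:
  "open U \<Longrightarrow> open {t. a + t *s (v :: complex ^ 'n) \<in> U}"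
  by (rule open_vimage[of U "\<lambda>t. a + t *s v", unfolded vimage_def]) (auto intro!: continuous_intros)

lemma holomorphic_cn_line:
  assumes "holomorphic_cn f U"
  shows "(\<lambda>t. f (a + t *s v)) holomorphic_on {t. a + t *s v \<in> U}"
proof (rule holomorphic_onI)
  fix t assume "t \<in> {t. a + t *s v \<in> U}"
  then obtain D where D: "(f has_derivative D) (at (a + t *s v))" "\<forall>c v. D (c *s v) = c * D v"
    using assms unfolding holomorphic_cn_def by auto
  have "((\<lambda>t. a + t *s v) has_derivative (\<lambda>t. 0 + t *s v)) (at t)"
    by (intro has_derivative_add has_derivative_const bounded_linear_imp_has_derivative
        bounded_linear_complex_scale)
  from has_derivative_compose[OF this D(1)] D(2)
  have "((\<lambda>t. f (a + t *s v)) has_derivative (\<lambda>t. D v * t)) (at t)"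
    by (simp add: mult.commute)
  then show "(\<lambda>t. f (a + t *s v)) field_differentiable (at t within {t. a + t *s v \<in> U})"
    using field_differentiable_at_within field_differentiable_def has_field_derivative_def by blast
qed

lemma holomorphic_cn_imp_continuous_on: "holomorphic_cn f U \<Longrightarrow> continuous_on U f"
  unfolding holomorphic_cn_def
  by (meson continuous_at_imp_continuous_on has_derivative_continuous)

text \<open>Discs of radius \<open>K / 4\<close> about points of \<open>cball 0 (K / 2)\<close> stay
  inside \<open>ball 0 K\<close>, so Cauchy's inequality bounds the second derivative by
  \<open>fact 2 * B / (K / 4) ^ 2\<close>, which is the constant of the statement. Its explicit
  dependence on \<open>K\<close> later makes the bound uniform over directions.\<close>

lemma holomorphic_taylor1_bound:
  assumes "f holomorphic_on ball 0 K" and "0 < K" and bd: "\<And>z. z \<in> ball 0 K \<Longrightarrow> norm (f z) \<le> B"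
    and s: "norm s \<le> K / 2"
  shows "norm (f s - f 0 - deriv f 0 * s) \<le> 32 * B / K\<^sup>2 * (norm s)\<^sup>2"
proof -
  have d2: "norm ((deriv ^^ 2) f w) \<le> 32 * B / K\<^sup>2" if "w \<in> cball 0 (K / 2)" for w
  proof -
    have sub: "cball w (K / 4) \<subseteq> ball 0 K"
      using that \<open>0 < K\<close> by (subst cball_subset_ball_iff) (auto simp: dist_norm)
    have "norm ((deriv ^^ 2) f w) \<le> fact 2 * B / (K / 4) ^ 2"
    proof (rule Cauchy_inequality)
      show "f holomorphic_on ball w (K/4)" "continuous_on (cball w (K/4)) f"
        using sub ball_subset_cball assms(1) holomorphic_on_subset holomorphic_on_imp_continuous_on
        by blast+
      show "norm (f x) \<le> B" if "norm (w - x) = K / 4" for x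
        using that sub by (intro bd) (auto simp: dist_norm)
    qed (use \<open>0 < K\<close> in auto)
    then show ?thesis by (simp add: power_divide mult.commute)
  qed
  have der: "((deriv ^^ i) f has_field_derivative (deriv ^^ Suc i) f w) (at w within cball 0 (K / 2))"
    if "w \<in> cball 0 (K / 2)" for i w
  proof -
    have "(deriv ^^ i) f holomorphic_on ball 0 K" "w \<in> ball 0 K"
      using assms(1,2) that by (auto intro: holomorphic_higher_deriv)
    from holomorphic_derivI[OF this(1) open_ball this(2)] show ?thesis
      by (simp add: has_field_derivative_at_within)
  qed
  have "norm (f s - (\<Sum>i\<le>1. (deriv ^^ i) f 0 * (s - 0) ^ i / fact i))
      \<le> 32 * B / K\<^sup>2 * norm (s - 0) ^ (Suc 1) / fact 1"
  proof (rule complex_Taylor[where S = "cball 0 (K / 2)" and f = "\<lambda>i. (deriv ^^ i) f", unfolded funpow_0])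
    show "norm ((deriv ^^ Suc 1) f w) \<le> 32 * B / K\<^sup>2" if "w \<in> cball 0 (K / 2)" for w
      using d2[OF that] by (simp add: numeral_2_eq_2)
  qed (use der s \<open>0 < K\<close> in auto)
  then show ?thesis by (simp add: diff_diff_eq power2_eq_square)
qed

text \<open>Osgood's lemma: the derivative along lines is linear because it depends continuously on
  the base point, and the first-order Taylor remainder is quadratic uniformly in the direction.\<close>

lemma holomorphic_cnI_lines:
  fixes f :: "complex ^ 'n \<Rightarrow> complex"
  assumes "open U" and cont: "continuous_on U f"
    and lines: "\<And>a v. (\<lambda>t. f (a + t *s v)) holomorphic_on {t. a + t *s v \<in> U}"
  shows "holomorphic_cn f U"
  unfolding holomorphic_cn_def
proof
  fix z assume "z \<in> U"
  then obtain R where R: "R > 0" "cball z R \<subseteq> U" using \<open>open U\<close> open_contains_cball by blast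
  then obtain B where B: "\<And>x. x \<in> cball z R \<Longrightarrow> norm (f x) \<le> B"
    by (metis compact_cball compact_continuous_image compact_imp_bounded bounded_iff image_eqI
        cont continuous_on_subset)
  define D where "D x v = deriv (\<lambda>t. f (x + t *s v)) 0" for x v
  \<comment> \<open>With \<open>K = R / (2 * norm v)\<close> below,
    \<open>32 * B / K\<^sup>2 * (norm s)\<^sup>2\<close> becomes
    \<open>C * (norm (s *s v))\<^sup>2\<close>: the constant does not depend on the direction
    \<open>v\<close>.\<close>
  define C where "C = 128 * B / R\<^sup>2"
  have taylor: "norm (f (x + s *s v) - f x - s * D x v) \<le> C * (norm (s *s v))\<^sup>2"
    if x: "x \<in> ball z (R / 2)" and sv: "norm (s *s v) \<le> R / 4" for x v s
  proof (cases "v = 0")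
    case True
    then show ?thesis by (simp add: D_def)
  next
    case False
    define K where "K = R / (2 * norm v)"
    have K: "K > 0" using R False by (simp add: K_def)
    have mem: "x + t *s v \<in> cball z R" if "t \<in> ball 0 K" for t
    proof -
      have "norm (t *s v) \<le> R / 2"
        using that False by (simp add: norm_complex_scale K_def field_simps)
      moreover have "dist z (x + t *s v) \<le> dist z x + norm (t *s v)"
        using dist_triangle[of z "x + t *s v" x] by (simp add: dist_norm)
      ultimately show ?thesis using x by simp
    qed
    have "norm (f (x + s *s v) - f (x + 0 *s v) - D x v * s) \<le> 32 * B / K\<^sup>2 * (norm s)\<^sup>2"
      unfolding D_def
    proof (rule holomorphic_taylor1_bound[OF _ K])
      show "(\<lambda>t. f (x + t *s v)) holomorphic_on ball 0 K"
        using lines by (rule holomorphic_on_subset) (use mem R in auto)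
      show "norm s \<le> K / 2"
        using sv False by (simp add: norm_complex_scale K_def field_simps)
    qed (use mem B in auto)
    also have "32 * B / K\<^sup>2 * (norm s)\<^sup>2 = C * (norm (s *s v))\<^sup>2"
      by (simp add: K_def C_def norm_complex_scale field_simps power_mult_distrib)
    finally show ?thesis by (simp add: mult.commute)
  qed
  have quot: "((\<lambda>t. (f (z + t *s v) - f z) / t) \<longlongrightarrow> D z v) (at 0)" for v
  proof -
    have "open {t. z + t *s v \<in> U}" "0 \<in> {t. z + t *s v \<in> U}"
      using open_line_vimage \<open>open U\<close> \<open>z \<in> U\<close> by auto
    then have "((\<lambda>t. f (z + t *s v)) has_field_derivative D z v) (at 0)"
      unfolding D_def using holomorphic_derivI lines by blast
    then show ?thesis by (simp add: DERIV_def)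
  qed
  have scale: "D z (c *s v) = c * D z v" for c v
  proof (cases "c = 0")
    case True
    then show ?thesis by (simp add: D_def)
  next
    case False
    have "((\<lambda>t. (f (z + (c * t) *s v) - f z) / (c * t)) \<longlongrightarrow> D z v) (at 0)"
      by (rule filterlim_compose[OF quot], rule filterlim_atI)
         (use False in \<open>auto intro!: tendsto_eq_intros simp: eventually_at_filter\<close>)
    from tendsto_mult[OF tendsto_const[of c] this]
    have "((\<lambda>t. (f (z + t *s (c *s v)) - f z) / t) \<longlongrightarrow> c * D z v) (at 0)"
      using False by (simp add: mult.commute)
    from tendsto_unique[OF _ quot this] show ?thesis by simp
  qed
  have add: "D z (u + w) = D z u + D z w" for u w
  proof -
    define K where "K = {s. z + s *s u \<in> ball z (R / 2)}"
    have opK: "open K" "0 \<in> K" using R open_line_vimage[of "ball z (R / 2)"] by (auto simp: K_def simp del: mem_ball)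
    obtain S where S: "open S" "0 \<in> S" "\<And>s t. s \<in> K \<Longrightarrow> t \<in> S \<Longrightarrow> z + s *s u + t *s w \<in> U"
    proof
      show "open {t. t *s w \<in> ball 0 (R / 2)}" using open_line_vimage[of "ball 0 (R/2)" 0 w] by simp
      fix s t assume st: "s \<in> K" "t \<in> {t. t *s w \<in> ball 0 (R / 2)}"
      have "dist z (z + s *s u + t *s w) \<le> norm (s *s u) + norm (t *s w)"
        by (metis add.assoc add_diff_cancel_left' dist_commute dist_norm norm_triangle_ineq)
      then have "z + s *s u + t *s w \<in> cball z R" using st by (simp add: K_def dist_norm)
      then show "z + s *s u + t *s w \<in> U" using R by blast
    qed (use R in auto)
    have "continuous_on (K \<times> S) (\<lambda>(s, t). deriv (\<lambda>t. f (z + s *s u + t *s w)) t)"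
    proof (rule continuous_on_deriv_param[OF _ S(1)])
      show "continuous_on (K \<times> S) (\<lambda>(s, t). f (z + s *s u + t *s w))"
        unfolding split_beta using S(3)
        by (intro continuous_on_compose2[OF cont] continuous_intros) auto
      show "(\<lambda>t. f (z + s *s u + t *s w)) holomorphic_on S" if "s \<in> K" for s
        using lines by (rule holomorphic_on_subset) (use S(3) that in auto)
    qed
    then have "continuous_on K (\<lambda>s. D (z + s *s u) w)"
      unfolding D_def
      by (rule continuous_on_compose_pair) (use S(2) in \<open>auto intro!: continuous_intros\<close>)
    then have "isCont (\<lambda>s. D (z + s *s u) w) 0"
      using opK continuous_on_eq_continuous_at by blast
    then have Dlim: "((\<lambda>s. D (z + s *s u) w) \<longlongrightarrow> D z w) (at 0)"
      by (simp add: isCont_def)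
    have ev: "\<forall>\<^sub>F t in at 0. t \<noteq> 0 \<and> z + t *s u \<in> ball z (R / 2) \<and> norm (t *s w) \<le> R / 4"
    proof -
      have "open (K \<inter> {t. 0 + t *s w \<in> ball 0 (R / 4)})" using opK by (intro open_Int open_line_vimage) auto
      then have "\<forall>\<^sub>F t in at 0. t \<in> K \<inter> {t. 0 + t *s w \<in> ball 0 (R / 4)} - {0}"
        using R opK by (intro eventually_at_in_open) auto
      then show ?thesis by eventually_elim (auto simp: K_def)
    qed
    \<comment> \<open>The quotient along \<open>u + w\<close> splits into one along \<open>w\<close>
      from the moving point \<open>z + t *s u\<close> and one along \<open>u\<close> from
      \<open>z\<close>. The first is compared with \<open>D\<close> at the moving point by the
      uniform remainder bound; \<open>Dlim\<close> then brings that point back to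
      \<open>z\<close>.\<close>
    have "((\<lambda>t. (f (z + t *s u + t *s w) - f (z + t *s u)) / t - D (z + t *s u) w) \<longlongrightarrow> 0) (at 0)"
    proof (rule tendsto_norm_zero_cancel, rule tendsto_sandwich[OF _ _ tendsto_const])
      show "\<forall>\<^sub>F t in at 0. norm ((f (z + t *s u + t *s w) - f (z + t *s u)) / t - D (z + t *s u) w)
          \<le> C * (norm w)\<^sup>2 * norm t"
        using ev
      proof eventually_elim
        case (elim t)
        then have "norm (f (z + t *s u + t *s w) - f (z + t *s u) - t * D (z + t *s u) w)
            \<le> C * (norm (t *s w))\<^sup>2" by (intro taylor) auto
        moreover have "(f (z + t *s u + t *s w) - f (z + t *s u)) / t - D (z + t *s u) w =
          (f (z + t *s u + t *s w) - f (z + t *s u) - t * D (z + t *s u) w) / t"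
          using elim by (simp add: field_simps)
        ultimately show ?case using elim
          by (simp add: norm_divide norm_complex_scale power2_eq_square field_simps)
      qed
      show "((\<lambda>t. C * (norm w)\<^sup>2 * norm t) \<longlongrightarrow> 0) (at 0)"
        by (auto intro!: tendsto_eq_intros)
    qed auto
    from tendsto_add[OF this tendsto_add[OF Dlim quot[of u]]]
    have "((\<lambda>t. (f (z + t *s u + t *s w) - f (z + t *s u)) / t + (f (z + t *s u) - f z) / t)
        \<longlongrightarrow> D z w + D z u) (at 0)" by (simp add: algebra_simps)
    then have "((\<lambda>t. (f (z + t *s (u + w)) - f z) / t) \<longlongrightarrow> D z w + D z u) (at 0)"
      by (simp add: add_divide_distrib[symmetric] vector_add_ldistrib add.assoc)
    from tendsto_unique[OF _ quot this] show ?thesis by simp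
  qed
  have "linear (D z)"
  proof (rule linearI)
    fix r :: real and v show "D z (r *\<^sub>R v) = r *\<^sub>R D z v"
      using scale[of "of_real r" v] by (simp add: scaleR_conv_of_real vector_scalar_mult_def scaleR_vec_def)
  qed (rule add)
  then have bl: "bounded_linear (D z)" by (rule linear_linear[THEN iffD1, OF _] linear_conv_bounded_linear[THEN iffD1])
  have "(f has_derivative D z) (at z)"
    unfolding has_derivative_at
  proof (intro conjI bl)
    have ev: "\<forall>\<^sub>F h in at 0. h \<in> ball (0 :: complex ^ 'n) (R / 4) - {0}"
      using R by (intro eventually_at_in_open) auto
    show "(\<lambda>h. norm (f (z + h) - f z - D z h) / norm h) \<midarrow>0\<rightarrow> 0"
    proof (rule tendsto_sandwich[OF _ _ tendsto_const])
      show "\<forall>\<^sub>F h in at 0. norm (f (z + h) - f z - D z h) / norm h \<le> C * norm h"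
        using ev
      proof eventually_elim
        case (elim h)
        then show ?case using taylor[of z 1 h] R
          by (simp add: power2_eq_square field_simps)
      qed
      show "((\<lambda>h::complex ^ 'n. C * norm h) \<longlongrightarrow> 0) (at 0)" by (auto intro!: tendsto_eq_intros)
    qed auto
  qed
  with scale show "\<exists>D. (f has_derivative D) (at z) \<and> (\<forall>c v. D (c *s v) = c * D v)" by blast
qed

lemma holomorphic_cn_contour_integral_circlepath:
  fixes h :: "complex ^ 'n \<Rightarrow> complex \<Rightarrow> complex"
  assumes cont: "continuous_on (X \<times> sphere c r) (\<lambda>(x, u). h x u)" and "0 \<le> r" and "open X"
    and hol: "\<And>u. u \<in> sphere c r \<Longrightarrow> holomorphic_cn (\<lambda>x. h x u) X"
  shows "holomorphic_cn (\<lambda>x. contour_integral (circlepath c r) (h x)) X"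
proof (rule holomorphic_cnI_lines[OF \<open>open X\<close>])
  show "continuous_on X (\<lambda>x. contour_integral (circlepath c r) (h x))"
    by (rule continuous_on_contour_integral_circlepath) fact+
  show "(\<lambda>t. contour_integral (circlepath c r) (h (a + t *s v))) holomorphic_on {t. a + t *s v \<in> X}"
    for a v
    unfolding split_beta
    by (intro holomorphic_on_contour_integral_circlepath open_line_vimage holomorphic_cn_line hol
        assms(2,3), unfold split_beta, intro continuous_on_compose_pair[OF cont] continuous_intros)
       auto
qed


section \<open>Zeros of holomorphic families of functions\<close>

text \<open>Half of the minimum over \<open>K\<close> at \<open>x0\<close> survives, by uniform
  continuity on \<open>cball x0 r \<times> K\<close>. The parameter \<open>x\<close> is either a
  base point, to keep zeros off a fixed circle, or a vector \<open>q\<close>, to obtain the bounds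
  that persist for nearby \<open>q\<close>.\<close>

lemma compact_bounded_below_nhd:
  fixes F :: "'a::heine_borel \<Rightarrow> 'b::metric_space \<Rightarrow> complex"
  assumes "open X" and "x0 \<in> X" and "compact K" and cont: "continuous_on (X \<times> K) (\<lambda>(x, y). F x y)"
    and nz: "\<And>y. y \<in> K \<Longrightarrow> F x0 y \<noteq> 0"
  obtains d c where "d > 0" "ball x0 d \<subseteq> X" "c > 0"
    "\<And>x y. x \<in> ball x0 d \<Longrightarrow> y \<in> K \<Longrightarrow> c \<le> norm (F x y)"
proof -
  obtain r where r: "r > 0" "cball x0 r \<subseteq> X"
    using assms(1,2) open_contains_cball by blast
  show ?thesis
  proof (cases "K = {}")
    case True
    then show ?thesis using r by (intro that[of r 1]) auto
  next
    case False
    have "uniformly_continuous_on (cball x0 r \<times> K) (\<lambda>(x, y). F x y)"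
      using r \<open>compact K\<close>
      by (intro compact_uniformly_continuous continuous_on_subset[OF cont] compact_Times) auto
    moreover have "continuous_on K (\<lambda>y. norm (F x0 y))"
      by (intro continuous_on_norm continuous_on_compose_pair[OF cont] continuous_intros)
        (use \<open>x0 \<in> X\<close> in auto)
    then obtain y0 where y0: "y0 \<in> K" "\<And>y. y \<in> K \<Longrightarrow> norm (F x0 y0) \<le> norm (F x0 y)"
      using continuous_attains_inf[OF \<open>compact K\<close> False] by blast
    have pos: "norm (F x0 y0) / 2 > 0" using nz[OF y0(1)] by simp
    ultimately obtain d where d: "d > 0" "\<And>p q. p \<in> cball x0 r \<times> K \<Longrightarrow> q \<in> cball x0 r \<times> K \<Longrightarrow>
        dist q p < d \<Longrightarrow> dist (case q of (x, y) \<Rightarrow> F x y) (case p of (x, y) \<Rightarrow> F x y) < norm (F x0 y0) / 2"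
      unfolding uniformly_continuous_on_def by metis
    show ?thesis
    proof (rule that[of "min d r" "norm (F x0 y0) / 2"])
      show "norm (F x0 y0) / 2 \<le> norm (F x y)" if "x \<in> ball x0 (min d r)" "y \<in> K" for x y
      proof -
        have "dist (F x y) (F x0 y) < norm (F x0 y0) / 2"
          using d(2)[of "(x0, y)" "(x, y)"] that r by (auto simp: dist_prod_def dist_commute)
        moreover have "norm (F x0 y) \<le> norm (F x y) + norm (F x y - F x0 y)"
          by (metis norm_minus_commute norm_triangle_sub)
        ultimately show ?thesis using y0(2)[OF that(2)] by (simp add: dist_norm)
      qed
    qed (use r d pos in auto)
  qed
qed

lemma compact_nonzero_nhd:
  fixes F :: "'a::heine_borel \<Rightarrow> 'b::metric_space \<Rightarrow> complex"
  assumes "open X" and "x0 \<in> X" and "compact K" and "continuous_on (X \<times> K) (\<lambda>(x, y). F x y)"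
    and "\<And>y. y \<in> K \<Longrightarrow> F x0 y \<noteq> 0"
  obtains d where "d > 0" "ball x0 d \<subseteq> X" "\<And>x y. x \<in> ball x0 d \<Longrightarrow> y \<in> K \<Longrightarrow> F x y \<noteq> 0"
  using compact_bounded_below_nhd[OF assms] by (metis norm_zero not_le)

text \<open>Multiplicity is \<open>zorder\<close>, an integer, hence the \<open>nat\<close>. With
  infinitely many zeros the sum would be the empty multiset; the context below excludes this by
  requiring \<open>g\<close> to be nonzero on the circle.\<close>

definition zero_mset :: "(complex \<Rightarrow> complex) \<Rightarrow> complex \<Rightarrow> real \<Rightarrow> complex multiset" where
  "zero_mset g c r = (\<Sum>z\<in>{z \<in> ball c r. g z = 0}. replicate_mset (nat (zorder g z)) z)"

lemma image_mset_sum_replicate: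
  "finite Z \<Longrightarrow> (\<Sum>z\<in>#(\<Sum>z\<in>Z. replicate_mset (m z) z). f z) = (\<Sum>z\<in>Z. of_nat (m z) * (f z :: complex))"
  by (induction Z rule: finite_induct) simp_all

context
  fixes g :: "complex \<Rightarrow> complex" and S :: "complex set" and c :: complex and r :: real
  assumes hol: "g holomorphic_on S" and S: "open S" and sub: "cball c r \<subseteq> S" and r: "0 < r"
    and nz: "\<And>z. z \<in> sphere c r \<Longrightarrow> g z \<noteq> 0"
begin

text \<open>The zeros avoid the compact circle, so a slightly larger open disc has no further ones.
  It is the open domain on which isolatedness of zeros and the argument principle are
  applied.\<close>

lemma nonzero_disc_nhd:
  obtains R where "r < R" "ball c R \<subseteq> S" "\<And>z. z \<in> ball c R \<Longrightarrow> g z = 0 \<Longrightarrow> z \<in> ball c r"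
proof -
  have cont: "continuous_on S g" using hol by (rule holomorphic_on_imp_continuous_on)
  have op: "open (ball c r \<union> (S \<inter> g -` (- {0})))"
    by (intro open_Un open_ball continuous_open_preimage cont S) auto
  have "cball c r \<subseteq> ball c r \<union> (S \<inter> g -` (- {0}))"
    using nz sub by (auto simp: subset_iff dist_norm less_eq_real_def)
  from compact_subset_open_imp_ball_epsilon_subset[OF compact_cball op this]
  obtain e where e: "e > 0" "(\<Union>x\<in>cball c r. ball x e) \<subseteq> ball c r \<union> (S \<inter> g -` (- {0}))" by metis
  have *: "z \<in> ball c r \<union> (S \<inter> g -` (- {0}))" if z: "z \<in> ball c (r + e)" for z
  proof (cases "z \<in> cball c r")
    case True
    moreover have "z \<in> ball z e" using e by simp
    ultimately show ?thesis using e by blast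
  next
    case False
    define w where "w = c + of_real (r / norm (z - c)) * (z - c)"
    have n: "norm (z - c) > r" using False by (simp add: dist_norm norm_minus_commute)
    then have w: "norm (w - c) = r" using r by (auto simp: w_def norm_mult norm_divide)
    have "z - w = of_real (1 - r / norm (z - c)) * (z - c)"
      by (simp add: w_def algebra_simps)
    moreover have "r / norm (z - c) < 1" using n r by (simp add: divide_less_eq)
    ultimately have "norm (z - w) = (1 - r / norm (z - c)) * norm (z - c)"
      using n r by (simp only: norm_mult norm_of_real)
    moreover have "(1 - r / norm (z - c)) * norm (z - c) = norm (z - c) - r"
      using n r by (auto simp: left_diff_distrib)
    ultimately have "norm (z - w) = norm (z - c) - r" by simp
    then have "w \<in> cball c r" "z \<in> ball w e"
      using z w by (auto simp: dist_norm norm_minus_commute)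
    then show ?thesis using e by blast
  qed
  show ?thesis
  proof (rule that[of "r + e"])
    show "ball c (r + e) \<subseteq> S" using * sub ball_subset_cball[of c r] by blast
    show "z \<in> ball c r" if "z \<in> ball c (r + e)" "g z = 0" for z using *[OF that(1)] that by auto
  qed (use e in simp)
qed

lemma nonzero_on_disc: "\<exists>z\<in>sphere c r. g z \<noteq> 0"
  using nz[of "c + of_real r"] r by (intro bexI[of _ "c + of_real r"]) (auto simp: dist_norm)

lemma finite_zeros_disc: "finite {z \<in> ball c r. g z = 0}"
proof -
  obtain R where R: "r < R" "ball c R \<subseteq> S" "\<And>z. z \<in> ball c R \<Longrightarrow> g z = 0 \<Longrightarrow> z \<in> ball c r"
    using nonzero_disc_nhd by metis
  have "finite {z \<in> cball c r. g z = 0}" if "\<exists>z\<in>ball c R. g z = 0"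
  proof (rule holomorphic_compact_finite_zeros[of g "ball c R"])
    show "g holomorphic_on ball c R" using hol R(2) by (rule holomorphic_on_subset)
    show "\<not> g constant_on ball c R"
      using that nonzero_on_disc R(1) by (force simp: constant_on_def)
  qed (use R r in \<open>auto simp: cball_subset_ball_iff\<close>)
  then show ?thesis
    using R(1) by (cases "\<exists>z\<in>ball c R. g z = 0") (auto intro: finite_subset[rotated])
qed

lemma zorder_pos_disc:
  assumes "z \<in> ball c r" and "g z = 0"
  shows "zorder g z > 0"
proof -
  obtain R where R: "r < R" "ball c R \<subseteq> S" "\<And>z. z \<in> ball c R \<Longrightarrow> g z = 0 \<Longrightarrow> z \<in> ball c r"
    using nonzero_disc_nhd by metis
  have "\<exists>w\<in>ball c R. g w \<noteq> 0" using nonzero_on_disc R(1) by force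
  moreover have "z \<in> ball c R" using assms(1) R(1) by auto
  ultimately show ?thesis
    using zorder_exist_zero[OF holomorphic_on_subset[OF hol R(2)] open_ball connected_ball] assms(2)
    by presburger
qed

lemma set_zero_mset: "set_mset (zero_mset g c r) = {z \<in> ball c r. g z = 0}"
  using finite_zeros_disc zorder_pos_disc by (force simp: zero_mset_def set_mset_sum)

text \<open>The argument principle with weight \<open>\<phi>\<close>, every winding number inside
  being 1. Single zeros need not depend holomorphically on parameters, but such sums do, being
  integrals over a fixed circle: weight 1 gives the count, and powers give the power sums.\<close>

lemma sum_zero_mset:
  assumes phi: "\<phi> holomorphic_on S"
  shows "(\<Sum>z\<in>#zero_mset g c r. \<phi> z) =
    contour_integral (circlepath c r) (\<lambda>u. deriv g u * \<phi> u / g u) / (2 * pi * \<i>)"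
proof -
  obtain R where R: "r < R" "ball c R \<subseteq> S" "\<And>z. z \<in> ball c R \<Longrightarrow> g z = 0 \<Longrightarrow> z \<in> ball c r"
    using nonzero_disc_nhd by metis
  have eq: "{w \<in> ball c R. g w = 0 \<or> w \<in> {}} = {z \<in> ball c r. g z = 0}"
    using R(1,3) by auto
  have "contour_integral (circlepath c r) (\<lambda>x. deriv g x * \<phi> x / g x) = 2 * pi * \<i> *
      (\<Sum>p\<in>{w \<in> ball c R. g w = 0 \<or> w \<in> {}}. winding_number (circlepath c r) p * \<phi> p * zorder g p)"
  proof (rule argument_principle)
    show "path_image (circlepath c r) \<subseteq> ball c R - {w \<in> ball c R. g w = 0 \<or> w \<in> {}}"
      using R r nz by auto
    show "\<forall>z. z \<notin> ball c R \<longrightarrow> winding_number (circlepath c r) z = 0"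
      using R(1) r by (auto intro!: winding_number_zero_outside[where s = "cball c r"])
    show "finite {w \<in> ball c R. g w = 0 \<or> w \<in> {}}" using finite_zeros_disc eq by simp
  qed (use R hol phi holomorphic_on_subset in auto)
  also have "\<dots> = 2 * pi * \<i> * (\<Sum>p\<in>{z \<in> ball c r. g z = 0}. of_nat (nat (zorder g p)) * \<phi> p)"
  proof -
    have "winding_number (circlepath c r) p * \<phi> p * zorder g p = of_nat (nat (zorder g p)) * \<phi> p"
      if "p \<in> {z \<in> ball c r. g z = 0}" for p
    proof -
      have "norm (p - c) < r" "zorder g p > 0"
        using that zorder_pos_disc by (auto simp: dist_norm norm_minus_commute)
      then show ?thesis by (simp add: winding_number_circlepath)
    qed
    from arg_cong2[where f = "(*)", OF refl sum.cong[OF refl this]] show ?thesis unfolding eq .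
  qed
  also have "\<dots> = 2 * pi * \<i> * (\<Sum>z\<in>#zero_mset g c r. \<phi> z)"
    unfolding zero_mset_def using finite_zeros_disc by (simp add: image_mset_sum_replicate)
  finally show ?thesis by simp
qed

end

text \<open>Holomorphy in the n + 1 variables \<open>(x, y)\<close>, split into a parameter and one
  plane variable so that no space of dimension n + 1 is needed. Joint continuity is what lets circle
  integrals in \<open>y\<close> inherit holomorphy in \<open>x\<close>.\<close>

definition hol_family :: "(complex ^ 'n \<Rightarrow> complex \<Rightarrow> complex) \<Rightarrow> (complex ^ 'n) set \<Rightarrow> complex set \<Rightarrow> bool"
  where "hol_family F X S \<longleftrightarrow> continuous_on (X \<times> S) (\<lambda>(x, y). F x y) \<and>
    (\<forall>x\<in>X. F x holomorphic_on S) \<and> (\<forall>y\<in>S. holomorphic_cn (\<lambda>x. F x y) X)"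

lemma hol_family_subset:
  "hol_family F X S \<Longrightarrow> X' \<subseteq> X \<Longrightarrow> S' \<subseteq> S \<Longrightarrow> hol_family F X' S'"
  unfolding hol_family_def
  by (auto elim!: continuous_on_subset intro: holomorphic_cn_subset holomorphic_on_subset)

lemma hol_family_const_right: "holomorphic_cn f X \<Longrightarrow> hol_family (\<lambda>x y. f x) X S"
  unfolding hol_family_def split_beta
  by (auto intro!: continuous_on_compose2[OF holomorphic_cn_imp_continuous_on, of f X] continuous_intros)

lemma hol_family_const_left: "f holomorphic_on S \<Longrightarrow> hol_family (\<lambda>x. f) X S"
  unfolding hol_family_def split_beta
  by (auto intro!: continuous_on_compose2[OF holomorphic_on_imp_continuous_on, of f S]
      continuous_intros holomorphic_cn_const)

lemma hol_family_mult:
  assumes "hol_family F X S" and "hol_family G X S"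
  shows "hol_family (\<lambda>x y. F x y * G x y) X S"
  unfolding hol_family_def split_beta
  using assms[unfolded hol_family_def split_beta]
  by (intro conjI ballI continuous_on_mult holomorphic_on_mult holomorphic_cn_mult) simp_all

lemma hol_family_inverse:
  assumes "hol_family F X S" and "\<And>x y. x \<in> X \<Longrightarrow> y \<in> S \<Longrightarrow> F x y \<noteq> 0"
  shows "hol_family (\<lambda>x y. inverse (F x y)) X S"
  unfolding hol_family_def split_beta
  using assms[unfolded hol_family_def split_beta]
  by (intro conjI ballI continuous_on_inverse holomorphic_on_inverse holomorphic_cn_inverse) auto

lemma holomorphic_cn_cong:
  assumes "open X" and "holomorphic_cn f X" and "\<And>x. x \<in> X \<Longrightarrow> f x = g x"
  shows "holomorphic_cn g X"
  using assms unfolding holomorphic_cn_def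
  by (meson has_derivative_transform_within_open)

lemma holomorphic_cn_family_contour_integral:
  assumes "hol_family F X (sphere c r)" and "0 \<le> r" and "open X"
  shows "holomorphic_cn (\<lambda>x. contour_integral (circlepath c r) (F x)) X"
  using assms unfolding hol_family_def
  by (intro holomorphic_cn_contour_integral_circlepath) auto

lemma hol_family_power: "hol_family F X S \<Longrightarrow> hol_family (\<lambda>x y. F x y ^ k) X S"
proof (induction k)
  case 0
  then show ?case using hol_family_const_right[OF holomorphic_cn_const[of 1 X], of S] by simp
next
  case (Suc k)
  then show ?case using hol_family_mult[of F X S "\<lambda>x y. F x y ^ k"] by simp
qed

lemma hol_family_deriv:
  assumes F: "hol_family F X S" and "open X" and "open S"
  shows "hol_family (\<lambda>x. deriv (F x)) X S"
  unfolding hol_family_def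
proof (intro conjI ballI)
  show "continuous_on (X \<times> S) (\<lambda>(x, y). deriv (F x) y)"
    using F \<open>open S\<close> by (intro continuous_on_deriv_param) (auto simp: hol_family_def)
  show "deriv (F x) holomorphic_on S" if "x \<in> X" for x
    using F \<open>open S\<close> that by (intro holomorphic_deriv) (auto simp: hol_family_def)
next
  fix y assume "y \<in> S"
  then obtain r where r: "r > 0" "cball y r \<subseteq> S" using \<open>open S\<close> open_contains_cball by blast
  have "hol_family F X (sphere y r)"
    using F by (rule hol_family_subset) (use r in auto)
  then have "hol_family (\<lambda>x u. F x u * inverse ((u - y)\<^sup>2)) X (sphere y r)"
    using r by (intro hol_family_mult hol_family_const_left holomorphic_intros) auto
  from holomorphic_cn_mult[OF holomorphic_cn_family_contour_integral[OF this _ \<open>open X\<close>]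
      holomorphic_cn_const[of "inverse (2 * pi * \<i>)"]]
  have "holomorphic_cn (\<lambda>x. contour_integral (circlepath y r)
      (\<lambda>u. F x u * inverse ((u - y)\<^sup>2)) * inverse (2 * pi * \<i>)) X"
    using r by simp
  then show "holomorphic_cn (\<lambda>x. deriv (F x) y) X"
  proof (rule holomorphic_cn_cong[OF \<open>open X\<close>])
    show "contour_integral (circlepath y r) (\<lambda>u. F x u * inverse ((u - y)\<^sup>2)) * inverse (2 * pi * \<i>)
      = deriv (F x) y" if "x \<in> X" for x
    proof -
      have "F x holomorphic_on S" using F that by (simp add: hol_family_def)
      then have "continuous_on (cball y r) (F x)" "F x holomorphic_on ball y r"
        using r ball_subset_cball holomorphic_on_subset holomorphic_on_imp_continuous_on by blast+
      then have "contour_integral (circlepath y r) (\<lambda>u. F x u / (u - y)\<^sup>2) = 2 * pi * \<i> * deriv (F x) y"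
        by (rule Cauchy_contour_integral_circlepath_2) (use r in simp)
      then show ?thesis unfolding divide_inverse[symmetric] by simp
    qed
  qed
qed

lemma holomorphic_cn_sum_zeros:
  assumes F: "hol_family F X S" and G: "hol_family \<phi> X S" and "open X" and S: "open S" "cball c r \<subseteq> S"
    and r: "0 < r" and nz: "\<And>x z. x \<in> X \<Longrightarrow> z \<in> sphere c r \<Longrightarrow> F x z \<noteq> 0"
  shows "holomorphic_cn (\<lambda>x. \<Sum>z\<in>#zero_mset (F x) c r. \<phi> x z) X"
proof -
  have sph: "sphere c r \<subseteq> S" using S(2) by auto
  have H: "hol_family (\<lambda>x u. deriv (F x) u * \<phi> x u) X (sphere c r)"
    using hol_family_mult[OF hol_family_deriv[OF F \<open>open X\<close> S(1)] G] sph
    by (rule hol_family_subset[OF _ order_refl])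
  have F': "hol_family F X (sphere c r)"
    using F sph by (rule hol_family_subset[OF _ order_refl])
  have "hol_family (\<lambda>x u. deriv (F x) u * \<phi> x u * inverse (F x u)) X (sphere c r)"
    using nz by (intro hol_family_mult[OF H] hol_family_inverse[OF F'])
  from holomorphic_cn_mult[OF holomorphic_cn_family_contour_integral[OF this _ \<open>open X\<close>]
      holomorphic_cn_const[of "inverse (2 * pi * \<i>)"]]
  have "holomorphic_cn (\<lambda>x. contour_integral (circlepath c r)
      (\<lambda>u. deriv (F x) u * \<phi> x u * inverse (F x u)) * inverse (2 * pi * \<i>)) X"
    using r by simp
  then show ?thesis
  proof (rule holomorphic_cn_cong[OF \<open>open X\<close>])
    show "contour_integral (circlepath c r) (\<lambda>u. deriv (F x) u * \<phi> x u * inverse (F x u))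
      * inverse (2 * pi * \<i>) = (\<Sum>z\<in>#zero_mset (F x) c r. \<phi> x z)" if "x \<in> X" for x
    proof -
      have "F x holomorphic_on S" "\<phi> x holomorphic_on S"
        using F G that by (auto simp: hol_family_def)
      from sum_zero_mset[OF this(1) S r nz[OF that] this(2)] show ?thesis
        unfolding divide_inverse by (rule sym)
    qed
  qed
qed

text \<open>With weight 1 the sum over the zeros is an integer that depends continuously on
  \<open>x\<close>, so it cannot jump on a connected set.\<close>

lemma size_zero_mset_constant:
  assumes F: "hol_family F X S" and "open X" and "connected X" and S: "open S" "cball c r \<subseteq> S"
    and r: "0 < r" and nz: "\<And>x z. x \<in> X \<Longrightarrow> z \<in> sphere c r \<Longrightarrow> F x z \<noteq> 0"
    and "x \<in> X" and "x' \<in> X"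
  shows "size (zero_mset (F x) c r) = size (zero_mset (F x') c r)"
proof -
  have "holomorphic_cn (\<lambda>x. \<Sum>z\<in>#zero_mset (F x) c r. 1) X"
    by (rule holomorphic_cn_sum_zeros[OF F _ \<open>open X\<close> S r nz])
      (auto intro: hol_family_const_right holomorphic_cn_const)
  then have "continuous_on X (\<lambda>x. of_nat (size (zero_mset (F x) c r)) :: complex)"
    by (auto dest: holomorphic_cn_imp_continuous_on)
  then have "(\<lambda>x. of_nat (size (zero_mset (F x) c r)) :: complex) constant_on X"
  proof (rule continuous_discrete_range_constant[OF \<open>connected X\<close>])
    fix x
    show "\<exists>e>0. \<forall>y. y \<in> X \<and> of_nat (size (zero_mset (F y) c r)) \<noteq> (of_nat (size (zero_mset (F x) c r)) :: complex)
        \<longrightarrow> e \<le> norm (of_nat (size (zero_mset (F y) c r)) - (of_nat (size (zero_mset (F x) c r)) :: complex))"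
    proof (intro exI[of _ 1] conjI allI impI)
      fix y assume "y \<in> X \<and> of_nat (size (zero_mset (F y) c r)) \<noteq> (of_nat (size (zero_mset (F x) c r)) :: complex)"
      then have "(1::int) \<le> \<bar>int (size (zero_mset (F y) c r)) - int (size (zero_mset (F x) c r))\<bar>" by auto
      then have "1 \<le> norm (of_int (int (size (zero_mset (F y) c r)) - int (size (zero_mset (F x) c r))) :: complex)"
        unfolding norm_of_int by linarith
      then show "1 \<le> norm (of_nat (size (zero_mset (F y) c r)) - (of_nat (size (zero_mset (F x) c r)) :: complex))"
        by simp
    qed auto
  qed
  then show ?thesis using assms(8,9) unfolding constant_on_def by (metis of_nat_eq_iff)
qed


section \<open>Symmetric functions of the zeros; bounded quotients\<close>

definition root_poly :: "complex multiset \<Rightarrow> complex poly" where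
  "root_poly A = (\<Prod>a\<in>#A. [:- a, 1:])"

lemma root_poly_add [simp]: "root_poly (add_mset a A) = [:- a, 1:] * root_poly A"
  by (simp add: root_poly_def)

lemma root_poly_monic: "lead_coeff (root_poly A) = 1"
  by (induction A) (simp_all add: root_poly_def lead_coeff_mult del: mult_pCons_left)

lemma root_poly_nonzero: "root_poly A \<noteq> 0"
  using root_poly_monic[of A] by auto

lemma degree_root_poly: "degree (root_poly A) = size A"
proof (induction A)
  case (add a A)
  have "degree ([:- a, 1:] * root_poly A) = degree [:- a, 1:] + degree (root_poly A)"
    by (intro degree_mult_eq root_poly_nonzero) simp
  with add show ?case by (simp del: mult_pCons_left)
qed (simp add: root_poly_def)

lemma poly_root_poly_eq_0_iff: "poly (root_poly A) t = 0 \<longleftrightarrow> t \<in># A"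
  by (induction A) (auto simp: root_poly_def)

text \<open>The term \<open>j = 0\<close> contains the number of roots as the power sum of exponent 0.\<close>

lemma newton_identity:
  assumes "size A \<le> B"
  shows "(\<Sum>j\<le>B. coeff (root_poly A) (i + j) * (\<Sum>a\<in>#A. a ^ j)) = of_nat i * coeff (root_poly A) i"
  using assms
proof (induction A arbitrary: B i)
  case empty
  show ?case by (cases i) (simp_all add: root_poly_def)
next
  case (add a A)
  show ?case
  proof (cases i)
    case 0
    \<comment> \<open>For \<open>i = 0\<close> the left-hand side is the sum of the polynomial's
      values at its own roots. An arbitrary multiset \<open>M\<close> replaces the roots in the
      power sums, so that the induction on \<open>M\<close> leaves the polynomial fixed.\<close>
    have "(\<Sum>j\<le>B. coeff (root_poly (add_mset a A)) j * (\<Sum>b\<in>#M. b ^ j))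
        = (\<Sum>b\<in>#M. poly (root_poly (add_mset a A)) b)" for M
    proof (induction M)
      case (add b M)
      have "poly (root_poly (add_mset a A)) b = (\<Sum>j\<le>B. coeff (root_poly (add_mset a A)) j * b ^ j)"
        unfolding poly_altdef using add.prems \<open>size (add_mset a A) \<le> B\<close>
        by (intro sum.mono_neutral_left) (auto simp: coeff_eq_0 degree_root_poly simp del: root_poly_add)
      with add show ?case by (simp add: distrib_left sum.distrib del: root_poly_add)
    qed simp
    also have "(\<Sum>b\<in>#add_mset a A. poly (root_poly (add_mset a A)) b) = (\<Sum>b\<in>#add_mset a A. 0)"
      by (intro arg_cong[where f = sum_mset] image_mset_cong)
        (simp only: poly_root_poly_eq_0_iff)
    finally show ?thesis using 0 by simp
  next
    case (Suc k)
    define c where "c = coeff (root_poly A)"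
    define p where "p j = (\<Sum>b\<in>#A. b ^ j)" for j
    have c': "coeff (root_poly (add_mset a A)) (Suc n) = c n - a * c (Suc n)" for n
      by (simp add: c_def)
    have c0: "c n = 0" if "n > B" for n
      using that add.prems by (simp add: c_def coeff_eq_0 degree_root_poly)
    have IH: "(\<Sum>j\<le>B. c (i + j) * p j) = of_nat i * c i" for i
      unfolding c_def p_def using add by simp
    \<comment> \<open>The contribution of the new root \<open>a\<close> telescopes; the boundary
      term \<open>c (k + Suc B)\<close> vanishes because its index exceeds
      \<open>size A\<close>.\<close>
    have tel: "(\<Sum>j\<le>B. c (k + j) * a ^ j - c (k + Suc j) * a ^ Suc j) = c k"
      using sum_telescope[of "\<lambda>j. c (k + j) * a ^ j" B] c0[of "k + Suc B"] by simp
    have "(\<Sum>j\<le>B. (c (k + j) - a * c (Suc k + j)) * (a ^ j + p j))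
      = (\<Sum>j\<le>B. c (k + j) * p j) - a * (\<Sum>j\<le>B. c (Suc k + j) * p j)
        + (\<Sum>j\<le>B. c (k + j) * a ^ j - c (k + Suc j) * a ^ Suc j)"
      by (simp add: sum_distrib_left sum.distrib[symmetric] sum_subtractf[symmetric] algebra_simps)
    also have "\<dots> = of_nat (Suc k) * (c k - a * c (Suc k))"
      unfolding IH tel by (simp add: algebra_simps)
    finally show ?thesis using Suc by (simp add: c' p_def del: root_poly_add)
  qed
qed

lemma holomorphic_cn_sum:
  "(\<And>i. i \<in> I \<Longrightarrow> holomorphic_cn (f i) X) \<Longrightarrow> holomorphic_cn (\<lambda>x. \<Sum>i\<in>I. f i x) X"
  by (induction I rule: infinite_finite_induct) (auto intro: holomorphic_cn_add holomorphic_cn_const)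

text \<open>In \<open>newton_identity\<close> the \<open>j = 0\<close> term is \<open>N\<close>
  times the \<open>i\<close>-th coefficient, so the identity can be solved for that coefficient in
  terms of higher ones after division by \<open>i - N\<close>. The induction therefore runs downward
  from the leading coefficient 1, and \<open>i < N\<close> keeps the divisor nonzero.\<close>

lemma holomorphic_cn_coeff_root_poly:
  assumes "open X" and size: "\<And>x. x \<in> X \<Longrightarrow> size (A x) = N"
    and power_sums: "\<And>k. holomorphic_cn (\<lambda>x. \<Sum>a\<in>#A x. a ^ k) X"
  shows "holomorphic_cn (\<lambda>x. coeff (root_poly (A x)) i) X"
proof (induction "N - i" arbitrary: i rule: less_induct)
  case less
  show ?case
  proof (cases "i < N")
    case False
    have "holomorphic_cn (\<lambda>x. if i = N then 1 else 0) X" by (rule holomorphic_cn_const)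
    then show ?thesis
      by (rule holomorphic_cn_cong[OF \<open>open X\<close>])
        (use False size root_poly_monic in \<open>auto simp: coeff_eq_0 degree_root_poly\<close>)
  next
    case True
    have "holomorphic_cn (\<lambda>x. inverse (of_nat i - of_nat N) *
        (\<Sum>j\<in>{0<..N}. coeff (root_poly (A x)) (i + j) * (\<Sum>a\<in>#A x. a ^ j))) X"
      using True by (intro holomorphic_cn_mult holomorphic_cn_const holomorphic_cn_sum less power_sums) auto
    then show ?thesis
    proof (rule holomorphic_cn_cong[OF \<open>open X\<close>])
      fix x assume x: "x \<in> X"
      have "{..N} = insert 0 {0<..N}" by auto
      then have "(\<Sum>j\<in>{0<..N}. coeff (root_poly (A x)) (i + j) * (\<Sum>a\<in>#A x. a ^ j)) =
          (of_nat i - of_nat N) * coeff (root_poly (A x)) i"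
        using newton_identity[of "A x" N i] size[OF x] by (simp add: algebra_simps)
      moreover have "of_nat i - (of_nat N :: complex) \<noteq> 0" using True by simp
      ultimately show "inverse (of_nat i - of_nat N) *
        (\<Sum>j\<in>{0<..N}. coeff (root_poly (A x)) (i + j) * (\<Sum>a\<in>#A x. a ^ j))
        = coeff (root_poly (A x)) i"
        by simp
    qed
  qed
qed

section \<open>Identity theorem and bounded quotients in several variables\<close>

lemma holomorphic_cn_identity:
  assumes a: "holomorphic_cn a V" and V: "open V" "convex V"
    and W: "open W" "W \<subseteq> V" "W \<noteq> {}" and zero: "\<And>x. x \<in> W \<Longrightarrow> a x = 0" and "x \<in> V"
  shows "a x = 0"
proof -
  obtain w where w: "w \<in> W" using W by auto
  define T where "T = {t. w + t *s (x - w) \<in> V}"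
  have "a (w + 1 *s (x - w)) = 0"
  proof (rule analytic_continuation_open[where f = "\<lambda>t. a (w + t *s (x - w))" and g = "\<lambda>t. 0"
        and s = "{t. w + t *s (x - w) \<in> W}" and s' = T and z = 1])
    show "open {t. w + t *s (x - w) \<in> W}" "open T"
      unfolding T_def by (intro open_line_vimage W V)+
    show "{t. w + t *s (x - w) \<in> W} \<noteq> {}" using w by (auto intro: exI[of _ 0])
    \<comment> \<open>Convexity of \<open>V\<close> makes its trace \<open>T\<close> on the complex
      line through \<open>w\<close> and \<open>x\<close> connected, as the one-variable identity
      theorem requires.\<close>
    have "convex ((\<lambda>t. t *s (x - w)) -` ((\<lambda>z. z - w) ` V))"
      by (intro convex_linear_vimage convex_translation_subtract V(2)
          bounded_linear.linear[OF bounded_linear_complex_scale])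
    also have "(\<lambda>t. t *s (x - w)) -` ((\<lambda>z. z - w) ` V) = T"
      unfolding T_def by (force simp: algebra_simps image_iff)
    finally show "connected T" by (rule convex_connected)
    show "(\<lambda>t. a (w + t *s (x - w))) holomorphic_on T"
      unfolding T_def using a by (rule holomorphic_cn_line)
  qed (use W zero \<open>x \<in> V\<close> in \<open>auto simp: T_def\<close>)
  then show ?thesis by simp
qed

lemma holomorphic_cn_nonzero_dense:
  assumes "holomorphic_cn a V" "open V" "convex V" and "x \<in> V" "a x \<noteq> 0"
    and "open W" "W \<subseteq> V" "W \<noteq> {}"
  shows "\<exists>y\<in>W. a y \<noteq> 0"
  using holomorphic_cn_identity[OF assms(1-3,6-8) _ assms(4)] assms(5) by blast

lemma nonzero_punctured_cball:
  assumes "g holomorphic_on T" and "open T" "connected T" "z \<in> T" "w \<in> T" "g w \<noteq> 0"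
  obtains r where "r > 0" "cball z r \<subseteq> T" "\<And>t. t \<in> cball z r - {z} \<Longrightarrow> g t \<noteq> 0"
proof (cases "g z = 0")
  case True
  then obtain r where r: "0 < r" "ball z r \<subseteq> T" "\<And>t. t \<in> ball z r - {z} \<Longrightarrow> g t \<noteq> 0"
    using isolated_zeros[OF assms(1-4) True assms(5,6)] by metis
  then show ?thesis by (intro that[of "r / 2"]) (auto simp: subset_iff)
next
  case False
  have "open (T \<inter> g -` (- {0}))"
    using assms by (intro continuous_open_preimage holomorphic_on_imp_continuous_on) auto
  then obtain r where "r > 0" "cball z r \<subseteq> T \<inter> g -` (- {0})"
    using False assms(4) open_contains_cball by (metis ComplI IntI singletonD vimageI)
  then show ?thesis by (intro that[of r]) auto
qed

lemma holomorphic_cn_shift: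
  assumes "holomorphic_cn f U" and "\<And>x. x \<in> X \<Longrightarrow> x + c \<in> U"
  shows "holomorphic_cn (\<lambda>x. f (x + c)) X"
  unfolding holomorphic_cn_def
proof
  fix x assume "x \<in> X"
  then obtain D where D: "(f has_derivative D) (at (x + c))" "\<forall>c v. D (c *s v) = c * D v"
    using assms unfolding holomorphic_cn_def by blast
  have "((\<lambda>x. x + c) has_derivative (\<lambda>x. x)) (at x)" by (auto intro!: derivative_eq_intros)
  from has_derivative_compose[OF this D(1)] D(2)
  show "\<exists>D. ((\<lambda>x. f (x + c)) has_derivative D) (at x) \<and> (\<forall>c v. D (c *s v) = c * D v)" by blast
qed

lemma hol_family_line:
  assumes f: "holomorphic_cn f U" and sub: "\<And>x t. x \<in> X \<Longrightarrow> t \<in> T \<Longrightarrow> x + t *s v \<in> U"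
  shows "hol_family (\<lambda>x t. f (x + t *s v)) X T"
  unfolding hol_family_def split_beta
proof (intro conjI ballI)
  show "continuous_on (X \<times> T) (\<lambda>z. f (fst z + snd z *s v))"
    by (rule continuous_on_compose2[OF holomorphic_cn_imp_continuous_on[OF f]])
      (auto intro!: continuous_intros sub)
  show "(\<lambda>t. f (x + t *s v)) holomorphic_on T" if "x \<in> X" for x
    using holomorphic_cn_line[OF f] by (rule holomorphic_on_subset) (use sub that in auto)
  show "holomorphic_cn (\<lambda>x. f (x + t *s v)) X" if "t \<in> T" for t
    using f by (rule holomorphic_cn_shift) (use sub that in auto)
qed

text \<open>The bound excludes poles of the meromorphic function \<open>c / a\<close>, so its
  singularities are removable. At zeros of \<open>a\<close> the identity holds because the bound
  forces \<open>c\<close> to vanish too.\<close>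

lemma holomorphic_bounded_quotient:
  assumes "open S" and "connected S" and a: "a holomorphic_on S" and c: "c holomorphic_on S"
    and "w \<in> S" "a w \<noteq> 0" and bd: "\<And>z. z \<in> S \<Longrightarrow> norm (c z) \<le> C * norm (a z)"
  obtains E where "E holomorphic_on S" "\<And>z. z \<in> S \<Longrightarrow> c z = E z * a z"
proof -
  define E where "E = remove_sings (\<lambda>z. c z / a z)"
  have mero: "(\<lambda>z. c z / a z) meromorphic_on S"
    using a c \<open>open S\<close>
    by (intro meromorphic_on_divide analytic_on_imp_meromorphic_on) (auto simp: analytic_on_open)
  then have nice: "E nicely_meromorphic_on S"
    unfolding E_def by (rule remove_sings_nicely_meromorphic)
  have an: "E analytic_on {z}" if z: "z \<in> S" for z
  proof (rule nicely_meromorphic_on_imp_analytic_at[OF nice z])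
    have "\<not> is_pole (\<lambda>z. c z / a z) z"
    proof
      assume "is_pole (\<lambda>z. c z / a z) z"
      then have "\<forall>\<^sub>F w in at z. \<bar>C\<bar> + 1 \<le> norm (c w / a w)"
        unfolding is_pole_def filterlim_at_infinity[OF order_refl] by simp
      moreover have "\<forall>\<^sub>F w in at z. w \<in> S" using \<open>open S\<close> z by (intro eventually_at_in_open') auto
      ultimately have "\<forall>\<^sub>F w in at z. False"
      proof eventually_elim
        case (elim w)
        have "norm (c w / a w) \<le> \<bar>C\<bar>"
        proof (cases "a w = 0")
          case False
          have "norm (c w) \<le> \<bar>C\<bar> * norm (a w)"
            by (rule order_trans[OF bd[OF elim(2)] mult_right_mono]) auto
          with False show ?thesis by (simp add: norm_divide divide_le_eq)
        qed simp
        with elim(1) show False by linarith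
      qed
      then show False by simp
    qed
    moreover have "isolated_singularity_at (\<lambda>z. c z / a z) z"
      using mero z meromorphic_on_isolated_singularity meromorphic_on_subset by blast
    ultimately show "\<not> is_pole E z" by (simp add: E_def)
  qed
  show ?thesis
  proof
    show "E holomorphic_on S" using an analytic_imp_holomorphic analytic_on_analytic_at by blast
    show "c z = E z * a z" if z: "z \<in> S" for z
    proof (cases "a z = 0")
      case True
      then show ?thesis using bd[OF z] by simp
    next
      case False
      have "(\<lambda>z. c z / a z) analytic_on {z}"
        using False z a c \<open>open S\<close>
        by (intro analytic_on_divide holomorphic_on_imp_analytic_at) auto
      then show ?thesis using False by (simp add: E_def)
    qed
  qed
qed

lemma convex_line_vimage: "convex A \<Longrightarrow> convex {t. t *s (w :: complex ^ 'n) \<in> A}"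
  using convex_linear_vimage[OF bounded_linear.linear[OF bounded_linear_complex_scale], of A w]
  by (simp add: vimage_def)

lemma disc_in_line_nhd:
  fixes w :: "complex ^ 'n"
  assumes r: "0 < r" "cball 0 r \<subseteq> {t. t *s w \<in> ball 0 R}"
  obtains e S where "e > 0" "open S" "connected S" "cball 0 r \<subseteq> S"
    "\<And>x t. x \<in> ball x0 e \<Longrightarrow> t \<in> S \<Longrightarrow> x + t *s w \<in> ball x0 R"
proof -
  have "norm (complex_of_real r *s w) < R" using r by (force simp: subset_iff)
  then have rw: "r * norm w < R" using r(1) by (simp add: norm_complex_scale)
  \<comment> \<open>The gap between \<open>R\<close> and \<open>r * norm w\<close> is halved: one
    half is for moving \<open>x\<close>, the other makes room for an open set \<open>S\<close>
    around the closed disc.\<close>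
  define e where "e = (R - r * norm w) / 2"
  define S where "S = {t. t *s w \<in> ball 0 (R - e)}"
  show ?thesis
  proof (rule that[of e S])
    show "e > 0" using rw by (simp add: e_def)
    show "open S" unfolding S_def using open_line_vimage[of "ball 0 (R - e)" 0 w] by simp
    show "connected S" unfolding S_def by (intro convex_connected convex_line_vimage convex_ball)
    show "cball 0 r \<subseteq> S"
    proof
      fix t :: complex assume "t \<in> cball 0 r"
      then have "norm t * norm w \<le> r * norm w" by (intro mult_right_mono) auto
      also have "\<dots> < R - e" using rw by (simp add: e_def field_simps)
      finally show "t \<in> S" by (simp add: S_def norm_complex_scale)
    qed
    show "x + t *s w \<in> ball x0 R" if "x \<in> ball x0 e" "t \<in> S" for x t
    proof -
      have "dist x0 (x + t *s w) \<le> dist x0 x + norm (t *s w)"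
        using dist_triangle[of x0 "x + t *s w" x] by (simp add: dist_norm)
      also have "\<dots> < R" using that by (simp add: S_def)
      finally show ?thesis by simp
    qed
  qed
qed

text \<open>Locally the quotient is a Cauchy integral over a circle, in a complex line on which \<open>a\<close> does not
  vanish identically, that avoids the zeros of \<open>a\<close>.\<close>

lemma holomorphic_cn_bounded_quotient_local:
  assumes V: "open V" "convex V" and a: "holomorphic_cn a V" and c: "holomorphic_cn c V"
    and z: "z \<in> V" "a z \<noteq> 0" and bd: "\<And>x. x \<in> V \<Longrightarrow> norm (c x) \<le> C * norm (a x)" and x0: "x0 \<in> V"
  shows "\<exists>X u. open X \<and> x0 \<in> X \<and> X \<subseteq> V \<and> holomorphic_cn u X \<and> (\<forall>x\<in>X. c x = u x * a x)"
proof -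
  obtain R where R: "R > 0" "ball x0 R \<subseteq> V" using V(1) x0 open_contains_ball by blast
  obtain y where y: "y \<in> ball x0 R" "a y \<noteq> 0"
    using holomorphic_cn_nonzero_dense[OF a V z open_ball R(2)] R(1) by auto
  define w where "w = y - x0"
  define T where "T = {t. t *s w \<in> ball 0 R}"
  have T: "open T" "connected T"
    unfolding T_def using open_line_vimage[of "ball 0 R" 0 w]
    by (simp, intro convex_connected convex_line_vimage convex_ball)
  have in_V: "x0 + t *s w \<in> V" if "t \<in> T" for t
    using that R(2) by (auto simp: T_def dist_norm)
  have "(\<lambda>t. a (x0 + t *s w)) holomorphic_on T"
    using holomorphic_cn_line[OF a] by (rule holomorphic_on_subset) (use in_V in auto)
  moreover have "1 \<in> T" "a (x0 + 1 *s w) \<noteq> 0" using y by (auto simp: T_def w_def dist_norm norm_minus_commute)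
  ultimately obtain r where r: "r > 0" "cball 0 r \<subseteq> T" "\<And>t. t \<in> cball 0 r - {0} \<Longrightarrow> a (x0 + t *s w) \<noteq> 0"
    using nonzero_punctured_cball[of _ T 0 1] T R(1) unfolding T_def
    by (metis (no_types, lifting) centre_in_ball mem_Collect_eq vector_smult_lzero)
  obtain e S where e: "e > 0" and S: "open S" "connected S" "cball 0 r \<subseteq> S"
    and sub: "\<And>x t. x \<in> ball x0 e \<Longrightarrow> t \<in> S \<Longrightarrow> x + t *s w \<in> V"
    using disc_in_line_nhd[OF r(1,2)[unfolded T_def], where ?x0.0 = x0] R(2) by (metis subsetD)
  have fa: "hol_family (\<lambda>x t. a (x + t *s w)) (ball x0 e) S"
    and fc: "hol_family (\<lambda>x t. c (x + t *s w)) (ball x0 e) S"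
    using a c by (auto intro: hol_family_line sub)
  have sph: "sphere 0 r \<subseteq> S" using S(3) by auto
  have "continuous_on (ball x0 e \<times> sphere 0 r) (\<lambda>(x, t). a (x + t *s w))"
    using hol_family_subset[OF fa order_refl sph] by (simp add: hol_family_def)
  then obtain d where d: "d > 0" "ball x0 d \<subseteq> ball x0 e"
      "\<And>x t. x \<in> ball x0 d \<Longrightarrow> t \<in> sphere 0 r \<Longrightarrow> a (x + t *s w) \<noteq> 0"
    by (rule compact_nonzero_nhd[OF open_ball centre_in_ball[THEN iffD2, OF e] compact_sphere])
      (use r in auto)
  define u where "u x = contour_integral (circlepath 0 r)
      (\<lambda>t. c (x + t *s w) * inverse (a (x + t *s w)) * inverse t) * inverse (2 * pi * \<i>)" for x
  have "hol_family (\<lambda>x t. c (x + t *s w) * inverse (a (x + t *s w)) * inverse t) (ball x0 d) (sphere 0 r)"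
    using r(1) d(3)
    by (intro hol_family_mult hol_family_inverse hol_family_const_left holomorphic_intros
        hol_family_subset[OF fa d(2) sph] hol_family_subset[OF fc d(2) sph]) auto
  from holomorphic_cn_mult[OF holomorphic_cn_family_contour_integral[OF this less_imp_le[OF r(1)] open_ball]
      holomorphic_cn_const]
  have "holomorphic_cn u (ball x0 d)" unfolding u_def .
  moreover have "c x = u x * a x" if x: "x \<in> ball x0 d" for x
  proof -
    have xe: "x \<in> ball x0 e" using x d(2) by blast
    have "complex_of_real r \<in> sphere 0 r" using r(1) by simp
    then obtain E where E: "E holomorphic_on S" "\<And>t. t \<in> S \<Longrightarrow> c (x + t *s w) = E t * a (x + t *s w)"
      using holomorphic_bounded_quotient[OF S(1,2), of "\<lambda>t. a (x + t *s w)" "\<lambda>t. c (x + t *s w)"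
          "of_real r" C] fa fc xe d(3)[OF x] sph bd[OF sub[OF xe]]
      unfolding hol_family_def by blast
    have "((\<lambda>t. E t / (t - 0)) has_contour_integral 2 * of_real pi * \<i> * E 0) (circlepath 0 r)"
      using E(1) S(3) r(1) ball_subset_cball[of 0 r]
      by (intro Cauchy_integral_circlepath holomorphic_on_imp_continuous_on holomorphic_on_subset[OF E(1)]) auto
    then have "((\<lambda>t. c (x + t *s w) * inverse (a (x + t *s w)) * inverse t)
        has_contour_integral 2 * of_real pi * \<i> * E 0) (circlepath 0 r)"
    proof (rule has_contour_integral_eq)
      fix t assume "t \<in> path_image (circlepath 0 r)"
      then have t: "t \<in> sphere 0 r" using r(1) by simp
      then show "E t / (t - 0) = c (x + t *s w) * inverse (a (x + t *s w)) * inverse t"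
        using E(2)[of t] sph d(3)[OF x t] by (auto simp: divide_inverse)
    qed
    then have "u x = E 0" unfolding u_def by (subst contour_integral_unique) (auto simp: field_simps)
    moreover have "0 \<in> S" using S(3) r(1) by (meson centre_in_cball less_imp_le subsetD)
    ultimately show ?thesis using E(2)[of 0] by simp
  qed
  moreover have "ball x0 d \<subseteq> V"
  proof
    fix x assume "x \<in> ball x0 d"
    moreover have "0 \<in> S" using S(3) r(1) by (meson centre_in_cball less_imp_le subsetD)
    ultimately show "x \<in> V" using sub[of x 0] d(2) by auto
  qed
  ultimately show ?thesis using d(1)
    by (intro exI[of _ "ball x0 d"] exI[of _ u]) auto
qed

text \<open>Local quotients agree where \<open>a\<close> is nonzero, which is a dense set, hence by
  continuity wherever both are defined. So they glue to one function on \<open>V\<close>.\<close>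

lemma holomorphic_cn_bounded_quotient:
  assumes V: "open V" "convex V" and a: "holomorphic_cn a V" and c: "holomorphic_cn c V"
    and z: "z \<in> V" "a z \<noteq> 0" and bd: "\<And>x. x \<in> V \<Longrightarrow> norm (c x) \<le> C * norm (a x)"
  obtains u where "holomorphic_cn u V" "\<And>x. x \<in> V \<Longrightarrow> c x = u x * a x"
proof -
  define P where "P x val \<longleftrightarrow> (\<exists>X u. open X \<and> x \<in> X \<and> X \<subseteq> V \<and> holomorphic_cn u X \<and>
      (\<forall>y\<in>X. c y = u y * a y) \<and> val = u x)" for x val
  have ex: "\<exists>val. P x val" if "x \<in> V" for x
    using holomorphic_cn_bounded_quotient_local[OF V a c z bd that] unfolding P_def by blast
  have uniq: "v1 = v2" if v1: "P x v1" and v2: "P x v2" for x v1 v2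
  proof (rule ccontr)
    assume ne: "v1 \<noteq> v2"
    obtain X u where X: "open X" "x \<in> X" "X \<subseteq> V" "holomorphic_cn u X" "\<forall>y\<in>X. c y = u y * a y" "v1 = u x"
      using v1 unfolding P_def by blast
    obtain Y v where Y: "open Y" "x \<in> Y" "Y \<subseteq> V" "holomorphic_cn v Y" "\<forall>y\<in>Y. c y = v y * a y" "v2 = v x"
      using v2 unfolding P_def by blast
    have "continuous_on (X \<inter> Y) (\<lambda>y. u y - v y)"
      using X(4) Y(4) by (intro continuous_intros holomorphic_cn_imp_continuous_on) (auto elim: holomorphic_cn_subset)
    then have "open ((X \<inter> Y) \<inter> (\<lambda>y. u y - v y) -` (- {0}))"
      using X(1) Y(1) by (intro continuous_open_preimage) auto
    moreover have "x \<in> (X \<inter> Y) \<inter> (\<lambda>y. u y - v y) -` (- {0})" using X Y ne by simp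
    ultimately obtain y where "y \<in> (X \<inter> Y) \<inter> (\<lambda>y. u y - v y) -` (- {0})" "a y \<noteq> 0"
      using holomorphic_cn_nonzero_dense[OF a V z, of "(X \<inter> Y) \<inter> (\<lambda>y. u y - v y) -` (- {0})"] X(3)
      by blast
    then have "y \<in> X" "y \<in> Y" "u y \<noteq> v y" "a y \<noteq> 0" by auto
    then show False using X(5) Y(5) by (metis mult_right_cancel)
  qed
  define u where "u x = (SOME val. P x val)" for x
  have u: "P x (u x)" if "x \<in> V" for x unfolding u_def using ex[OF that] by (rule someI_ex)
  show ?thesis
  proof
    show "c x = u x * a x" if "x \<in> V" for x using u[OF that] unfolding P_def by auto
    show "holomorphic_cn u V"
      unfolding holomorphic_cn_def
    proof
      fix x assume "x \<in> V"
      then obtain X v where X: "open X" "x \<in> X" "X \<subseteq> V" "holomorphic_cn v X" "\<forall>y\<in>X. c y = v y * a y"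
        using u unfolding P_def by metis
      have "P y (v y)" if "y \<in> X" for y using X that unfolding P_def by blast
      then have "v y = u y" if "y \<in> X" for y using uniq u X(3) that by blast
      with X(1,4) have "holomorphic_cn u X" by (rule holomorphic_cn_cong)
      then show "\<exists>D. (u has_derivative D) (at x) \<and> (\<forall>c v. D (c *s v) = c * D v)"
        using X(2) unfolding holomorphic_cn_def by blast
    qed
  qed
qed


section \<open>Graphs of common zeros\<close>

text \<open>A finite Baire argument: either \<open>f i\<close> vanishes on all of \<open>W\<close>,
  or the other functions cover the nonempty open set where \<open>f i\<close> is nonzero. It selects
  one branch of zeros, or one factor of a product, that works over an open set.\<close>

lemma finite_zero_cover:
  fixes f :: "'i \<Rightarrow> 'a::topological_space \<Rightarrow> complex"
  assumes "finite I" and "open W" and "W \<noteq> {}"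
    and "\<And>i. i \<in> I \<Longrightarrow> continuous_on W (f i)" and "\<And>x. x \<in> W \<Longrightarrow> \<exists>i\<in>I. f i x = 0"
  shows "\<exists>i\<in>I. \<exists>W'. open W' \<and> W' \<noteq> {} \<and> W' \<subseteq> W \<and> (\<forall>x\<in>W'. f i x = 0)"
  using assms
proof (induction I arbitrary: W rule: finite_induct)
  case empty
  then show ?case by blast
next
  case (insert i I)
  define W1 where "W1 = W \<inter> f i -` (- {0})"
  show ?case
  proof (cases "W1 = {}")
    case True
    then have "\<forall>x\<in>W. f i x = 0" by (auto simp: W1_def)
    with insert.prems show ?thesis by blast
  next
    case False
    have "open W1"
      unfolding W1_def using insert.prems by (intro continuous_open_preimage) auto
    moreover have "continuous_on W1 (f j)" if "j \<in> I" for j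
      using insert.prems(3)[of j] that by (auto simp: W1_def intro: continuous_on_subset)
    moreover have "\<exists>j\<in>I. f j x = 0" if "x \<in> W1" for x
      using insert.prems(4)[of x] that by (auto simp: W1_def)
    ultimately obtain j W' where "j \<in> I" "open W'" "W' \<noteq> {}" "W' \<subseteq> W1" "\<forall>x\<in>W'. f j x = 0"
      using insert.IH[of W1] False by blast
    then show ?thesis by (intro bexI[of _ j] exI[of _ W']) (auto simp: W1_def)
  qed
qed

lemma card_set_mset_le_size: "card (set_mset M) \<le> size M"
  by (induction M) (auto simp: card_insert_if)

lemma finite_disjoint_cballs:
  fixes Z :: "complex set"
  assumes "finite Z" and "open B" and "Z \<subseteq> B"
  obtains e where "e > 0" "\<And>y. y \<in> Z \<Longrightarrow> cball y e \<subseteq> B"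
    "\<And>y z. y \<in> Z \<Longrightarrow> z \<in> Z \<Longrightarrow> y \<noteq> z \<Longrightarrow> cball y e \<inter> cball z e = {}"
proof -
  have "\<forall>y\<in>Z. \<exists>e>0. \<forall>w\<in>cball y e. w \<in> B \<and> (w \<noteq> y \<longrightarrow> w \<notin> Z)"
    using finite_cball_avoid[OF assms(2,1)] assms(3) by blast
  then obtain e where e: "\<And>y. y \<in> Z \<Longrightarrow> e y > 0"
      "\<And>y w. y \<in> Z \<Longrightarrow> w \<in> cball y (e y) \<Longrightarrow> w \<in> B \<and> (w \<noteq> y \<longrightarrow> w \<notin> Z)" by metis
  define m where "m = Min (insert 1 (e ` Z))"
  have m: "m > 0" "\<And>y. y \<in> Z \<Longrightarrow> m \<le> e y" using assms(1) e(1) by (auto simp: m_def)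
  show ?thesis
  proof (rule that[of "m / 2"])
    show "cball y (m / 2) \<subseteq> B" if "y \<in> Z" for y
    proof
      fix w assume "w \<in> cball y (m / 2)"
      then have "w \<in> cball y (e y)" using m(1) m(2)[OF that] by auto
      then show "w \<in> B" using e(2)[OF that] by blast
    qed
    show "cball y (m / 2) \<inter> cball z (m / 2) = {}" if yz: "y \<in> Z" "z \<in> Z" "y \<noteq> z" for y z
    proof -
      have "dist y z > e y" using e(2)[OF yz(1), of z] yz by (cases "dist y z \<le> e y") simp_all
      then have "dist y z > m" using m(2)[OF yz(1)] by linarith
      then show ?thesis using dist_triangle2[of y z] by (auto simp: dist_commute) (smt (verit) dist_triangle2 field_sum_of_halves)
    qed
  qed (use m in simp)
qed

text \<open>Near a point where the number of distinct zeros of \<open>F x\<close> is maximal, the zeros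
  are holomorphic functions of \<open>x\<close>: each is the mean of the zeros in a fixed small disc.\<close>

lemma common_zero_graph:
  assumes F: "hol_family F X S" and H: "continuous_on (X \<times> S) (\<lambda>(x, y). H x y :: complex)"
    and X: "open X" "X \<noteq> {}" and S: "open S" "cball c r \<subseteq> S" and r: "0 < r"
    and nz: "\<And>x z. x \<in> X \<Longrightarrow> z \<in> sphere c r \<Longrightarrow> F x z \<noteq> 0"
    and common: "\<And>x. x \<in> X \<Longrightarrow> \<exists>y\<in>ball c r. F x y = 0 \<and> H x y = 0"
  obtains W b where "open W" "W \<noteq> {}" "W \<subseteq> X" "holomorphic_cn b W"
    "\<And>x. x \<in> W \<Longrightarrow> b x \<in> ball c r \<and> F x (b x) = 0 \<and> H x (b x) = 0"
proof -
  obtain x1 \<rho> where x1: "\<rho> > 0" "ball x1 \<rho> \<subseteq> X" using X open_contains_ball by blast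
  define X1 where "X1 = ball x1 \<rho>"
  have X1: "open X1" "connected X1" "x1 \<in> X1" "X1 \<subseteq> X" using x1 by (auto simp: X1_def)
  define Z where "Z x = {z \<in> ball c r. F x z = 0}" for x
  have holF: "F x holomorphic_on S" if "x \<in> X" for x using F that by (auto simp: hol_family_def)
  have finZ: "finite (Z x)" if "x \<in> X" for x
    unfolding Z_def using finite_zeros_disc[OF holF[OF that] S r nz[OF that]] .
  \<comment> \<open>The number of distinct zeros is at most their constant number with multiplicity,
    so a maximum exists.\<close>
  have "card (Z x) < Suc (size (zero_mset (F x1) c r))" if "x \<in> X1" for x
  proof -
    have x: "x \<in> X" using that X1 by blast
    have "Z x = set_mset (zero_mset (F x) c r)"
      unfolding Z_def using set_zero_mset[OF holF[OF x] S r nz[OF x]] by simp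
    moreover have "size (zero_mset (F x) c r) = size (zero_mset (F x1) c r)"
      by (rule size_zero_mset_constant[OF hol_family_subset[OF F X1(4) order_refl] X1(1,2) S r])
        (use nz X1 that in auto)
    ultimately show ?thesis using card_set_mset_le_size[of "zero_mset (F x) c r"] by simp
  qed
  then obtain x0 where x0: "x0 \<in> X1" "\<And>x. x \<in> X1 \<Longrightarrow> card (Z x) \<le> card (Z x0)"
    using ex_has_greatest_nat[of "\<lambda>x. x \<in> X1" x1 "\<lambda>x. card (Z x)"] X1(3) by metis
  have x0X: "x0 \<in> X" using x0 X1 by blast
  obtain e where e: "e > 0" "\<And>y. y \<in> Z x0 \<Longrightarrow> cball y e \<subseteq> ball c r"
    "\<And>y z. y \<in> Z x0 \<Longrightarrow> z \<in> Z x0 \<Longrightarrow> y \<noteq> z \<Longrightarrow> cball y e \<inter> cball z e = {}"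
    by (rule finite_disjoint_cballs[OF finZ[OF x0X] open_ball]) (auto simp: Z_def)
  define K where "K = (\<Union>y\<in>Z x0. sphere y e)"
  have K: "compact K" "K \<subseteq> ball c r"
  proof -
    show "compact K" unfolding K_def using finZ[OF x0X] by (intro compact_UN) auto
    show "K \<subseteq> ball c r" unfolding K_def using e(2) sphere_cball by blast
  qed
  have "F x0 y \<noteq> 0" if "y \<in> K" for y
  proof
    assume "F x0 y = 0"
    then have y: "y \<in> Z x0" using that K by (auto simp: Z_def)
    from that obtain z where z: "z \<in> Z x0" "y \<in> sphere z e" by (auto simp: K_def)
    then have "y \<noteq> z" "y \<in> cball y e \<inter> cball z e" using e(1) by auto
    then show False using e(3) y z by blast
  qed
  moreover have "continuous_on (X1 \<times> K) (\<lambda>(x, y). F x y)"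
    using F unfolding hol_family_def
    by (auto elim!: continuous_on_subset) (use X1 K S ball_subset_cball in blast)+
  ultimately obtain d where d: "d > 0" "ball x0 d \<subseteq> X1"
      "\<And>x y. x \<in> ball x0 d \<Longrightarrow> y \<in> K \<Longrightarrow> F x y \<noteq> 0"
    using compact_nonzero_nhd[OF X1(1) x0(1) K(1), of F] by metis
  have dX: "x \<in> X" if "x \<in> ball x0 d" for x using that d(2) X1(4) by blast
  have sub: "cball y e \<subseteq> S" if "y \<in> Z x0" for y
    using e(2)[OF that] S ball_subset_cball[of c r] by blast
  have nzK: "F x z \<noteq> 0" if "x \<in> ball x0 d" "y \<in> Z x0" "z \<in> sphere y e" for x y z
    using d(3)[OF that(1)] that(2,3) by (auto simp: K_def)
  have Fd: "hol_family F (ball x0 d) S" using F by (rule hol_family_subset) (use dX in auto)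
  define m where "m y = size (zero_mset (F x0) y e)" for y
  have size_m: "size (zero_mset (F x) y e) = m y" if "x \<in> ball x0 d" "y \<in> Z x0" for x y
    unfolding m_def
    by (rule size_zero_mset_constant[OF Fd open_ball connected_ball S(1) sub[OF that(2)] e(1)])
      (use nzK[OF _ that(2)] that d(1) in auto)
  have set_z: "set_mset (zero_mset (F x) y e) = {z \<in> ball y e. F x z = 0}"
    if "x \<in> ball x0 d" "y \<in> Z x0" for x y
    using set_zero_mset[OF holF[OF dX[OF that(1)]] S(1) sub[OF that(2)] e(1) nzK[OF that]] .
  have m_pos: "m y > 0" if "y \<in> Z x0" for y
  proof -
    have "y \<in># zero_mset (F x0) y e" using set_z[of x0 y] that d(1) e(1) by (auto simp: Z_def)
    then show ?thesis unfolding m_def by (cases "zero_mset (F x0) y e") auto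
  qed
  define b where "b y x = (\<Sum>z\<in>#zero_mset (F x) y e. z) * inverse (of_nat (m y))" for y x
  have hol_b: "holomorphic_cn (b y) (ball x0 d)" if "y \<in> Z x0" for y
    unfolding b_def
    using holomorphic_cn_sum_zeros[OF Fd hol_family_const_left[OF holomorphic_on_ident] open_ball S(1)
        sub[OF that] e(1) nzK[OF _ that]]
    by (intro holomorphic_cn_mult holomorphic_cn_const)
  \<comment> \<open>The disjoint discs each keep \<open>m y > 0\<close> zeros, which makes at least
    \<open>card (Z x0)\<close> distinct ones. By maximality there are no others: all zeros in one
    disc coincide, and their mean \<open>b y x\<close> is that zero.\<close>
  have zeros: "(\<forall>y\<in>Z x0. b y x \<in> Z x) \<and> Z x \<subseteq> (\<lambda>y. b y x) ` Z x0" if x: "x \<in> ball x0 d" for x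
  proof -
    have "\<exists>z. z \<in> ball y e \<and> F x z = 0" if y: "y \<in> Z x0" for y
      using size_m[OF x y] m_pos[OF y] set_z[OF x y] by (cases "zero_mset (F x) y e") auto
    then obtain s where s: "\<And>y. y \<in> Z x0 \<Longrightarrow> s y \<in> ball y e \<and> F x (s y) = 0" by metis
    have same: "y = y'" if "y \<in> Z x0" "y' \<in> Z x0" "z \<in> ball y e" "z \<in> ball y' e" for y y' z
      using e(3)[OF that(1,2)] that(3,4) ball_subset_cball by blast
    have sZ: "s ` Z x0 \<subseteq> Z x" unfolding Z_def[of x] using s e(2) ball_subset_cball by blast
    have "inj_on s (Z x0)" using s same by (metis inj_onI)
    then have "card (s ` Z x0) = card (Z x0)" by (rule card_image)
    moreover have "card (Z x) \<le> card (Z x0)" using x0(2) x d(2) by blast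
    ultimately have eq: "s ` Z x0 = Z x"
      using card_seteq[OF finZ[OF dX[OF x]] sZ] by simp
    have "b y x = s y" if y: "y \<in> Z x0" for y
    proof -
      have "z = s y" if "z \<in># zero_mset (F x) y e" for z
      proof -
        have z: "z \<in> ball y e" "F x z = 0" using that set_z[OF x y] by auto
        moreover have "z \<in> ball c r" using e(2)[OF y] ball_subset_cball[of y e] z(1) by blast
        ultimately have "z \<in> Z x" by (simp add: Z_def)
        then obtain y' where y': "y' \<in> Z x0" "z = s y'" using eq by blast
        then have "y' = y" using same[OF y'(1) y] s[OF y'(1)] z by blast
        with y' show ?thesis by simp
      qed
      then have "(\<Sum>z\<in>#zero_mset (F x) y e. z) = (\<Sum>z\<in>#zero_mset (F x) y e. s y)"
        by (intro arg_cong[where f = sum_mset] image_mset_cong)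
      then show ?thesis using m_pos[OF y] size_m[OF x y] by (simp add: b_def)
    qed
    then show ?thesis using eq by force
  qed
  have "\<exists>y\<in>Z x0. \<exists>W'. open W' \<and> W' \<noteq> {} \<and> W' \<subseteq> ball x0 d \<and> (\<forall>x\<in>W'. H x (b y x) = 0)"
  proof (rule finite_zero_cover[OF finZ[OF x0X] open_ball])
    show "ball x0 d \<noteq> {}" using d(1) by simp
    show "continuous_on (ball x0 d) (\<lambda>x. H x (b y x))" if "y \<in> Z x0" for y
    proof (rule continuous_on_compose_pair[OF H])
      show "x \<in> X \<and> b y x \<in> S" if "x \<in> ball x0 d" for x
      proof -
        have "b y x \<in> ball c r" using zeros[OF that] \<open>y \<in> Z x0\<close> by (auto simp: Z_def)
        then show ?thesis using dX[OF that] S(2) ball_subset_cball[of c r] by blast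
      qed
    qed (use holomorphic_cn_imp_continuous_on[OF hol_b[OF that]] in \<open>auto intro: continuous_intros\<close>)
    show "\<exists>y\<in>Z x0. H x (b y x) = 0" if x: "x \<in> ball x0 d" for x
    proof -
      obtain z where "z \<in> Z x" "H x z = 0" using common[OF dX[OF x]] by (auto simp: Z_def)
      then show ?thesis using zeros[OF x] by blast
    qed
  qed
  then obtain y W where W: "y \<in> Z x0" "open W" "W \<noteq> {}" "W \<subseteq> ball x0 d" "\<And>x. x \<in> W \<Longrightarrow> H x (b y x) = 0"
    by blast
  show ?thesis
  proof (rule that[of W "b y"])
    show "b y x \<in> ball c r \<and> F x (b y x) = 0 \<and> H x (b y x) = 0" if "x \<in> W" for x
      using zeros[of x] W that by (auto simp: Z_def)
  qed (use W dX hol_b holomorphic_cn_subset in blast)+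
qed


section \<open>Minimal polynomials and common factors\<close>

definition hol_poly :: "(complex ^ 'n \<Rightarrow> complex poly) \<Rightarrow> (complex ^ 'n) set \<Rightarrow> nat \<Rightarrow> bool" where
  "hol_poly p V d \<longleftrightarrow> (\<forall>i. holomorphic_cn (\<lambda>x. coeff (p x) i) V) \<and> (\<forall>x\<in>V. degree (p x) \<le> d)"

lemma holomorphic_cn_diff:
  "holomorphic_cn f U \<Longrightarrow> holomorphic_cn g U \<Longrightarrow> holomorphic_cn (\<lambda>z. f z - g z) U"
  using holomorphic_cn_add[OF _ holomorphic_cn_mult[OF holomorphic_cn_const[of "- 1"]], of f U g] by simp

text \<open>One step of pseudo-division by \<open>r\<close>: multiplying \<open>H\<close> by the
  \<open>k\<close>-th coefficient of \<open>r\<close> cancels the top term without dividing by a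
  function that may have zeros.\<close>

lemma hol_poly_reduce:
  assumes r: "hol_poly r V k" and H: "hol_poly H V D" and k: "0 < k" "k \<le> D"
  shows "hol_poly (\<lambda>x. smult (coeff (r x) k) (H x) - monom (coeff (H x) D) (D - k) * r x) V (D - 1)"
    (is "hol_poly ?p V _")
  unfolding hol_poly_def
proof (intro conjI allI ballI)
  show "holomorphic_cn (\<lambda>x. coeff (?p x) i) V" for i
    using r H unfolding hol_poly_def
    by (cases "i < D - k") (auto simp: coeff_monom_mult intro!: holomorphic_cn_diff holomorphic_cn_mult)
  show "degree (?p x) \<le> D - 1" if "x \<in> V" for x
  proof (rule degree_le, intro allI impI)
    fix i assume i: "i > D - 1"
    have d: "degree (r x) \<le> k" "degree (H x) \<le> D" using r H that by (auto simp: hol_poly_def)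
    show "coeff (?p x) i = 0"
    proof (cases "i = D")
      case True
      then show ?thesis using k by (simp add: coeff_monom_mult)
    next
      case False
      then have "i > D" using i k by linarith
      then have "coeff (H x) i = 0" "coeff (r x) (i - (D - k)) = 0"
        using d k by (auto intro!: coeff_eq_0)
      then show ?thesis by (simp add: coeff_monom_mult)
    qed
  qed
qed

text \<open>Pseudo-division is repeated until the degree bound is below \<open>k\<close>, where
  minimality makes the remainder zero. Each step multiplies \<open>H x\<close> by
  \<open>coeff (r x) k\<close>, a nonzero number at the given point, which can be cancelled.\<close>

lemma minimal_hol_poly_dvd:
  assumes r: "hol_poly r V k" "0 < k" "\<And>x. x \<in> W \<Longrightarrow> poly (r x) (b x) = 0"
    and minimal: "\<And>H d. d < k \<Longrightarrow> hol_poly H V d \<Longrightarrow> (\<And>x. x \<in> W \<Longrightarrow> poly (H x) (b x) = 0) \<Longrightarrow>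
      \<forall>x\<in>V. H x = 0"
    and H: "hol_poly H V D" "\<And>x. x \<in> W \<Longrightarrow> poly (H x) (b x) = 0"
    and x: "x \<in> V" "coeff (r x) k \<noteq> 0"
  shows "r x dvd H x"
  using H
proof (induction D arbitrary: H rule: less_induct)
  case (less D)
  show ?case
  proof (cases "D < k")
    case True
    then show ?thesis using minimal[OF True less.prems] x by simp
  next
    case False
    then have k: "k \<le> D" by simp
    have "r x dvd smult (coeff (r x) k) (H x) - monom (coeff (H x) D) (D - k) * r x"
      using less.prems(2) r
      by (intro less.IH[OF _ hol_poly_reduce[OF r(1) less.prems(1) r(2) k]]) (use k in auto)
    then have "r x dvd smult (coeff (r x) k) (H x)"
      by (metis diff_add_cancel dvd_add dvd_triv_right)
    then show ?thesis using x(2) dvd_smult_cancel by blast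
  qed
qed

lemma coeff_root_poly_bound:
  assumes "\<And>a. a \<in># A \<Longrightarrow> norm a \<le> e" and "0 \<le> e"
  shows "norm (coeff (root_poly A) i) \<le> (1 + e) ^ size A"
  using assms(1)
proof (induction A arbitrary: i)
  case empty
  then show ?case by (cases i) (simp_all add: root_poly_def)
next
  case (add a A)
  have IH: "norm (coeff (root_poly A) j) \<le> (1 + e) ^ size A" for j
    using add by simp
  have a: "norm (a * coeff (root_poly A) j) \<le> e * (1 + e) ^ size A" for j
    unfolding norm_mult using add.prems IH \<open>0 \<le> e\<close> by (intro mult_mono) auto
  show ?case
  proof (cases i)
    case 0
    then show ?thesis using a[of 0] \<open>0 \<le> e\<close> by (simp add: distrib_right add_increasing)
  next
    case (Suc j)
    have "norm (coeff (root_poly A) j - a * coeff (root_poly A) (Suc j))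
        \<le> norm (coeff (root_poly A) j) + norm (a * coeff (root_poly A) (Suc j))" by (rule norm_triangle_ineq4)
    also have "\<dots> \<le> (1 + e) ^ size A + e * (1 + e) ^ size A" using IH a by (intro add_mono)
    finally show ?thesis using Suc by (simp add: algebra_simps)
  qed
qed

lemma poly_eq_smult_root_poly:
  fixes p :: "complex poly"
  assumes "p \<noteq> 0"
  obtains A where "p = smult (lead_coeff p) (root_poly A)" "size A = degree p"
    "\<And>a. a \<in># A \<longleftrightarrow> poly p a = 0"
proof -
  obtain A where A: "size A = degree p" "p = smult (lead_coeff p) (\<Prod>x\<in>#A. [:- x, 1:])"
    using alg_closed_imp_factorization[OF assms] by blast
  have "a \<in># A \<longleftrightarrow> poly p a = 0" for a
    using assms poly_root_poly_eq_0_iff[of A a] by (subst A(2)) (simp add: root_poly_def)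
  with A show ?thesis by (intro that[of A]) (auto simp: root_poly_def)
qed

lemma continuous_on_hol_poly:
  assumes "hol_poly P V k" and "W \<subseteq> V" and "continuous_on W b"
  shows "continuous_on W (\<lambda>x. poly (P x) (b x))"
proof -
  have "continuous_on W (\<lambda>x. \<Sum>i\<le>k. coeff (P x) i * b x ^ i)"
    using assms unfolding hol_poly_def
    by (intro continuous_intros) (auto intro: holomorphic_cn_imp_continuous_on holomorphic_cn_subset)
  moreover have "(\<Sum>i\<le>k. coeff (P x) i * b x ^ i) = poly (P x) (b x)" if "x \<in> W" for x
    unfolding poly_altdef using assms(1,2) that
    by (intro sum.mono_neutral_right) (auto simp: hol_poly_def coeff_eq_0)
  ultimately show ?thesis by (simp cong: continuous_on_cong)
qed

text \<open>The graph of \<open>b\<close> over \<open>W\<close> has a monic minimal polynomial with holomorphic coefficients on all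
  of \<open>V\<close>: a vanishing polynomial \<open>r\<close> of least degree has its roots among those of \<open>Q\<close>, hence its
  coefficients are bounded by its leading coefficient, which therefore divides them.\<close>

lemma minimal_polynomial_of_graph:
  fixes V W :: "(complex ^ 'n) set"
  assumes V: "open V" "convex V" and W: "open W" "W \<subseteq> V" "W \<noteq> {}" and b: "continuous_on W b"
    and Q: "hol_poly Q V m" "\<And>x. x \<in> V \<Longrightarrow> Q x \<noteq> 0" "\<And>x. x \<in> W \<Longrightarrow> poly (Q x) (b x) = 0"
    and roots: "\<And>x y. x \<in> V \<Longrightarrow> poly (Q x) y = 0 \<Longrightarrow> norm y \<le> e" and e: "0 \<le> e"
  obtains P k where "0 < k" "hol_poly P V k" "\<And>x. x \<in> V \<Longrightarrow> coeff (P x) k = 1"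
    "\<And>x. x \<in> W \<Longrightarrow> poly (P x) (b x) = 0" "\<And>x. x \<in> V \<Longrightarrow> P x dvd Q x"
    "\<And>H d. d < k \<Longrightarrow> hol_poly H V d \<Longrightarrow> (\<And>x. x \<in> W \<Longrightarrow> poly (H x) (b x) = 0) \<Longrightarrow> \<forall>x\<in>V. H x = 0"
proof -
  define vanishing where "vanishing H d \<longleftrightarrow> hol_poly H V d \<and> (\<forall>x\<in>W. poly (H x) (b x) = 0)" for H d
  define ex where "ex d \<longleftrightarrow> (\<exists>H. vanishing H d \<and> (\<exists>x\<in>V. H x \<noteq> 0))" for d
  define k where "k = (LEAST d. ex d)"
  obtain w where "w \<in> W" using W by blast
  then have "ex m" unfolding ex_def vanishing_def using Q W by blast
  then have "ex k" unfolding k_def by (rule LeastI)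
  then obtain r x1 where r: "vanishing r k" and x1: "x1 \<in> V" "r x1 \<noteq> 0" unfolding ex_def by blast
  have minimal: "\<forall>x\<in>V. H x = 0"
    if "d < k" "hol_poly H V d" "\<And>x. x \<in> W \<Longrightarrow> poly (H x) (b x) = 0" for H d
  proof -
    have "\<not> ex d" using not_less_Least[of d ex] that(1) by (simp add: k_def)
    then show ?thesis using that(2,3) unfolding ex_def vanishing_def by blast
  qed
  have r': "hol_poly r V k" "\<And>x. x \<in> W \<Longrightarrow> poly (r x) (b x) = 0" using r by (auto simp: vanishing_def)
  have hol_r: "holomorphic_cn (\<lambda>x. coeff (r x) i) V" for i using r' by (simp add: hol_poly_def)
  have deg_r: "degree (r x) \<le> k" if "x \<in> V" for x using r' that by (simp add: hol_poly_def)
  \<comment> \<open>A bound \<open>k = 0\<close> would make \<open>r\<close> a function of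
    \<open>x\<close> alone that vanishes on \<open>W\<close>, hence on \<open>V\<close> by the
    identity theorem.\<close>
  have k: "0 < k"
  proof (rule ccontr)
    assume "\<not> 0 < k"
    then have deg: "degree (r x) = 0" if "x \<in> V" for x using deg_r[OF that] by simp
    then have c: "r x = [:coeff (r x) 0:]" if "x \<in> V" for x using degree_0_id[of "r x"] that by simp
    have "coeff (r x) 0 = 0" if "x \<in> W" for x
      using r'(2)[OF that] c[of x] W(2) that by (metis poly_const_conv subsetD)
    then have "coeff (r x1) 0 = 0"
      using holomorphic_cn_identity[OF hol_r V W _ x1(1)] by blast
    then show False using c[OF x1(1)] x1(2) by simp
  qed
  define a where "a x = coeff (r x) k" for x
  have hol_a: "holomorphic_cn a V" unfolding a_def by (rule hol_r)
  \<comment> \<open>If the leading coefficient \<open>a\<close> vanished identically,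
    \<open>k - 1\<close> would be a smaller degree bound for the same \<open>r\<close>.\<close>
  obtain z where z: "z \<in> V" "a z \<noteq> 0"
  proof (rule ccontr)
    assume *: "\<not> thesis"
    have "degree (r x) \<le> k - 1" if "x \<in> V" for x
    proof (rule degree_le, intro allI impI)
      fix i assume "k - 1 < i"
      then show "coeff (r x) i = 0"
        using * that deg_r[OF that] \<open>\<And>z. z \<in> V \<Longrightarrow> a z \<noteq> 0 \<Longrightarrow> thesis\<close>
        by (cases "i = k") (auto simp: a_def coeff_eq_0)
    qed
    then have "hol_poly r V (k - 1)" using hol_r by (simp add: hol_poly_def)
    from minimal[OF _ this r'(2)] k x1 show False by simp
  qed
  have dense: "\<exists>y\<in>N. a y \<noteq> 0" if "open N" "N \<subseteq> V" "N \<noteq> {}" for N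
    using holomorphic_cn_nonzero_dense[OF hol_a V z that] .
  define C where "C = (1 + e) ^ k"
  \<comment> \<open>Where \<open>a\<close> is nonzero, \<open>r\<close> divides \<open>Q\<close>, so
    its roots have norm at most \<open>e\<close> and \<open>coeff_root_poly_bound\<close> applies. A
    violation of the inequality is an open condition, so it would also occur at such a
    point.\<close>
  have bound: "norm (coeff (r x) i) \<le> C * norm (a x)" if x: "x \<in> V" for x i
  proof (rule ccontr)
    assume "\<not> norm (coeff (r x) i) \<le> C * norm (a x)"
    define N where "N = V \<inter> (\<lambda>x. norm (coeff (r x) i) - C * norm (a x)) -` {0<..}"
    have "open N" unfolding N_def
      using holomorphic_cn_imp_continuous_on[OF hol_r[of i]] holomorphic_cn_imp_continuous_on[OF hol_a] V(1)
      by (intro continuous_open_preimage continuous_intros) auto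
    moreover have "x \<in> N"
      using x \<open>\<not> norm (coeff (r x) i) \<le> C * norm (a x)\<close> by (simp add: N_def)
    moreover have "N \<subseteq> V" by (simp add: N_def)
    ultimately obtain y where y: "y \<in> N" "a y \<noteq> 0" using dense by blast
    have yV: "y \<in> V" using y by (simp add: N_def)
    have "degree (r y) = k" using deg_r[OF yV] le_degree[of "r y" k] y(2) by (simp add: a_def)
    moreover have "r y \<noteq> 0" using y(2) by (auto simp: a_def)
    ultimately obtain A where A: "r y = smult (a y) (root_poly A)" "size A = k"
        "\<And>u. u \<in># A \<longleftrightarrow> poly (r y) u = 0"
      using poly_eq_smult_root_poly[of "r y"] unfolding a_def by metis
    have "r y dvd Q y"
      by (rule minimal_hol_poly_dvd[OF r'(1) k r'(2) minimal Q(1,3) yV])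
        (use y in \<open>auto simp: a_def\<close>)
    then have "norm u \<le> e" if "u \<in># A" for u
      using roots[OF yV] A(3) that by (metis dvd_trans poly_eq_0_iff_dvd)
    from coeff_root_poly_bound[OF this e, of A i]
    have "norm (coeff (r y) i) \<le> C * norm (a y)"
      unfolding A(1) coeff_smult norm_mult C_def A(2)[symmetric]
      by (subst mult.commute) (auto intro!: mult_right_mono)
    then show False using y(1) by (simp add: N_def)
  qed
  have "\<exists>u. holomorphic_cn u V \<and> (\<forall>x\<in>V. coeff (r x) i = u x * a x)" for i
    using holomorphic_cn_bounded_quotient[OF V hol_a hol_r z bound] by metis
  then obtain u where u: "\<And>i. holomorphic_cn (u i) V" "\<And>i x. x \<in> V \<Longrightarrow> coeff (r x) i = u i x * a x"
    by metis
  \<comment> \<open>The quotients \<open>u i\<close> of the coefficients by \<open>a\<close> give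
    \<open>r = a P\<close> with \<open>P\<close> monic. Since its leading coefficient never
    vanishes, \<open>P\<close> divides \<open>Q\<close> at every point of \<open>V\<close>.\<close>
  define P where "P x = monom 1 k + (\<Sum>i<k. monom (u i x) i)" for x
  have coeff_P: "coeff (P x) i = (if i < k then u i x else if i = k then 1 else 0)" for x i
    unfolding P_def by (simp add: coeff_sum)
  have hol_P: "hol_poly P V k"
    unfolding hol_poly_def
  proof (intro conjI allI ballI)
    show "holomorphic_cn (\<lambda>x. coeff (P x) i) V" for i
      by (cases "i < k") (auto simp: coeff_P u holomorphic_cn_const)
  qed (auto simp: coeff_P intro!: degree_le)
  have smult_P: "smult (a x) (P x) = r x" if "x \<in> V" for x
  proof (rule poly_eqI)
    fix i show "coeff (smult (a x) (P x)) i = coeff (r x) i"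
      using u(2)[OF that, of i] deg_r[OF that] by (auto simp: coeff_P a_def coeff_eq_0)
  qed
  have van_P: "poly (P x) (b x) = 0" if x: "x \<in> W" for x
  proof (rule ccontr)
    assume ne: "poly (P x) (b x) \<noteq> 0"
    define N where "N = W \<inter> (\<lambda>x. poly (P x) (b x)) -` (- {0})"
    have "open N" unfolding N_def
      using continuous_on_hol_poly[OF hol_P W(2) b] W(1) by (intro continuous_open_preimage) auto
    moreover have "x \<in> N" using ne x by (simp add: N_def)
    moreover have "N \<subseteq> V" using W(2) by (auto simp: N_def)
    ultimately obtain y where y: "y \<in> N" "a y \<noteq> 0" using dense by blast
    then have "a y * poly (P y) (b y) = 0"
      using smult_P[of y] r'(2)[of y] W(2) by (auto simp: N_def simp flip: poly_smult)
    with y show False by (simp add: N_def)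
  qed
  show ?thesis
  proof (rule that[OF k hol_P _ van_P])
    show "coeff (P x) k = 1" for x by (simp add: coeff_P)
    show "P x dvd Q x" if "x \<in> V" for x
      by (rule minimal_hol_poly_dvd[OF hol_P k van_P minimal Q(1,3) that]) (simp_all add: coeff_P)
  qed (use minimal in blast)+
qed

section \<open>Weierstrass division with parameters\<close>

lemma poly_altdef_le: "degree p \<le> k \<Longrightarrow> poly p y = (\<Sum>i\<le>k. coeff p i * y ^ i)"
  for p :: "'a::comm_semiring_1 poly"
  unfolding poly_altdef by (intro sum.mono_neutral_left) (auto simp: coeff_eq_0)

lemma hol_family_add:
  assumes "hol_family F X S" and "hol_family G X S"
  shows "hol_family (\<lambda>x y. F x y + G x y) X S"
  unfolding hol_family_def split_beta
  using assms[unfolded hol_family_def split_beta]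
  by (intro conjI ballI continuous_on_add holomorphic_on_add holomorphic_cn_add) simp_all

lemma hol_family_sum:
  assumes "\<And>i. i \<in> I \<Longrightarrow> hol_family (F i) X S"
  shows "hol_family (\<lambda>x y. \<Sum>i\<in>I. F i x y) X S"
  using assms
proof (induction I rule: infinite_finite_induct)
  case (insert i I)
  then show ?case using hol_family_add[of "F i" X S "\<lambda>x y. \<Sum>i\<in>I. F i x y"] by simp
qed (simp_all add: hol_family_const_right holomorphic_cn_const)

lemma hol_family_cong:
  assumes F: "hol_family F X S" and "open X" and eq: "\<And>x y. x \<in> X \<Longrightarrow> F x y = G x y"
  shows "hol_family G X S"
proof -
  have "continuous_on (X \<times> S) (\<lambda>(x, y). G x y) \<longleftrightarrow> continuous_on (X \<times> S) (\<lambda>(x, y). F x y)"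
    by (rule continuous_on_cong) (auto simp: eq)
  moreover have "G x = F x" if "x \<in> X" for x using eq[OF that] by auto
  moreover have "holomorphic_cn (\<lambda>x. G x y) X" if "y \<in> S" for y
    by (rule holomorphic_cn_cong[OF \<open>open X\<close> _ eq]) (use F that in \<open>auto simp: hol_family_def\<close>)
  ultimately show ?thesis using F by (simp add: hol_family_def)
qed

lemma hol_family_poly:
  assumes P: "hol_poly P V k" and "open V"
  shows "hol_family (\<lambda>x y. poly (P x) y) V S"
proof (rule hol_family_cong[OF _ \<open>open V\<close>])
  show "hol_family (\<lambda>x y. \<Sum>i\<le>k. coeff (P x) i * y ^ i) V S"
    using P unfolding hol_poly_def
    by (intro hol_family_sum hol_family_mult hol_family_const_right hol_family_const_left
        holomorphic_intros) auto
  show "(\<Sum>i\<le>k. coeff (P x) i * y ^ i) = poly (P x) y" if "x \<in> V" for x y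
    using P that by (intro poly_altdef_le[symmetric]) (simp add: hol_poly_def)
qed

lemma has_contour_integral_circlepathI:
  assumes "continuous_on (sphere c r) f" and "0 \<le> r"
  shows "(f has_contour_integral contour_integral (circlepath c r) f) (circlepath c r)"
  using assms by (intro has_contour_integral_integral contour_integrable_continuous_circlepath) simp

text \<open>The remainder of Weierstrass division by \<open>P\<close> is a polynomial of degree less than \<open>k\<close> that
  vanishes on the graph of \<open>b\<close>, hence is zero.\<close>

lemma weierstrass_division_minimal:
  fixes V W :: "(complex ^ 'n) set"
  assumes "open V" and S: "open S" "cball 0 e \<subseteq> S" and e: "0 < e"
    and P: "hol_poly P V k" "0 < k" "\<And>x y. x \<in> V \<Longrightarrow> y \<in> sphere 0 e \<Longrightarrow> poly (P x) y \<noteq> 0"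
    and minimal: "\<And>H d. d < k \<Longrightarrow> hol_poly H V d \<Longrightarrow> (\<And>x. x \<in> W \<Longrightarrow> poly (H x) (b x) = 0) \<Longrightarrow>
      \<forall>x\<in>V. H x = 0"
    and G: "hol_family G V S"
    and W: "W \<subseteq> V" "\<And>x. x \<in> W \<Longrightarrow> b x \<in> ball 0 e \<and> poly (P x) (b x) = 0 \<and> G x (b x) = 0"
  obtains q where "holomorphic_cn q V" "\<And>x. x \<in> V \<Longrightarrow> G x 0 = poly (P x) 0 * q x"
proof -
  have sph: "sphere 0 e \<subseteq> S" using S(2) by auto
  define K where "K x \<zeta> = G x \<zeta> * inverse (poly (P x) \<zeta>)" for x \<zeta>
  have K: "hol_family K V (sphere 0 e)"
    unfolding K_def using P(3)
    by (intro hol_family_mult hol_family_inverse hol_family_subset[OF G order_refl sph]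
        hol_family_poly[OF P(1) \<open>open V\<close>])
  define J where "J f x = contour_integral (circlepath 0 e) (\<lambda>\<zeta>. K x \<zeta> * f \<zeta>) * inverse (2 * pi * \<i>)" for f x
  have hol_J: "holomorphic_cn (J f) V" if "f holomorphic_on sphere 0 e" for f
    unfolding J_def
    by (rule holomorphic_cn_mult[OF holomorphic_cn_family_contour_integral[OF hol_family_mult[OF K
        hol_family_const_left[OF that]] less_imp_le[OF e] \<open>open V\<close>] holomorphic_cn_const])
  have J: "((\<lambda>\<zeta>. K x \<zeta> * f \<zeta>) has_contour_integral 2 * pi * \<i> * J f x) (circlepath 0 e)"
    if "continuous_on (sphere 0 e) f" "x \<in> V" for f x
  proof -
    have "continuous_on (sphere 0 e) (K x)"
      using K that(2) by (auto simp: hol_family_def holomorphic_on_imp_continuous_on)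
    then have cont: "continuous_on (sphere 0 e) (\<lambda>\<zeta>. K x \<zeta> * f \<zeta>)"
      using that(1) by (intro continuous_intros)
    have eq: "contour_integral (circlepath 0 e) (\<lambda>\<zeta>. K x \<zeta> * f \<zeta>) = 2 * pi * \<i> * J f x"
      by (simp add: J_def field_simps)
    from has_contour_integral_circlepathI[OF cont less_imp_le[OF e]] show ?thesis unfolding eq .
  qed
  \<comment> \<open>This is the Cauchy integral of \<open>(G / P) (\<zeta>)\<close> times the
    difference quotient of \<open>P\<close> between \<open>\<zeta>\<close> and \<open>y\<close>,
    expanded by the geometric sum for \<open>(\<zeta>^l - y^l) / (\<zeta> - y)\<close>. The expanded
    form is a polynomial in \<open>y\<close> of degree below \<open>k\<close>; the unexpanded one
    shows that it is the remainder of \<open>G\<close> modulo \<open>P\<close>.\<close>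
  define r where "r x = (\<Sum>l\<le>k. \<Sum>j<l. monom (coeff (P x) l * J (\<lambda>\<zeta>. \<zeta> ^ (l - Suc j)) x) j)" for x
  have hol_r: "hol_poly r V (k - 1)"
    unfolding hol_poly_def
  proof (intro conjI allI ballI)
    fix i
    have "holomorphic_cn (\<lambda>x. \<Sum>l\<le>k. \<Sum>j<l. (if j = i then coeff (P x) l * J (\<lambda>\<zeta>. \<zeta> ^ (l - Suc j)) x else 0)) V"
    proof (intro holomorphic_cn_sum)
      fix l j
      have "holomorphic_cn (\<lambda>x. coeff (P x) l * J (\<lambda>\<zeta>. \<zeta> ^ (l - Suc j)) x) V"
        using P(1) by (intro holomorphic_cn_mult hol_J holomorphic_intros) (simp add: hol_poly_def)
      then show "holomorphic_cn (\<lambda>x. if j = i then coeff (P x) l * J (\<lambda>\<zeta>. \<zeta> ^ (l - Suc j)) x else 0) V"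
        by (cases "j = i") (auto intro: holomorphic_cn_const)
    qed
    then show "holomorphic_cn (\<lambda>x. coeff (r x) i) V"
      by (simp add: r_def coeff_sum)
    show "degree (r x) \<le> k - 1" for x
      unfolding r_def
      by (intro degree_sum_le finite_atMost finite_lessThan order_trans[OF degree_monom_le]) auto
  qed
  have division: "poly (r x) y = G x y - poly (P x) y * J (\<lambda>\<zeta>. inverse (\<zeta> - y)) x"
    if x: "x \<in> V" and y: "y \<in> ball 0 e" for x y
  proof -
    have "((\<lambda>\<zeta>. \<Sum>l\<le>k. \<Sum>j<l. (coeff (P x) l * y ^ j) * (K x \<zeta> * \<zeta> ^ (l - Suc j))) has_contour_integral
      (\<Sum>l\<le>k. \<Sum>j<l. (coeff (P x) l * y ^ j) * (2 * pi * \<i> * J (\<lambda>\<zeta>. \<zeta> ^ (l - Suc j)) x))) (circlepath 0 e)"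
      by (intro has_contour_integral_sum has_contour_integral_lmul J x continuous_intros) auto
    moreover have "(\<Sum>l\<le>k. \<Sum>j<l. (coeff (P x) l * y ^ j) * (2 * pi * \<i> * J (\<lambda>\<zeta>. \<zeta> ^ (l - Suc j)) x))
      = 2 * pi * \<i> * poly (r x) y"
      by (simp add: r_def poly_sum poly_monom sum_distrib_left mult_ac)
    ultimately have 1: "((\<lambda>\<zeta>. \<Sum>l\<le>k. \<Sum>j<l. (coeff (P x) l * y ^ j) * (K x \<zeta> * \<zeta> ^ (l - Suc j)))
      has_contour_integral 2 * pi * \<i> * poly (r x) y) (circlepath 0 e)" by simp
    have ne: "\<zeta> - y \<noteq> 0" if "\<zeta> \<in> sphere 0 e" for \<zeta> using y that by auto
    have "G x holomorphic_on S" using G x by (simp add: hol_family_def)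
    then have "continuous_on (cball 0 e) (G x)" "G x holomorphic_on ball 0 e"
      using S(2) ball_subset_cball[of 0 e] holomorphic_on_imp_continuous_on holomorphic_on_subset
      by blast+
    then have "((\<lambda>\<zeta>. G x \<zeta> / (\<zeta> - y)) has_contour_integral 2 * pi * \<i> * G x y) (circlepath 0 e)"
      using y Cauchy_integral_circlepath[of 0 e "G x" y] by simp
    moreover have "((\<lambda>\<zeta>. K x \<zeta> * inverse (\<zeta> - y)) has_contour_integral
        2 * pi * \<i> * J (\<lambda>\<zeta>. inverse (\<zeta> - y)) x) (circlepath 0 e)"
      using ne by (intro J x continuous_intros) auto
    ultimately have "((\<lambda>\<zeta>. G x \<zeta> / (\<zeta> - y) - poly (P x) y * (K x \<zeta> * inverse (\<zeta> - y))) has_contour_integral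
       2 * pi * \<i> * G x y - poly (P x) y * (2 * pi * \<i> * J (\<lambda>\<zeta>. inverse (\<zeta> - y)) x)) (circlepath 0 e)"
      by (intro has_contour_integral_diff has_contour_integral_lmul)
    then have 2: "((\<lambda>\<zeta>. \<Sum>l\<le>k. \<Sum>j<l. (coeff (P x) l * y ^ j) * (K x \<zeta> * \<zeta> ^ (l - Suc j)))
      has_contour_integral 2 * pi * \<i> * G x y - poly (P x) y * (2 * pi * \<i> * J (\<lambda>\<zeta>. inverse (\<zeta> - y)) x))
      (circlepath 0 e)"
    proof (rule has_contour_integral_eq)
      fix \<zeta> assume "\<zeta> \<in> path_image (circlepath 0 e)"
      then have \<zeta>: "\<zeta> \<in> sphere 0 e" using e by simp
      have deg: "degree (P x) \<le> k" using P(1) x by (simp add: hol_poly_def)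
      have sum_l: "(\<Sum>j<l. y ^ j * \<zeta> ^ (l - Suc j)) = (\<zeta> ^ l - y ^ l) * inverse (\<zeta> - y)" for l
      proof -
        define s where "s = (\<Sum>j<l. \<zeta> ^ (l - Suc j) * y ^ j)"
        have "\<zeta> ^ l - y ^ l = s * (\<zeta> - y)"
          using power_diff_sumr2[of y l \<zeta>] unfolding s_def[symmetric] by (simp add: algebra_simps)
        then have "(\<zeta> ^ l - y ^ l) * inverse (\<zeta> - y) = s" using ne[OF \<zeta>] by simp
        then show ?thesis by (simp add: s_def mult.commute)
      qed
      have "(\<Sum>l\<le>k. \<Sum>j<l. (coeff (P x) l * y ^ j) * (K x \<zeta> * \<zeta> ^ (l - Suc j)))
          = K x \<zeta> * (\<Sum>l\<le>k. coeff (P x) l * (\<Sum>j<l. y ^ j * \<zeta> ^ (l - Suc j)))"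
        by (simp add: sum_distrib_left mult_ac)
      also have "\<dots> = K x \<zeta> * inverse (\<zeta> - y) * (\<Sum>l\<le>k. coeff (P x) l * \<zeta> ^ l - coeff (P x) l * y ^ l)"
        unfolding sum_l by (simp add: sum_distrib_left algebra_simps)
      also have "\<dots> = K x \<zeta> * inverse (\<zeta> - y) * (poly (P x) \<zeta> - poly (P x) y)"
        by (simp add: poly_altdef_le[OF deg] sum_subtractf)
      also have "\<dots> = G x \<zeta> / (\<zeta> - y) - poly (P x) y * (K x \<zeta> * inverse (\<zeta> - y))"
      proof -
        have "K x \<zeta> * poly (P x) \<zeta> = G x \<zeta>" using P(3)[OF x \<zeta>] by (simp add: K_def)
        moreover have "K x \<zeta> * inverse (\<zeta> - y) * (poly (P x) \<zeta> - poly (P x) y) =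
            K x \<zeta> * poly (P x) \<zeta> * inverse (\<zeta> - y) - poly (P x) y * (K x \<zeta> * inverse (\<zeta> - y))"
          by (simp add: right_diff_distrib mult_ac)
        ultimately show ?thesis by (simp add: divide_inverse)
      qed
      finally show "G x \<zeta> / (\<zeta> - y) - poly (P x) y * (K x \<zeta> * inverse (\<zeta> - y)) =
        (\<Sum>l\<le>k. \<Sum>j<l. (coeff (P x) l * y ^ j) * (K x \<zeta> * \<zeta> ^ (l - Suc j)))" by simp
    qed
    from has_contour_integral_unique[OF 1 2]
    have "2 * pi * \<i> * poly (r x) y = 2 * pi * \<i> * (G x y - poly (P x) y * J (\<lambda>\<zeta>. inverse (\<zeta> - y)) x)"
      by (simp add: algebra_simps)
    then show ?thesis by simp
  qed
  have "\<forall>x\<in>V. r x = 0"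
  proof (rule minimal[OF _ hol_r])
    show "poly (r x) (b x) = 0" if "x \<in> W" for x
      using division[of x "b x"] W(1) W(2)[OF that] that by auto
  qed (use P(2) in simp)
  then have "G x 0 = poly (P x) 0 * J inverse x" if "x \<in> V" for x
    using division[OF that, of 0] e that by simp
  moreover have "holomorphic_cn (J inverse) V"
    using e by (intro hol_J holomorphic_intros) auto
  ultimately show ?thesis using that by blast
qed

text \<open>The common factor is the minimal polynomial of the graph, evaluated at \<open>y = 0\<close>.\<close>

lemma common_graph_imp_common_factor:
  fixes V W :: "(complex ^ 'n) set"
  assumes V: "open V" "convex V" "0 \<in> V" and S: "open S" "cball 0 e \<subseteq> S" and e: "0 < e"
    and F: "hol_family F V S" and G: "hol_family G V S"
    and nz: "\<And>x y. x \<in> V \<Longrightarrow> y \<in> sphere 0 e \<Longrightarrow> F x y \<noteq> 0"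
    and F0: "\<And>y. y \<in> ball 0 e \<Longrightarrow> F 0 y = 0 \<Longrightarrow> y = 0"
    and W: "open W" "W \<subseteq> V" "W \<noteq> {}" and b: "continuous_on W b"
    and graph: "\<And>x. x \<in> W \<Longrightarrow> b x \<in> ball 0 e \<and> F x (b x) = 0 \<and> G x (b x) = 0"
  obtains D q1 q2 where "holomorphic_cn D V" "holomorphic_cn q1 V" "holomorphic_cn q2 V" "D 0 = 0"
    "\<And>x. x \<in> V \<Longrightarrow> F x 0 = D x * q1 x" "\<And>x. x \<in> V \<Longrightarrow> G x 0 = D x * q2 x"
proof -
  \<comment> \<open>The Weierstrass polynomial of \<open>F\<close>: monic, its roots being the zeros
    of \<open>F x\<close> in the disc. Its coefficients are holomorphic by Newton's identities, so
    the search for a minimal polynomial can start from it.\<close>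
  define Q where "Q x = root_poly (zero_mset (F x) 0 e)" for x
  define N where "N = size (zero_mset (F 0) 0 e)"
  have size: "size (zero_mset (F x) 0 e) = N" if "x \<in> V" for x
    unfolding N_def
    by (rule size_zero_mset_constant[OF F V(1) convex_connected[OF V(2)] S e nz that V(3)])
  have hol_Q: "hol_poly Q V N"
    unfolding hol_poly_def
  proof (intro conjI allI ballI)
    show "holomorphic_cn (\<lambda>x. coeff (Q x) i) V" for i
      unfolding Q_def
    proof (rule holomorphic_cn_coeff_root_poly[OF V(1) size])
      show "holomorphic_cn (\<lambda>x. \<Sum>a\<in>#zero_mset (F x) 0 e. a ^ k) V" for k
        by (rule holomorphic_cn_sum_zeros[where \<phi> = "\<lambda>x z. z ^ k", OF F _ V(1) S e nz])
          (auto intro!: hol_family_const_left holomorphic_intros)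
    qed
    show "degree (Q x) \<le> N" if "x \<in> V" for x
      using size[OF that] by (simp add: Q_def degree_root_poly)
  qed
  have root_Q: "poly (Q x) y = 0 \<longleftrightarrow> y \<in> ball 0 e \<and> F x y = 0" if "x \<in> V" for x y
  proof -
    have "F x holomorphic_on S" using F that by (simp add: hol_family_def)
    from set_zero_mset[OF this S e nz[OF that]] show ?thesis
      by (simp add: Q_def poly_root_poly_eq_0_iff)
  qed
  have van_Q: "poly (Q x) (b x) = 0" if "x \<in> W" for x
    using root_Q[of x "b x"] graph[OF that] W(2) that by blast
  have Q_ne: "Q x \<noteq> 0" for x by (simp add: Q_def root_poly_nonzero)
  have roots: "norm y \<le> e" if "x \<in> V" "poly (Q x) y = 0" for x y
    using root_Q[OF that(1), of y] that(2) by simp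
  obtain P k where P: "0 < k" "hol_poly P V k" "\<And>x. x \<in> V \<Longrightarrow> coeff (P x) k = 1"
    "\<And>x. x \<in> W \<Longrightarrow> poly (P x) (b x) = 0" "\<And>x. x \<in> V \<Longrightarrow> P x dvd Q x"
    and minimal: "\<And>H d. d < k \<Longrightarrow> hol_poly H V d \<Longrightarrow> (\<And>x. x \<in> W \<Longrightarrow> poly (H x) (b x) = 0) \<Longrightarrow> \<forall>x\<in>V. H x = 0"
  proof (rule minimal_polynomial_of_graph[OF V(1,2) W b hol_Q Q_ne _ _ less_imp_le[OF e]])
    show "poly (Q x) (b x) = 0" if "x \<in> W" for x using van_Q[OF that] .
    show "norm y \<le> e" if "x \<in> V" "poly (Q x) y = 0" for x y using roots[OF that] .
  next
    fix P k
    assume a: "0 < k" "hol_poly P V k" "\<And>x. x \<in> V \<Longrightarrow> coeff (P x) k = 1"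
      "\<And>x. x \<in> W \<Longrightarrow> poly (P x) (b x) = 0" "\<And>x. x \<in> V \<Longrightarrow> P x dvd Q x"
      "\<And>H d. d < k \<Longrightarrow> hol_poly H V d \<Longrightarrow> (\<And>x. x \<in> W \<Longrightarrow> poly (H x) (b x) = 0) \<Longrightarrow> \<forall>x\<in>V. H x = 0"
    show thesis by (rule that) (fact a)+
  qed
  have root_P: "y \<in> ball 0 e \<and> F x y = 0" if "x \<in> V" "poly (P x) y = 0" for x y
    using root_Q[OF that(1), of y] P(5)[OF that(1)] that(2) by (metis dvd_trans poly_eq_0_iff_dvd)
  have P_nz: "poly (P x) y \<noteq> 0" if "x \<in> V" "y \<in> sphere 0 e" for x y
    using root_P[OF that(1), of y] that(2) by auto
  obtain q1 where q1: "holomorphic_cn q1 V" "\<And>x. x \<in> V \<Longrightarrow> F x 0 = poly (P x) 0 * q1 x"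
    by (rule weierstrass_division_minimal[OF V(1) S e P(2,1) P_nz minimal F W(2)])
      (use graph P(4) in auto)
  obtain q2 where q2: "holomorphic_cn q2 V" "\<And>x. x \<in> V \<Longrightarrow> G x 0 = poly (P x) 0 * q2 x"
    by (rule weierstrass_division_minimal[OF V(1) S e P(2,1) P_nz minimal G W(2)])
      (use graph P(4) in auto)
  \<comment> \<open>The factor must not be a unit: \<open>P 0\<close> is monic of positive degree,
    so it has a root; this is a zero of \<open>F 0\<close> in the disc, hence 0 by
    \<open>F0\<close>.\<close>
  have "degree (P 0) \<noteq> 0"
    using P(1) P(3)[OF V(3)] le_degree[of "P 0" k] by auto
  then have "\<not> constant (poly (P 0))" by (simp add: constant_degree)
  then obtain y where "poly (P 0) y = 0" using fundamental_theorem_of_algebra by blast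
  then have "poly (P 0) 0 = 0" using root_P[OF V(3), of y] F0[of y] by auto
  moreover have "holomorphic_cn (\<lambda>x. poly (P x) 0) V"
    using P(2) by (simp add: hol_poly_def poly_0_coeff_0)
  ultimately show ?thesis using that q1 q2 by blast
qed


section \<open>Submanifolds contained in graphs\<close>

lemma holomorphic_cn_compose_linear:
  fixes L :: "complex ^ 'n \<Rightarrow> complex ^ 'n"
  assumes f: "holomorphic_cn f U" and L: "linear L" "\<And>c v. L (c *s v) = c *s L v"
  shows "holomorphic_cn (\<lambda>z. f (L z)) {z. L z \<in> U}"
  unfolding holomorphic_cn_def
proof
  fix z assume "z \<in> {z. L z \<in> U}"
  then obtain D where D: "(f has_derivative D) (at (L z))" "\<forall>c v. D (c *s v) = c * D v"
    using f unfolding holomorphic_cn_def by blast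
  have "(L has_derivative L) (at z)"
    using L(1) by (intro bounded_linear_imp_has_derivative) (simp add: linear_conv_bounded_linear[symmetric])
  from has_derivative_compose[OF this D(1)] D(2) L(2)
  show "\<exists>D. ((\<lambda>z. f (L z)) has_derivative D) (at z) \<and> (\<forall>c v. D (c *s v) = c * D v)"
    by (intro exI[of _ "\<lambda>z. D (L z)"]) simp
qed

lemma holomorphic_cn_component:
  fixes U :: "(complex ^ 'n) set"
  shows "holomorphic_cn (\<lambda>z. z $ i) U"
  unfolding holomorphic_cn_def
proof
  fix z :: "complex ^ 'n"
  have "((\<lambda>z. z $ i) has_derivative (\<lambda>z. z $ i)) (at z)"
    by (intro bounded_linear_imp_has_derivative bounded_linear_vec_nth)
  then show "\<exists>D. ((\<lambda>z. z $ i) has_derivative D) (at z) \<and> (\<forall>c v. D (c *s v) = c * D v)"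
    by (intro exI[of _ "\<lambda>z. z $ i"]) simp
qed

text \<open>The chart projects along \<open>v\<close> onto the hyperplane \<open>z $ i = 0\<close> and uses the displacement from
  the graph in the direction \<open>v\<close> as its \<open>i\<close>-th coordinate.\<close>

lemma graph_submanifold_hyperplane:
  fixes v w :: "complex ^ 'n"
  assumes v: "v $ i \<noteq> 0" and W: "open W" "w \<in> W" "w $ i = 0" and b: "holomorphic_cn b W"
  shows "complex_submanifold (CARD('n) - 1) {x + b x *s v | x. x \<in> W \<and> x $ i = 0}"
    (is "complex_submanifold _ ?M")
proof -
  define \<pi> where "\<pi> z = z - (z $ i / v $ i) *s v" for z
  define \<phi> where "\<phi> z = \<pi> z + (b (\<pi> z) - z $ i / v $ i) *s axis i 1" for z
  define \<sigma> where "\<sigma> y = y - y $ i *s axis i 1" for y :: "complex ^ 'n"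
  \<comment> \<open>Inverse of \<open>\<phi>\<close>. It has the same form because
    \<open>t = b - (b - t)\<close>, with \<open>b\<close> evaluated at the same point on both sides
    since \<open>\<sigma> (\<phi> z) = \<pi> z\<close>.\<close>
  define \<psi> where "\<psi> y = \<sigma> y + (b (\<sigma> y) - y $ i) *s v" for y
  define U where "U = {z. \<pi> z \<in> W}"
  define V where "V = {y. \<sigma> y \<in> W}"
  have lin: "linear \<pi>" "linear \<sigma>"
    unfolding \<pi>_def \<sigma>_def
    by (rule linearI; simp add: vec_eq_iff divide_inverse algebra_simps)+
  have scale: "\<pi> (c *s x) = c *s \<pi> x" "\<sigma> (c *s x) = c *s \<sigma> x" for c x
    unfolding \<pi>_def \<sigma>_def by (simp_all add: vec_eq_iff algebra_simps)
  have \<pi>_i: "\<pi> z $ i = 0" for z using v by (simp add: \<pi>_def)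
  have \<sigma>_i: "\<sigma> z $ i = 0" for z by (simp add: \<sigma>_def axis_def)
  have \<pi>_line: "\<pi> (x + t *s v) = x" if "x $ i = 0" for x t
    using v that by (simp add: \<pi>_def vec_eq_iff)
  have \<pi>_dec: "z = \<pi> z + (z $ i / v $ i) *s v" for z by (simp add: \<pi>_def)
  have \<sigma>_line: "\<sigma> (x + t *s axis i 1) = x" if "x $ i = 0" for x t
    using that by (simp add: \<sigma>_def vec_eq_iff axis_def)
  have \<sigma>_dec: "y = \<sigma> y + y $ i *s axis i 1" for y by (simp add: \<sigma>_def)
  have open_U: "open U" "open V"
    unfolding U_def V_def using lin W(1)
    by (auto intro!: open_vimage[unfolded vimage_def] linear_continuous_on
        simp: linear_conv_bounded_linear)
  have \<phi>_i: "\<phi> z $ i = b (\<pi> z) - z $ i / v $ i" for z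
    by (simp add: \<phi>_def \<pi>_i axis_def)
  have \<sigma>_\<phi>: "\<sigma> (\<phi> z) = \<pi> z" for z unfolding \<phi>_def by (rule \<sigma>_line[OF \<pi>_i])
  have \<psi>_i: "\<psi> y $ i / v $ i = b (\<sigma> y) - y $ i" for y
    using v by (simp add: \<psi>_def \<sigma>_i diff_divide_distrib)
  have \<pi>_\<psi>: "\<pi> (\<psi> y) = \<sigma> y" for y unfolding \<psi>_def by (rule \<pi>_line[OF \<sigma>_i])
  have \<psi>_\<phi>: "\<psi> (\<phi> z) = z" for z
    using \<pi>_dec[of z] by (simp add: \<psi>_def \<sigma>_\<phi> \<phi>_i)
  have \<phi>_\<psi>: "\<phi> (\<psi> y) = y" for y
    using \<sigma>_dec[of y] by (simp add: \<phi>_def \<pi>_\<psi> \<psi>_i)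
  have bij: "bij_betw \<phi> U V"
    by (rule bij_betw_byWitness[where f' = \<psi>]) (auto simp: \<psi>_\<phi> \<phi>_\<psi> U_def V_def \<sigma>_\<phi> \<pi>_\<psi>)
  have inv: "inv_into U \<phi> y = \<psi> y" if "y \<in> V" for y
    using inv_into_f_f[of \<phi> U "\<psi> y"] bij that
    by (auto simp: bij_betw_def \<phi>_\<psi> U_def V_def \<pi>_\<psi>)
  have chart: "biholomorphic_cn \<phi> U V"
    unfolding biholomorphic_cn_def
  proof (intro conjI open_U bij allI)
    fix j
    have "holomorphic_cn (\<lambda>z. \<pi> z $ j) U" "holomorphic_cn (\<lambda>z. b (\<pi> z)) U"
      unfolding U_def
      by (rule holomorphic_cn_compose_linear[OF holomorphic_cn_component[of _ W] lin(1) scale(1)],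
          rule holomorphic_cn_compose_linear[OF b lin(1) scale(1)])
    then show "holomorphic_cn (\<lambda>z. \<phi> z $ j) U"
      unfolding \<phi>_def vector_add_component vector_smult_component divide_inverse
      by (intro holomorphic_cn_add holomorphic_cn_mult holomorphic_cn_diff holomorphic_cn_const
          holomorphic_cn_component)
    have "holomorphic_cn (\<lambda>z. \<sigma> z $ j) V" "holomorphic_cn (\<lambda>z. b (\<sigma> z)) V"
      unfolding V_def
      by (rule holomorphic_cn_compose_linear[OF holomorphic_cn_component[of _ W] lin(2) scale(2)],
          rule holomorphic_cn_compose_linear[OF b lin(2) scale(2)])
    then have "holomorphic_cn (\<lambda>z. \<psi> z $ j) V"
      unfolding \<psi>_def vector_add_component vector_smult_component
      by (intro holomorphic_cn_add holomorphic_cn_mult holomorphic_cn_diff holomorphic_cn_const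
          holomorphic_cn_component)
    then show "holomorphic_cn (\<lambda>w. inv_into U \<phi> w $ j) V"
      by (rule holomorphic_cn_cong[OF open_U(2)]) (simp add: inv)
  qed
  have M: "z \<in> ?M \<longleftrightarrow> z \<in> U \<and> \<phi> z $ i = 0" for z
  proof
    assume "z \<in> ?M"
    then obtain x where x: "z = x + b x *s v" "x \<in> W" "x $ i = 0" by blast
    then have "\<pi> z = x" by (simp add: \<pi>_line)
    then show "z \<in> U \<and> \<phi> z $ i = 0" using x v by (simp add: U_def \<phi>_i)
  next
    assume z: "z \<in> U \<and> \<phi> z $ i = 0"
    then have "z = \<pi> z + b (\<pi> z) *s v" using \<pi>_dec[of z] by (simp add: \<phi>_i)
    then show "z \<in> ?M" using z \<pi>_i[of z] unfolding U_def by blast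
  qed
  have image: "\<phi> ` (?M \<inter> U) = {y \<in> V. \<forall>j. j \<notin> UNIV - {i} \<longrightarrow> y $ j = 0}"
  proof (intro equalityI subsetI)
    fix y assume "y \<in> {y \<in> V. \<forall>j. j \<notin> UNIV - {i} \<longrightarrow> y $ j = 0}"
    then have "y = \<phi> (\<psi> y)" "\<psi> y \<in> ?M \<inter> U" using M by (auto simp: \<phi>_\<psi> U_def V_def \<pi>_\<psi>)
    then show "y \<in> \<phi> ` (?M \<inter> U)" by blast
  qed (use M bij in \<open>auto simp: bij_betw_def\<close>)
  show ?thesis
    unfolding complex_submanifold_def
  proof (intro conjI ballI)
    show "?M \<noteq> {}" using W(2,3) by blast
    fix a assume "a \<in> ?M"
    then have "a \<in> U" using M by blast
    moreover have "card (UNIV - {i}) = CARD('n) - 1" by simp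
    ultimately show "\<exists>\<phi> U V I. a \<in> U \<and> biholomorphic_cn \<phi> U V \<and> card I = CARD('n) - 1 \<and>
        \<phi> ` (?M \<inter> U) = {w \<in> V. \<forall>i. i \<notin> I \<longrightarrow> w $ i = 0}"
      using chart image by blast
  qed
qed

text \<open>The set is parametrized by an open set of the whole space, one parameter too many.
  Shifting base points along \<open>v\<close> by \<open>t\<close> brings one of them to the
  hyperplane \<open>x $ i = 0\<close>, which is transversal to \<open>v\<close>; over that
  hyperplane a genuine graph remains, with \<open>t\<close> added to \<open>b\<close> so that it
  consists of the same points.\<close>

lemma graph_contains_submanifold:
  fixes v :: "complex ^ 'n"
  assumes "v \<noteq> 0" and W: "open W" "W \<noteq> {}" and b: "holomorphic_cn b W"
  obtains M where "complex_submanifold (CARD('n) - 1) M" "M \<subseteq> {x + b x *s v | x. x \<in> W}"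
proof -
  obtain i where i: "v $ i \<noteq> 0" using \<open>v \<noteq> 0\<close> by (auto simp: vec_eq_iff)
  obtain w where w: "w \<in> W" using W by blast
  define t where "t = w $ i / v $ i"
  define W' where "W' = {x. x + t *s v \<in> W}"
  have "open W'"
    unfolding W'_def
    by (rule open_vimage[OF W(1), of "\<lambda>x. x + t *s v", unfolded vimage_def]) (intro continuous_intros)
  moreover have "w - t *s v \<in> W'" "(w - t *s v) $ i = 0" using w i by (auto simp: W'_def t_def)
  moreover have "holomorphic_cn (\<lambda>x. b (x + t *s v) + t) W'"
    by (intro holomorphic_cn_add holomorphic_cn_const holomorphic_cn_shift[OF b]) (simp add: W'_def)
  ultimately have "complex_submanifold (CARD('n) - 1) {x + (b (x + t *s v) + t) *s v | x. x \<in> W' \<and> x $ i = 0}"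
    using graph_submanifold_hyperplane[OF i] by blast
  moreover have "{x + (b (x + t *s v) + t) *s v | x. x \<in> W' \<and> x $ i = 0} \<subseteq> {x + b x *s v | x. x \<in> W}"
  proof
    fix z assume "z \<in> {x + (b (x + t *s v) + t) *s v | x. x \<in> W' \<and> x $ i = 0}"
    then obtain x where x: "z = x + (b (x + t *s v) + t) *s v" "x \<in> W'" by blast
    then have "z = (x + t *s v) + b (x + t *s v) *s v" by (simp add: vector_sadd_rdistrib)
    then show "z \<in> {x + b x *s v | x. x \<in> W}" using x(2) unfolding W'_def by blast
  qed
  ultimately show ?thesis using that by blast
qed

text \<open>The germ dimension is an infimum over neighbourhoods, so some \<open>U\<close> already
  has \<open>set_dim\<close> below n - 1, whereas every graph contains a submanifold of dimension n
  - 1. In this form the dimension hypothesis can be played against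
  \<open>common_zero_graph\<close>.\<close>

lemma set_dim_at0_less_imp_no_graph:
  fixes E :: "(complex ^ 'n) set"
  assumes "set_dim_at0 E < ereal (real CARD('n) - 1)"
  obtains U where "open U" "0 \<in> U"
    "\<And>v W b. v \<noteq> 0 \<Longrightarrow> open W \<Longrightarrow> W \<noteq> {} \<Longrightarrow> holomorphic_cn b W \<Longrightarrow>
      \<not> {x + b x *s v | x. x \<in> W} \<subseteq> E \<inter> U"
proof -
  obtain U where U: "open U" "0 \<in> U" "set_dim (E \<inter> U) < ereal (real CARD('n) - 1)"
    using assms unfolding set_dim_at0_def INF_less_iff by blast
  show ?thesis
  proof (rule that[OF U(1,2)])
    fix v :: "complex ^ 'n" and W :: "(complex ^ 'n) set" and b
    assume v: "v \<noteq> 0" and W: "open W" "W \<noteq> {}" "holomorphic_cn b W"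
    show "\<not> {x + b x *s v | x. x \<in> W} \<subseteq> E \<inter> U"
    proof
      assume sub: "{x + b x *s v | x. x \<in> W} \<subseteq> E \<inter> U"
      obtain M where "complex_submanifold (CARD('n) - 1) M" "M \<subseteq> {x + b x *s v | x. x \<in> W}"
        using graph_contains_submanifold[OF v W] .
      then have "ereal (real (CARD('n) - 1)) \<le> set_dim (E \<inter> U)"
        unfolding set_dim_def using sub by (intro SUP_upper) blast
      moreover have "real (CARD('n) - 1) = real CARD('n) - 1"
        by (simp add: of_nat_diff Suc_leI)
      ultimately show False using U(3) by simp
    qed
  qed
qed


section \<open>The image near the origin\<close>

lemma norm_sum_mset_le:
  "(\<And>z. z \<in># A \<Longrightarrow> norm (f z) \<le> M) \<Longrightarrow> norm (\<Sum>z\<in>#A. f z :: complex) \<le> of_nat (size A) * M"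
proof (induction A)
  case (add a A)
  then have "norm (f a) \<le> M" "norm (\<Sum>z\<in>#A. f z) \<le> of_nat (size A) * M" by auto
  then show ?case using norm_triangle_ineq[of "f a" "\<Sum>z\<in>#A. f z"] by (simp add: algebra_simps)
qed simp

lemma norm_sum_mset_less:
  assumes "A \<noteq> {#}" and "\<And>z. z \<in># A \<Longrightarrow> norm (f z) < M"
  shows "norm (\<Sum>z\<in>#A. f z :: complex) < of_nat (size A) * M"
proof -
  obtain a B where A: "A = add_mset a B" using assms(1) multiset_cases by blast
  have "norm (f a) < M" "norm (\<Sum>z\<in>#B. f z) \<le> of_nat (size B) * M"
    using assms(2) by (auto simp: A less_imp_le intro!: norm_sum_mset_le)
  then show ?thesis using norm_triangle_ineq[of "f a" "\<Sum>z\<in>#B. f z"] by (simp add: A algebra_simps)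
qed

lemma exists_point_further_out:
  assumes "\<eta> > 0"
  shows "\<exists>\<xi>\<in>ball \<xi>0 \<eta>. norm \<xi> > norm (\<xi>0 :: complex)"
proof (cases "\<xi>0 = 0")
  case True
  then show ?thesis using assms by (intro bexI[of _ "of_real (\<eta> / 2)"]) auto
next
  case False
  define t where "t = \<eta> / (2 * norm \<xi>0)"
  have t: "t > 0" "t * norm \<xi>0 = \<eta> / 2" using assms False by (auto simp: t_def)
  have "norm (of_real (1 + t) * \<xi>0) = (1 + t) * norm \<xi>0"
    unfolding norm_mult norm_of_real using t(1) by simp
  moreover have "dist \<xi>0 (of_real (1 + t) * \<xi>0) = \<eta> / 2"
  proof -
    have "\<xi>0 - of_real (1 + t) * \<xi>0 = - (of_real t * \<xi>0)" by (simp add: algebra_simps)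
    then show ?thesis using t by (simp add: dist_norm norm_mult)
  qed
  ultimately show ?thesis
    using t assms False by (intro bexI[of _ "of_real (1 + t) * \<xi>0"]) (auto simp: distrib_right)
qed

text \<open>Maximum principle on the curve \<open>F = 0\<close> in the plane with coordinates \<open>(\<xi>, y)\<close>: if \<open>\<phi>\<close> omitted the value
  \<open>s\<close> there, then \<open>1 / (\<phi> - s)\<close> would be larger at the origin than over \<open>norm \<xi> = \<delta>\<close>. At a
  maximum with \<open>norm \<xi>\<close> as large as possible, the sum of \<open>1 / (\<phi> - s)\<close> over the nearby zeros
  of \<open>F\<close> is a holomorphic function of \<open>\<xi>\<close> with a local maximum, so the maximum also
  occurs further out.\<close>

lemma value_attained_on_zero_curve:
  fixes F \<phi> :: "complex ^ 'n \<Rightarrow> complex \<Rightarrow> complex" and p :: "complex ^ 'n"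
  assumes F: "hol_family F X S" and \<phi>: "hol_family \<phi> X S"
    and X: "open X" "\<And>\<xi>. norm \<xi> \<le> \<delta> \<Longrightarrow> \<xi> *s p \<in> X" and \<delta>: "0 < \<delta>"
    and S: "open S" "connected S" "cball 0 \<epsilon> \<subseteq> S" and \<epsilon>: "0 < \<epsilon>"
    and nz: "\<And>\<xi> y. norm \<xi> \<le> \<delta> \<Longrightarrow> norm y = \<epsilon> \<Longrightarrow> F (\<xi> *s p) y \<noteq> 0"
    and origin: "F 0 0 = 0" "\<phi> 0 0 = 0"
    and bd: "\<And>\<xi> y. norm \<xi> = \<delta> \<Longrightarrow> norm y \<le> \<epsilon> \<Longrightarrow> F (\<xi> *s p) y = 0 \<Longrightarrow> c \<le> norm (\<phi> (\<xi> *s p) y)"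
    and s: "2 * norm s < c"
  shows "\<exists>\<xi> y. norm \<xi> \<le> \<delta> \<and> norm y \<le> \<epsilon> \<and> F (\<xi> *s p) y = 0 \<and> \<phi> (\<xi> *s p) y = s"
proof (rule ccontr)
  assume no: "\<not> ?thesis"
  define K where "K = {z \<in> cball 0 \<delta> \<times> cball 0 \<epsilon>. F (fst z *s p) (snd z) = 0}"
  define N where "N z = norm (inverse (\<phi> (fst z *s p) (snd z) - s))" for z
  have contF: "continuous_on (X \<times> S) (\<lambda>(x, y). F x y)"
    and cont\<phi>: "continuous_on (X \<times> S) (\<lambda>(x, y). \<phi> x y)" using F \<phi> by (auto simp: hol_family_def)
  have D: "fst z *s p \<in> X \<and> snd z \<in> S" if "z \<in> cball 0 \<delta> \<times> cball 0 \<epsilon>" for z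
    using that X(2) S(3) by auto
  have cF: "continuous_on (cball 0 \<delta> \<times> cball 0 \<epsilon>) (\<lambda>z. F (fst z *s p) (snd z))"
    by (rule continuous_on_compose_pair[OF contF]) (auto intro!: continuous_intros D)
  have c\<phi>: "continuous_on (cball 0 \<delta> \<times> cball 0 \<epsilon>) (\<lambda>z. \<phi> (fst z *s p) (snd z))"
    by (rule continuous_on_compose_pair[OF cont\<phi>]) (auto intro!: continuous_intros D)
  have "closed K"
    unfolding K_def by (rule continuous_closed_preimage_constant[OF cF]) (simp add: closed_Times)
  moreover have "compact (cball 0 \<delta> \<times> cball (0 :: complex) \<epsilon> :: (complex \<times> complex) set)"
    by (simp add: compact_Times)
  ultimately have "compact ((cball 0 \<delta> \<times> cball 0 \<epsilon>) \<inter> K)" by (rule compact_Int_closed[rotated])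
  also have "(cball 0 \<delta> \<times> cball 0 \<epsilon>) \<inter> K = K" by (auto simp: K_def)
  finally have compactK: "compact K" .
  have K\<phi>: "\<phi> (fst z *s p) (snd z) \<noteq> s" if "z \<in> K" for z
  proof
    assume "\<phi> (fst z *s p) (snd z) = s"
    moreover have "norm (fst z) \<le> \<delta>" "norm (snd z) \<le> \<epsilon>" "F (fst z *s p) (snd z) = 0"
      using that by (auto simp: K_def)
    ultimately show False using no by blast
  qed
  have contN: "continuous_on K N"
    unfolding N_def using K\<phi>
    by (intro continuous_intros continuous_on_subset[OF c\<phi>]) (auto simp: K_def)
  have origK: "(0, 0) \<in> K" using origin \<delta> \<epsilon> by (simp add: K_def)
  then obtain z1 where z1: "z1 \<in> K" "\<And>z. z \<in> K \<Longrightarrow> N z \<le> N z1"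
    using continuous_attains_sup[OF compactK _ contN] by blast
  define M where "M = N z1"
  define T where "T = {z \<in> K. N z = M}"
  have "closed T"
    unfolding T_def using contN compact_imp_closed[OF compactK] by (rule continuous_closed_preimage_constant)
  then have "compact (K \<inter> T)" by (rule compact_Int_closed[OF compactK])
  also have "K \<inter> T = T" by (auto simp: T_def)
  finally have "compact T" .
  moreover have "T \<noteq> {}" using z1(1) unfolding T_def M_def by blast
  moreover have "continuous_on T (\<lambda>z. norm (fst z))" by (intro continuous_intros)
  ultimately obtain z0 where z0: "z0 \<in> T" "\<And>z. z \<in> T \<Longrightarrow> norm (fst z) \<le> norm (fst z0)"
    using continuous_attains_sup[of T "\<lambda>z. norm (fst z)"] by blast
  obtain \<xi>0 y0 where z0_eq: "z0 = (\<xi>0, y0)" by (cases z0)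
  have \<xi>0: "norm \<xi>0 \<le> \<delta>" "norm y0 \<le> \<epsilon>" "F (\<xi>0 *s p) y0 = 0" and N0: "N (\<xi>0, y0) = M"
    using z0(1) by (auto simp: z0_eq T_def K_def)
  have max: "N z \<le> M" if "z \<in> K" for z using z1(2)[OF that] by (simp add: M_def)
  have "s \<noteq> 0" using K\<phi>[OF origK] origin by auto
  have M_ge: "1 / norm s \<le> M"
    using max[OF origK] origin by (simp add: N_def norm_inverse inverse_eq_divide norm_divide)
  \<comment> \<open>Over the boundary circle \<open>norm \<phi> \<ge> c > 2 * norm s\<close> gives
    \<open>norm (\<phi> - s) > norm s\<close>, so \<open>N\<close> is smaller there than its value
    \<open>1 / norm s\<close> at the origin.\<close>
  have "norm \<xi>0 \<noteq> \<delta>"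
  proof
    assume "norm \<xi>0 = \<delta>"
    then have "c \<le> norm (\<phi> (\<xi>0 *s p) y0)" using bd \<xi>0 by blast
    then have "norm s < norm (\<phi> (\<xi>0 *s p) y0 - s)"
      using s norm_triangle_ineq2[of "\<phi> (\<xi>0 *s p) y0" s] by linarith
    then have "inverse (norm (\<phi> (\<xi>0 *s p) y0 - s)) < inverse (norm s)"
      using \<open>s \<noteq> 0\<close> by (intro less_imp_inverse_less) auto
    then have "M < 1 / norm s"
      unfolding N0[symmetric] N_def fst_conv snd_conv norm_inverse by (simp add: inverse_eq_divide)
    then show False using M_ge by simp
  qed
  then have \<xi>0_less: "norm \<xi>0 < \<delta>" using \<xi>0(1) by simp
  have y0_less: "norm y0 < \<epsilon>" using nz[OF \<xi>0(1), of y0] \<xi>0(2,3) by force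
  define x0 where "x0 = \<xi>0 *s p"
  have x0: "x0 \<in> X" using X(2)[OF \<xi>0(1)] by (simp add: x0_def)
  have holF: "F x holomorphic_on S" and hol\<phi>: "\<phi> x holomorphic_on S" if "x \<in> X" for x
    using F \<phi> that by (auto simp: hol_family_def)
  have "complex_of_real \<epsilon> \<in> S" using S(3) \<epsilon> by auto
  moreover have "F x0 (of_real \<epsilon>) \<noteq> 0" using nz[OF \<xi>0(1), of "of_real \<epsilon>"] \<epsilon> by (simp add: x0_def)
  moreover have "y0 \<in> S" using S(3) \<xi>0(2) by auto
  ultimately obtain r1 where r1: "r1 > 0" "cball y0 r1 \<subseteq> S" "\<And>t. t \<in> cball y0 r1 - {y0} \<Longrightarrow> F x0 t \<noteq> 0"
    using nonzero_punctured_cball[OF holF[OF x0] S(1,2)] by metis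
  have "open (S \<inter> (\<lambda>y. \<phi> x0 y - s) -` (- {0}) \<inter> ball 0 \<epsilon>)"
    using hol\<phi>[OF x0] S(1)
    by (intro open_Int continuous_open_preimage continuous_intros holomorphic_on_imp_continuous_on) auto
  moreover have "y0 \<in> S \<inter> (\<lambda>y. \<phi> x0 y - s) -` (- {0}) \<inter> ball 0 \<epsilon>"
    using K\<phi>[of "(\<xi>0, y0)"] z0(1) z0_eq y0_less \<open>y0 \<in> S\<close> by (auto simp: T_def x0_def)
  ultimately obtain r2 where r2: "r2 > 0" "cball y0 r2 \<subseteq> S \<inter> (\<lambda>y. \<phi> x0 y - s) -` (- {0}) \<inter> ball 0 \<epsilon>"
    using open_contains_cball by blast
  \<comment> \<open>On \<open>cball y0 \<rho>\<close> the only zero of \<open>F x0\<close> is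
    \<open>y0\<close>, the function \<open>\<phi> x0 - s\<close> has no zero, and the disc lies in
    \<open>ball 0 \<epsilon>\<close>. The zeros are counted in the smaller radius \<open>r\<close>,
    so that the open disc of radius \<open>\<rho>\<close> can serve as domain.\<close>
  define \<rho> where "\<rho> = min r1 r2"
  define r where "r = \<rho> / 2"
  have \<rho>: "0 < \<rho>" "0 < r" "r < \<rho>" using r1 r2 by (auto simp: \<rho>_def r_def)
  have \<rho>_sub: "cball y0 \<rho> \<subseteq> cball y0 r1" "cball y0 \<rho> \<subseteq> cball y0 r2" by (auto simp: \<rho>_def)
  have \<rho>S: "cball y0 \<rho> \<subseteq> S" "cball y0 \<rho> \<subseteq> ball 0 \<epsilon>" using \<rho>_sub r1 r2 by blast+
  have sph: "sphere y0 r \<subseteq> cball y0 \<rho>" using \<rho> by auto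
  have F_sph: "F x0 y \<noteq> 0" if "y \<in> sphere y0 r" for y
  proof (rule r1(3))
    have "y \<in> cball y0 r1" using that sph \<rho>_sub(1) by blast
    moreover have "y \<noteq> y0" using that \<rho>(2) by auto
    ultimately show "y \<in> cball y0 r1 - {y0}" by simp
  qed
  have \<phi>_disc: "\<phi> x0 y - s \<noteq> 0" if "y \<in> cball y0 \<rho>" for y using r2(2) \<rho>_sub(2) that by blast
  obtain d1 where d1: "d1 > 0" "ball x0 d1 \<subseteq> X" "\<And>x y. x \<in> ball x0 d1 \<Longrightarrow> y \<in> sphere y0 r \<Longrightarrow> F x y \<noteq> 0"
  proof (rule compact_nonzero_nhd[OF X(1) x0 compact_sphere, of y0 r F])
    show "continuous_on (X \<times> sphere y0 r) (\<lambda>(x, y). F x y)"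
      using contF by (rule continuous_on_subset) (use sph \<rho>S in blast)
  qed (use F_sph in auto)
  obtain d2 where d2: "d2 > 0" "ball x0 d2 \<subseteq> X" "\<And>x y. x \<in> ball x0 d2 \<Longrightarrow> y \<in> cball y0 \<rho> \<Longrightarrow> \<phi> x y - s \<noteq> 0"
  proof (rule compact_nonzero_nhd[OF X(1) x0 compact_cball, of y0 \<rho> "\<lambda>x y. \<phi> x y - s"])
    have "continuous_on (X \<times> cball y0 \<rho>) (\<lambda>(x, y). \<phi> x y)"
      using cont\<phi> by (rule continuous_on_subset) (use \<rho>S in blast)
    then show "continuous_on (X \<times> cball y0 \<rho>) (\<lambda>(x, y). \<phi> x y - s)"
      unfolding split_beta by (intro continuous_intros)
  qed (use \<phi>_disc in auto)
  define X' where "X' = ball x0 (min d1 d2)"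
  have X': "open X'" "connected X'" "X' \<subseteq> X" "x0 \<in> X'"
    using d1(1,2) d2(1) by (auto simp: X'_def)
  have ballS: "ball y0 \<rho> \<subseteq> S" "cball y0 r \<subseteq> ball y0 \<rho>" using \<rho>S \<rho> by auto
  have FX': "hol_family F X' (ball y0 \<rho>)" using F X'(3) ballS(1) by (rule hol_family_subset)
  have nzX': "F x y \<noteq> 0" if "x \<in> X'" "y \<in> sphere y0 r" for x y
    using d1(3)[of x y] that by (simp add: X'_def)
  define \<psi> where "\<psi> x y = inverse (\<phi> x y + - s)" for x y
  have "hol_family \<phi> X' (ball y0 \<rho>)" using \<phi> X'(3) ballS(1) by (rule hol_family_subset)
  then have \<psi>: "hol_family \<psi> X' (ball y0 \<rho>)"
    unfolding \<psi>_def using d2(3)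
    by (intro hol_family_inverse hol_family_add hol_family_const_right holomorphic_cn_const)
      (auto simp: X'_def)
  define Z where "Z x = zero_mset (F x) y0 r" for x
  define \<Sigma> where "\<Sigma> x = (\<Sum>z\<in>#Z x. \<psi> x z)" for x
  have hol_\<Sigma>: "holomorphic_cn \<Sigma> X'"
    unfolding \<Sigma>_def Z_def
    by (rule holomorphic_cn_sum_zeros[OF FX' \<psi> X'(1) open_ball ballS(2) \<rho>(2) nzX'])
  define m where "m = size (Z x0)"
  have size_Z: "size (Z x) = m" if "x \<in> X'" for x
    unfolding m_def Z_def
    by (rule size_zero_mset_constant[OF FX' X'(1,2) open_ball ballS(2) \<rho>(2) nzX' that X'(4)])
  have set_Z: "set_mset (Z x) = {z \<in> ball y0 r. F x z = 0}" if "x \<in> X'" for x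
  proof -
    have "F x holomorphic_on ball y0 \<rho>" using FX' that by (simp add: hol_family_def)
    from set_zero_mset[OF this open_ball ballS(2) \<rho>(2) nzX'[OF that]] show ?thesis by (simp add: Z_def)
  qed
  have zeros_x0: "z = y0" if "z \<in># Z x0" for z
    using that set_Z[OF X'(4)] r1(3)[of z] \<rho> \<rho>_sub(1) by (force simp: \<rho>_def)
  have "y0 \<in># Z x0" using set_Z[OF X'(4)] \<xi>0(3) \<rho>(2) by (simp add: x0_def)
  then have m: "m > 0" unfolding m_def by (cases "Z x0") auto
  have norm_\<psi>: "norm (\<psi> (\<xi> *s p) z) = N (\<xi>, z)" for \<xi> z by (simp add: \<psi>_def N_def)
  define G where "G = {\<xi>. 0 + \<xi> *s p \<in> X'} \<inter> ball 0 \<delta>"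
  have "open G" unfolding G_def by (intro open_Int open_line_vimage X'(1) open_ball)
  moreover have "\<xi>0 \<in> G" using X'(4) \<xi>0_less by (simp add: G_def x0_def)
  ultimately obtain \<eta> where \<eta>: "\<eta> > 0" "ball \<xi>0 \<eta> \<subseteq> G" using open_contains_ball by blast
  have inX': "\<xi> *s p \<in> X'" "norm \<xi> < \<delta>" if "\<xi> \<in> ball \<xi>0 \<eta>" for \<xi> using \<eta>(2) that by (auto simp: G_def)
  have inK: "(\<xi>, z) \<in> K" if \<xi>: "\<xi> \<in> ball \<xi>0 \<eta>" and z: "z \<in># Z (\<xi> *s p)" for \<xi> z
  proof -
    have "z \<in> ball y0 r" "F (\<xi> *s p) z = 0" using set_Z[OF inX'(1)[OF \<xi>]] z by auto
    then have "z \<in> ball 0 \<epsilon>" using ballS(2) \<rho>S(2) ball_subset_cball by blast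
    then show ?thesis using inX'(2)[OF \<xi>] \<open>F (\<xi> *s p) z = 0\<close> by (simp add: K_def)
  qed
  have "(\<lambda>\<xi>. \<Sigma> (0 + \<xi> *s p)) holomorphic_on ball \<xi>0 \<eta>"
    using holomorphic_cn_line[OF hol_\<Sigma>] by (rule holomorphic_on_subset) (use inX' in auto)
  then have hol: "(\<lambda>\<xi>. \<Sigma> (\<xi> *s p)) holomorphic_on ball \<xi>0 \<eta>" by simp
  \<comment> \<open>All \<open>m\<close> zeros sit at \<open>y0\<close> here, so their terms are
    equal and nothing cancels: the sum attains the bound \<open>m * M\<close> that holds for all
    nearby \<open>\<xi>\<close>.\<close>
  have at_\<xi>0: "norm (\<Sigma> (\<xi>0 *s p)) = of_nat m * M"
  proof -
    have "\<Sigma> x0 = (\<Sum>z\<in>#Z x0. \<psi> x0 y0)"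
      unfolding \<Sigma>_def using zeros_x0 by (intro arg_cong[where f = sum_mset] image_mset_cong) simp
    also have "\<dots> = of_nat m * \<psi> x0 y0" by (simp add: m_def)
    finally show ?thesis using norm_\<psi>[of \<xi>0 y0] N0 by (simp add: x0_def norm_mult)
  qed
  have "(\<lambda>\<xi>. \<Sigma> (\<xi> *s p)) constant_on ball \<xi>0 \<eta>"
  proof (rule maximum_modulus_principle[OF hol open_ball connected_ball open_ball order_refl])
    show "norm (\<Sigma> (\<xi> *s p)) \<le> norm (\<Sigma> (\<xi>0 *s p))" if \<xi>: "\<xi> \<in> ball \<xi>0 \<eta>" for \<xi>
    proof -
      have "norm (\<psi> (\<xi> *s p) z) \<le> M" if "z \<in># Z (\<xi> *s p)" for z
        using max[OF inK[OF \<xi> that]] norm_\<psi> by simp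
      then have "norm (\<Sigma> (\<xi> *s p)) \<le> of_nat (size (Z (\<xi> *s p))) * M"
        unfolding \<Sigma>_def by (rule norm_sum_mset_le)
      then show ?thesis using at_\<xi>0 size_Z[OF inX'(1)[OF \<xi>]] by simp
    qed
  qed (use \<eta> in simp)
  then have const: "norm (\<Sigma> (\<xi> *s p)) = of_nat m * M" if "\<xi> \<in> ball \<xi>0 \<eta>" for \<xi>
    using that at_\<xi>0 \<eta>(1) unfolding constant_on_def by (metis centre_in_ball)
  obtain \<xi>1 where \<xi>1: "\<xi>1 \<in> ball \<xi>0 \<eta>" "norm \<xi>1 > norm \<xi>0"
    using exists_point_further_out[OF \<eta>(1)] by blast
  have "\<exists>z\<in>#Z (\<xi>1 *s p). M \<le> norm (\<psi> (\<xi>1 *s p) z)"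
  proof (rule ccontr)
    assume "\<not> ?thesis"
    moreover have "Z (\<xi>1 *s p) \<noteq> {#}" using size_Z[OF inX'(1)[OF \<xi>1(1)]] m by auto
    ultimately have "norm (\<Sigma> (\<xi>1 *s p)) < of_nat (size (Z (\<xi>1 *s p))) * M"
      unfolding \<Sigma>_def by (intro norm_sum_mset_less) auto
    then show False using const[OF \<xi>1(1)] size_Z[OF inX'(1)[OF \<xi>1(1)]] by simp
  qed
  then obtain z where z: "z \<in># Z (\<xi>1 *s p)" "M \<le> N (\<xi>1, z)" using norm_\<psi> by auto
  have "(\<xi>1, z) \<in> T" using inK[OF \<xi>1(1) z(1)] max z(2) by (auto simp: T_def antisym)
  from z0(2)[OF this] \<xi>1(2) show False by (simp add: z0_eq)
qed

section \<open>Coordinates adapted to a unit vector\<close>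

definition along :: "complex \<times> complex \<Rightarrow> complex \<Rightarrow> complex \<Rightarrow> complex" where
  "along q x y = cnj (fst q) * x + cnj (snd q) * y"

definition across :: "complex \<times> complex \<Rightarrow> complex \<Rightarrow> complex \<Rightarrow> complex" where
  "across q x y = snd q * x - fst q * y"

text \<open>\<open>along\<close> and \<open>across\<close> are the coordinates of
  \<open>(x, y)\<close> in the orthonormal basis \<open>q\<close>,
  \<open>(cnj (snd q), - cnj (fst q))\<close>. Conjugates fall on \<open>q\<close> only, so both are
  holomorphic in \<open>x\<close>, \<open>y\<close> and continuous in \<open>q\<close>. Since
  \<open>x\<close> and \<open>y\<close> are recovered linearly, a common factor of the two
  coordinates is one of \<open>x\<close> and \<open>y\<close>.\<close>

lemma unit_vector_decomposition:
  assumes "norm q = 1"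
  shows "x = fst q * along q x y + cnj (snd q) * across q x y"
    and "y = snd q * along q x y - cnj (fst q) * across q x y"
proof -
  have "(norm (fst q))\<^sup>2 + (norm (snd q))\<^sup>2 = 1"
    using assms by (simp add: norm_prod_def)
  then have "complex_of_real ((norm (fst q))\<^sup>2 + (norm (snd q))\<^sup>2) = 1" by simp
  then have 1: "fst q * cnj (fst q) + snd q * cnj (snd q) = 1"
    unfolding of_real_add complex_norm_square .
  have "fst q * along q x y + cnj (snd q) * across q x y = (fst q * cnj (fst q) + snd q * cnj (snd q)) * x"
    by (simp add: along_def across_def algebra_simps)
  then show "x = fst q * along q x y + cnj (snd q) * across q x y" by (simp add: 1)
  have "snd q * along q x y - cnj (fst q) * across q x y = (fst q * cnj (fst q) + snd q * cnj (snd q)) * y"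
    by (simp add: along_def across_def algebra_simps)
  then show "y = snd q * along q x y - cnj (fst q) * across q x y" by (simp add: 1)
qed

lemma continuous_along_across [continuous_intros]:
  fixes q :: "'a::topological_space \<Rightarrow> complex \<times> complex"
  assumes "continuous_on A q" "continuous_on A f" "continuous_on A g"
  shows "continuous_on A (\<lambda>x. along (q x) (f x) (g x))" "continuous_on A (\<lambda>x. across (q x) (f x) (g x))"
  unfolding along_def across_def by (intro continuous_intros assms)+

lemma holomorphic_along_across:
  assumes "holomorphic_cn f U" "holomorphic_cn g U"
  shows "holomorphic_cn (\<lambda>x. along q (f x) (g x)) U" "holomorphic_cn (\<lambda>x. across q (f x) (g x)) U"
  unfolding along_def across_def
  by (intro holomorphic_cn_add holomorphic_cn_diff holomorphic_cn_mult holomorphic_cn_const assms)+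

text \<open>\<open>R x\<close> is a resultant: up to sign, the product of \<open>G x\<close> over
  the zeros of \<open>F x\<close>. It is taken as the constant coefficient of the polynomial whose
  roots are these values, because coefficients are holomorphic once the power sums are.\<close>

lemma zero_product_holomorphic:
  assumes "open X" and F: "hol_family F X S" and G: "hol_family G X S" and S: "open S" "cball c r \<subseteq> S"
    and r: "0 < r" and "connected X"
    and nz: "\<And>x z. x \<in> X \<Longrightarrow> z \<in> sphere c r \<Longrightarrow> F x z \<noteq> 0"
  obtains R where "holomorphic_cn R X"
    "\<And>x. x \<in> X \<Longrightarrow> R x = 0 \<longleftrightarrow> (\<exists>z\<in>ball c r. F x z = 0 \<and> G x z = 0)"
proof -
  define A where "A x = image_mset (G x) (zero_mset (F x) c r)" for x
  show ?thesis
  proof (cases "X = {}")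
    case True
    then show ?thesis using that[of "\<lambda>x. 0"] by (auto intro: holomorphic_cn_const)
  next
    case False
    then obtain x0 where x0: "x0 \<in> X" by blast
    have size: "size (A x) = size (A x0)" if "x \<in> X" for x
      using size_zero_mset_constant[OF F \<open>open X\<close> \<open>connected X\<close> S r nz that x0] by (simp add: A_def)
    have "holomorphic_cn (\<lambda>x. coeff (root_poly (A x)) 0) X"
    proof (rule holomorphic_cn_coeff_root_poly[OF \<open>open X\<close> size])
      show "holomorphic_cn (\<lambda>x. \<Sum>a\<in>#A x. a ^ k) X" for k
        using holomorphic_cn_sum_zeros[OF F hol_family_power[OF G, of k] \<open>open X\<close> S r nz]
        by (simp add: A_def image_mset.compositionality o_def)
    qed
    moreover have "coeff (root_poly (A x)) 0 = 0 \<longleftrightarrow> (\<exists>z\<in>ball c r. F x z = 0 \<and> G x z = 0)" if "x \<in> X" for x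
    proof -
      have "F x holomorphic_on S" using F that by (simp add: hol_family_def)
      from set_zero_mset[OF this S r nz[OF that]] show ?thesis
        by (auto simp: poly_0_coeff_0[symmetric] poly_root_poly_eq_0_iff A_def image_iff)
    qed
    ultimately show ?thesis using that by blast
  qed
qed

text \<open>Coordinates \<open>(x, t)\<close> for the point \<open>x + t *s v\<close>, with \<open>x\<close> near the origin of the whole space:
  this redundancy avoids spaces of lower dimension.\<close>

lemma line_coordinates:
  fixes F :: "complex ^ 'n \<Rightarrow> complex"
  assumes hol: "holomorphic_cn F U" and \<rho>: "ball 0 \<rho> \<subseteq> U" and v: "v \<in> ball 0 \<rho>" "F v \<noteq> 0"
  obtains \<epsilon> V S where "0 < \<epsilon>" "\<And>t. t \<in> cball 0 \<epsilon> - {0} \<Longrightarrow> F (0 + t *s v) \<noteq> 0"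
    "open S" "connected S" "cball 0 \<epsilon> \<subseteq> S" "open V" "convex V" "0 \<in> V"
    "\<And>x t. x \<in> V \<Longrightarrow> t \<in> S \<Longrightarrow> x + t *s v \<in> U"
    "\<And>x t. x \<in> V \<Longrightarrow> t \<in> sphere 0 \<epsilon> \<Longrightarrow> F (x + t *s v) \<noteq> 0"
proof -
  have "0 < \<rho>" using v(1) norm_ge_zero[of v] by (simp del: norm_ge_zero)
  define T where "T = {t. t *s v \<in> ball 0 \<rho>}"
  have T: "open T" "connected T" "0 \<in> T" "1 \<in> T"
    unfolding T_def using open_line_vimage[of "ball 0 \<rho>" 0 v] v(1) \<open>0 < \<rho>\<close>
    by (simp, intro convex_connected convex_line_vimage convex_ball, simp_all)
  have "(\<lambda>t. F (0 + t *s v)) holomorphic_on T"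
    using holomorphic_cn_line[OF hol] by (rule holomorphic_on_subset) (use \<rho> in \<open>auto simp: T_def\<close>)
  then obtain \<epsilon> where \<epsilon>: "\<epsilon> > 0" "cball 0 \<epsilon> \<subseteq> T" "\<And>t. t \<in> cball 0 \<epsilon> - {0} \<Longrightarrow> F (0 + t *s v) \<noteq> 0"
    by (rule nonzero_punctured_cball[OF _ T]) (use v(2) in auto)
  obtain e S where e: "e > 0" and S: "open S" "connected S" "cball 0 \<epsilon> \<subseteq> S"
    and sub: "\<And>x t. x \<in> ball 0 e \<Longrightarrow> t \<in> S \<Longrightarrow> x + t *s v \<in> ball 0 \<rho>"
    by (rule disc_in_line_nhd[OF \<epsilon>(1,2)[unfolded T_def], where ?x0.0 = 0]) blast
  have subU: "x + t *s v \<in> U" if "x \<in> ball 0 e" "t \<in> S" for x t using sub[OF that] \<rho> by blast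
  have fam: "hol_family (\<lambda>x t. F (x + t *s v)) (ball 0 e) S"
    using hol by (rule hol_family_line) (rule subU)
  have sph: "sphere 0 \<epsilon> \<subseteq> S" using S(3) by auto
  have "continuous_on (ball 0 e \<times> sphere 0 \<epsilon>) (\<lambda>(x, t). F (x + t *s v))"
    using hol_family_subset[OF fam order_refl sph] by (simp add: hol_family_def)
  then obtain d where d: "d > 0" "ball 0 d \<subseteq> ball (0 :: complex ^ 'n) e"
      "\<And>x t. x \<in> ball 0 d \<Longrightarrow> t \<in> sphere 0 \<epsilon> \<Longrightarrow> F (x + t *s v) \<noteq> 0"
  proof (rule compact_nonzero_nhd[OF open_ball centre_in_ball[THEN iffD2, OF e] compact_sphere])
    show "F (0 + y *s v) \<noteq> 0" if "y \<in> sphere 0 \<epsilon>" for y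
      using \<epsilon>(1) that by (intro \<epsilon>(3)) auto
  qed blast
  show ?thesis
  proof (rule that[OF \<epsilon>(1,3) S open_ball convex_ball _ _ d(3)])
    show "x + t *s v \<in> U" if "x \<in> ball 0 d" "t \<in> S" for x t using subU[OF _ that(2)] that(1) d(2) by blast
  qed (use d(1) in auto)
qed

text \<open>The zero at the origin persists on the lines parallel to \<open>v\<close>, since the
  number of zeros in the disc is constant; \<open>common_zero_graph\<close>, with second function 0,
  turns these zeros into a graph. The lemma serves to exclude \<open>h = 0\<close> in the
  theorem.\<close>

lemma hypersurface_contains_graph:
  fixes F :: "complex ^ 'n \<Rightarrow> complex"
  assumes U: "open U" "0 \<in> U" and hol: "holomorphic_cn F U" and "F 0 = 0"
  obtains v W b where "v \<noteq> 0" "open W" "W \<noteq> {}" "holomorphic_cn b W"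
    "{x + b x *s v | x. x \<in> W} \<subseteq> {z \<in> U. F z = 0}"
proof -
  obtain \<rho> where \<rho>: "\<rho> > 0" "ball 0 \<rho> \<subseteq> U" using U open_contains_ball by blast
  show ?thesis
  proof (cases "\<exists>v\<in>ball 0 \<rho>. F v \<noteq> 0")
    case False
    have "(1 :: complex ^ 'n) \<noteq> 0" by (simp add: vec_eq_iff)
    moreover have "{x + 0 *s 1 | x. x \<in> ball 0 \<rho>} \<subseteq> {z \<in> U. F z = 0}" using False \<rho>(2) by auto
    ultimately show ?thesis
      using \<rho>(1) by (intro that[of 1 "ball 0 \<rho>" "\<lambda>x. 0"]) (auto intro: holomorphic_cn_const)
  next
    case True
    then obtain v where v: "v \<in> ball 0 \<rho>" "F v \<noteq> 0" by blast
    have "v \<noteq> 0" using v(2) \<open>F 0 = 0\<close> by auto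
    obtain \<epsilon> V S where \<epsilon>: "0 < \<epsilon>"
      and S: "open S" "connected S" "cball 0 \<epsilon> \<subseteq> S" and V: "open V" "convex V" "0 \<in> V"
      and subV: "\<And>x t. x \<in> V \<Longrightarrow> t \<in> S \<Longrightarrow> x + t *s v \<in> U"
      and nzV: "\<And>x t. x \<in> V \<Longrightarrow> t \<in> sphere 0 \<epsilon> \<Longrightarrow> F (x + t *s v) \<noteq> 0"
      by (rule line_coordinates[OF hol \<rho>(2) v]) blast
    have fam: "hol_family (\<lambda>x t. F (x + t *s v)) V S" using hol subV by (rule hol_family_line)
    have set_z: "set_mset (zero_mset (\<lambda>t. F (x + t *s v)) 0 \<epsilon>) = {t \<in> ball 0 \<epsilon>. F (x + t *s v) = 0}"
      if "x \<in> V" for x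
    proof -
      have "(\<lambda>t. F (x + t *s v)) holomorphic_on S" using fam that by (simp add: hol_family_def)
      from set_zero_mset[OF this S(1,3) \<epsilon> nzV[OF that]] show ?thesis .
    qed
    have zero: "\<exists>t\<in>ball 0 \<epsilon>. F (x + t *s v) = 0 \<and> (0 :: complex) = 0" if "x \<in> V" for x
    proof -
      have "0 \<in># zero_mset (\<lambda>t. F (0 + t *s v)) 0 \<epsilon>" using set_z[OF V(3)] \<epsilon> \<open>F 0 = 0\<close> by simp
      then have "zero_mset (\<lambda>t. F (0 + t *s v)) 0 \<epsilon> \<noteq> {#}" by auto
      moreover have "size (zero_mset (\<lambda>t. F (x + t *s v)) 0 \<epsilon>) = size (zero_mset (\<lambda>t. F (0 + t *s v)) 0 \<epsilon>)"
        by (rule size_zero_mset_constant[OF fam V(1) convex_connected[OF V(2)] S(1,3) \<epsilon> nzV that V(3)])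
      ultimately have "zero_mset (\<lambda>t. F (x + t *s v)) 0 \<epsilon> \<noteq> {#}" by auto
      then obtain t where "t \<in># zero_mset (\<lambda>t. F (x + t *s v)) 0 \<epsilon>" by (rule multiset_nonemptyE)
      then show ?thesis using set_z[OF that] by auto
    qed
    obtain W b where W: "open W" "W \<noteq> {}" "W \<subseteq> V" "holomorphic_cn b W"
      and graph: "\<And>x. x \<in> W \<Longrightarrow> b x \<in> ball 0 \<epsilon> \<and> F (x + b x *s v) = 0 \<and> (0 :: complex) = 0"
      using common_zero_graph[OF fam _ V(1) _ S(1,3) \<epsilon> nzV zero] V(3) by (auto simp: split_beta)
    have "{x + b x *s v | x. x \<in> W} \<subseteq> {z \<in> U. F z = 0}"
    proof safe
      fix x assume x: "x \<in> W"
      then have "b x \<in> S" using graph[OF x] S(3) ball_subset_cball[of 0 \<epsilon>] by blast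
      then show "x + b x *s v \<in> U" using subV x W(3) by blast
      show "F (x + b x *s v) = 0" using graph[OF x] by simp
    qed
    then show ?thesis using that \<open>v \<noteq> 0\<close> W(1,2,4) by blast
  qed
qed

text \<open>Coprimality of germs, stated for functions on a neighbourhood; \<open>D 0 = 0\<close>
  says that the factor is not a unit.\<close>

definition no_common_factor :: "(complex ^ 'n \<Rightarrow> complex) \<Rightarrow> (complex ^ 'n \<Rightarrow> complex) \<Rightarrow> bool" where
  "no_common_factor f g \<longleftrightarrow> \<not> (\<exists>V D q1 q2. open V \<and> 0 \<in> V \<and> holomorphic_cn D V \<and>
    holomorphic_cn q1 V \<and> holomorphic_cn q2 V \<and> D 0 = 0 \<and> (\<forall>x\<in>V. f x = D x * q1 x \<and> g x = D x * q2 x))"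

text \<open>The plane and the two discs are chosen for \<open>q0\<close> and then kept for all
  \<open>q\<close> in \<open>N\<close>: what the maximum principle requires of them is nonvanishing
  on compact sets, which survives small changes of \<open>q\<close>.\<close>

lemma locally_solvable:
  fixes h f g :: "complex ^ 'n \<Rightarrow> complex"
  assumes U: "open U" "0 \<in> U" and hol: "holomorphic_cn h U" "holomorphic_cn f U" "holomorphic_cn g U"
    and zero: "h 0 = 0" "f 0 = 0" "g 0 = 0"
    and no_factor: "no_common_factor f g"
    and no_graph: "\<And>v W b. v \<noteq> 0 \<Longrightarrow> open W \<Longrightarrow> W \<noteq> {} \<Longrightarrow> holomorphic_cn b W \<Longrightarrow>
      \<not> {x + b x *s v | x. x \<in> W} \<subseteq> {z \<in> U. h z = 0 \<and> across q0 (f z) (g z) = 0}"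
    and q0: "norm q0 = 1"
  shows "\<exists>N c. open N \<and> q0 \<in> N \<and> 0 < c \<and> (\<forall>q\<in>N. norm q = 1 \<longrightarrow>
    (\<forall>s. norm s < c \<longrightarrow> (\<exists>z\<in>U. h z * f z = s * fst q \<and> h z * g z = s * snd q)))"
proof -
  have coprime: False
    if "open V" "0 \<in> V" "holomorphic_cn D V" "holomorphic_cn q1 V" "holomorphic_cn q2 V" "D 0 = 0"
      "\<And>x. x \<in> V \<Longrightarrow> f x = D x * q1 x" "\<And>x. x \<in> V \<Longrightarrow> g x = D x * q2 x" for D q1 q2 V
    using no_factor that unfolding no_common_factor_def by blast
  define F where "F q z = across q (f z) (g z)" for q z
  define k where "k q z = along q (f z) (g z)" for q z
  have f_eq: "f z = fst q * k q z + cnj (snd q) * F q z"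
    and g_eq: "g z = snd q * k q z - cnj (fst q) * F q z" if "norm q = 1" for q z
    using unit_vector_decomposition[OF that, of "f z" "g z"]
      unit_vector_decomposition(2)[OF that, of "g z" "f z"] by (simp_all add: F_def k_def)
  have holF: "holomorphic_cn (F q) U" and holk: "holomorphic_cn (k q) U" for q
    unfolding F_def k_def by (intro holomorphic_along_across hol)+
  have F0: "F q 0 = 0" and k0: "k q 0 = 0" for q by (simp_all add: F_def k_def across_def along_def zero)
  obtain \<rho> where \<rho>: "\<rho> > 0" "ball 0 \<rho> \<subseteq> U" using U open_contains_ball by blast
  \<comment> \<open>If \<open>F q0\<close> vanished near the origin, \<open>f\<close> and
    \<open>g\<close> would be constant multiples of \<open>k q0\<close>, a common factor that
    vanishes at 0.\<close>
  have "\<exists>v\<in>ball 0 \<rho>. F q0 v \<noteq> 0"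
  proof (rule ccontr)
    assume "\<not> ?thesis"
    then have F: "F q0 x = 0" if "x \<in> ball 0 \<rho>" for x using that by blast
    show False
    proof (rule coprime[of "ball 0 \<rho>" "k q0" "\<lambda>x. fst q0" "\<lambda>x. snd q0"])
      show "holomorphic_cn (k q0) (ball 0 \<rho>)" using holk \<rho>(2) by (rule holomorphic_cn_subset)
      show "f x = k q0 x * fst q0" if "x \<in> ball 0 \<rho>" for x
        using f_eq[OF q0, of x] F[OF that] by simp
      show "g x = k q0 x * snd q0" if "x \<in> ball 0 \<rho>" for x
        using g_eq[OF q0, of x] F[OF that] by simp
    qed (use \<rho> k0 holomorphic_cn_const in auto)
  qed
  then obtain v where v: "v \<in> ball 0 \<rho>" "F q0 v \<noteq> 0" by blast
  have "v \<noteq> 0" using v(2) F0[of q0] by (cases "v = 0") simp_all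
  obtain \<epsilon> V S where \<epsilon>: "0 < \<epsilon>" "\<And>t. t \<in> cball 0 \<epsilon> - {0} \<Longrightarrow> F q0 (0 + t *s v) \<noteq> 0"
    and S: "open S" "connected S" "cball 0 \<epsilon> \<subseteq> S" and V: "open V" "convex V" "0 \<in> V"
    and subV: "\<And>x t. x \<in> V \<Longrightarrow> t \<in> S \<Longrightarrow> x + t *s v \<in> U"
    and nzV: "\<And>x t. x \<in> V \<Longrightarrow> t \<in> sphere 0 \<epsilon> \<Longrightarrow> F q0 (x + t *s v) \<noteq> 0"
    by (rule line_coordinates[OF holF \<rho>(2) v]) blast
  have "connected V" using V(2) by (rule convex_connected)
  have famV: "hol_family (\<lambda>x t. u (x + t *s v)) V S" if "holomorphic_cn u U" for u
    using that by (rule hol_family_line) (rule subV)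
  have "\<exists>x\<in>V. \<not> (\<exists>y\<in>ball 0 \<epsilon>. F q0 (x + y *s v) = 0 \<and> h (x + y *s v) * k q0 (x + y *s v) = 0)"
  proof (rule ccontr)
    assume "\<not> ?thesis"
    then have common: "\<exists>y\<in>ball 0 \<epsilon>. F q0 (x + y *s v) = 0 \<and> h (x + y *s v) * k q0 (x + y *s v) = 0"
      if "x \<in> V" for x using that by blast
    have "hol_family (\<lambda>x y. h (x + y *s v) * k q0 (x + y *s v)) V S"
      by (intro hol_family_mult famV hol(1) holk)
    then have cont: "continuous_on (V \<times> S) (\<lambda>(x, y). h (x + y *s v) * k q0 (x + y *s v))"
      by (simp add: hol_family_def)
    obtain W b where W: "open W" "W \<noteq> {}" "W \<subseteq> V" "holomorphic_cn b W"
      and graph: "\<And>x. x \<in> W \<Longrightarrow> b x \<in> ball 0 \<epsilon> \<and> F q0 (x + b x *s v) = 0 \<and>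
        h (x + b x *s v) * k q0 (x + b x *s v) = 0"
      using common_zero_graph[OF famV[OF holF] cont V(1) _ S(1,3) \<epsilon>(1) nzV common] V(3) by blast
    have cont_u: "continuous_on W (\<lambda>x. u (x + b x *s v))" if "holomorphic_cn u U" for u
    proof (rule continuous_on_compose2[OF holomorphic_cn_imp_continuous_on[OF that]])
      show "continuous_on W (\<lambda>x. x + b x *s v)"
        using holomorphic_cn_imp_continuous_on[OF W(4)] by (intro continuous_intros)
      show "(\<lambda>x. x + b x *s v) ` W \<subseteq> U"
        using subV W(3) graph S(3) ball_subset_cball[of 0 \<epsilon>] by blast
    qed
    \<comment> \<open>One of the two factors vanishes on the graph over a smaller open set:
      \<open>h\<close> would contradict the dimension, \<open>k q0\<close> the coprimality.\<close>
    have "\<exists>u\<in>{h, k q0}. \<exists>W'. open W' \<and> W' \<noteq> {} \<and> W' \<subseteq> W \<and> (\<forall>x\<in>W'. u (x + b x *s v) = 0)"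
      by (rule finite_zero_cover[OF _ W(1,2)]) (use cont_u hol(1) holk[of q0] graph in auto)
    then obtain u W' where u: "u = h \<or> u = k q0" and W': "open W'" "W' \<noteq> {}" "W' \<subseteq> W"
      and u0: "\<And>x. x \<in> W' \<Longrightarrow> u (x + b x *s v) = 0" by blast
    have hol_b: "holomorphic_cn b W'" using W(4) W'(3) by (rule holomorphic_cn_subset)
    show False
    proof (cases "u = h")
      case True
      have "{x + b x *s v | x. x \<in> W'} \<subseteq> {z \<in> U. h z = 0 \<and> across q0 (f z) (g z) = 0}"
      proof safe
        fix x assume x: "x \<in> W'"
        then have "b x \<in> S" using graph[of x] W'(3) S(3) ball_subset_cball[of 0 \<epsilon>] by blast
        then show "x + b x *s v \<in> U" using subV x W'(3) W(3) by blast
        show "h (x + b x *s v) = 0" using u0[OF x] True by simp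
        show "across q0 (f (x + b x *s v)) (g (x + b x *s v)) = 0"
          using graph[of x] W'(3) x by (auto simp: F_def)
      qed
      then show False using no_graph[OF \<open>v \<noteq> 0\<close> W'(1,2) hol_b] by blast
    next
      case False
      then have u: "u = k q0" using u by blast
      obtain D q1 q2 where D: "holomorphic_cn D V" "holomorphic_cn q1 V" "holomorphic_cn q2 V" "D 0 = 0"
        "\<And>x. x \<in> V \<Longrightarrow> F q0 (x + 0 *s v) = D x * q1 x" "\<And>x. x \<in> V \<Longrightarrow> k q0 (x + 0 *s v) = D x * q2 x"
      proof (rule common_graph_imp_common_factor[OF V(1-3) S(1,3) \<epsilon>(1) famV[OF holF[of q0]] famV[OF holk[of q0]] nzV])
        show "y = 0" if "y \<in> ball 0 \<epsilon>" "F q0 (0 + y *s v) = 0" for y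
          using \<epsilon>(2)[of y] that by auto
        show "continuous_on W' b" using hol_b by (rule holomorphic_cn_imp_continuous_on)
        show "b x \<in> ball 0 \<epsilon> \<and> F q0 (x + b x *s v) = 0 \<and> k q0 (x + b x *s v) = 0" if "x \<in> W'" for x
          using graph[of x] u0[OF that] u W'(3) that by auto
      qed (use W' W(3) in auto)
      show False
      proof (rule coprime[OF V(1,3) D(1) _ _ D(4)])
        show "holomorphic_cn (\<lambda>x. fst q0 * q2 x + cnj (snd q0) * q1 x) V"
          "holomorphic_cn (\<lambda>x. snd q0 * q2 x - cnj (fst q0) * q1 x) V"
          by (intro holomorphic_cn_add holomorphic_cn_diff holomorphic_cn_mult holomorphic_cn_const D)+
        show "f x = D x * (fst q0 * q2 x + cnj (snd q0) * q1 x)" if "x \<in> V" for x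
          using f_eq[OF q0, of x] D(5,6)[OF that] by (simp add: algebra_simps)
        show "g x = D x * (snd q0 * q2 x - cnj (fst q0) * q1 x)" if "x \<in> V" for x
          using g_eq[OF q0, of x] D(5,6)[OF that] by (simp add: algebra_simps)
      qed
    qed
  qed
  then obtain p where p: "p \<in> V"
    "\<And>y. y \<in> ball 0 \<epsilon> \<Longrightarrow> F q0 (p + y *s v) = 0 \<Longrightarrow> h (p + y *s v) * k q0 (p + y *s v) \<noteq> 0" by blast
  \<comment> \<open>\<open>R\<close> is holomorphic and nonzero at \<open>p\<close>, so its zeros on
    the line through 0 and \<open>p\<close> are isolated. The resulting
    \<open>R (\<xi> *s p) \<noteq> 0\<close> for \<open>0 < norm \<xi> \<le> \<delta>\<close> is the
    isolatedness of the common zero in the plane of the points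
    \<open>\<xi> *s p + y *s v\<close>.\<close>
  obtain R where R: "holomorphic_cn R V" "\<And>x. x \<in> V \<Longrightarrow> R x = 0 \<longleftrightarrow>
      (\<exists>y\<in>ball 0 \<epsilon>. F q0 (x + y *s v) = 0 \<and> h (x + y *s v) * k q0 (x + y *s v) = 0)"
  proof (rule zero_product_holomorphic[OF V(1) famV[OF holF[of q0]] hol_family_mult[OF famV[OF hol(1)]
        famV[OF holk[of q0]]] S(1,3) \<epsilon>(1) \<open>connected V\<close> nzV])
    fix R
    assume R: "holomorphic_cn R V" "\<And>x. x \<in> V \<Longrightarrow> R x = 0 \<longleftrightarrow>
      (\<exists>y\<in>ball 0 \<epsilon>. F q0 (x + y *s v) = 0 \<and> h (x + y *s v) * k q0 (x + y *s v) = 0)"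
    show thesis using R by (rule that)
  qed
  define T' where "T' = {t. 0 + t *s p \<in> V}"
  have T': "open T'" "connected T'" "0 \<in> T'" "1 \<in> T'"
    unfolding T'_def using open_line_vimage[OF V(1), of 0 p] p(1) V(3)
    by (simp, simp, intro convex_connected convex_line_vimage V(2), simp_all)
  have "(\<lambda>t. R (0 + t *s p)) holomorphic_on T'"
    unfolding T'_def using R(1) by (rule holomorphic_cn_line)
  moreover have "R (0 + 1 *s p) \<noteq> 0" using R(2)[OF p(1)] p(2) by auto
  ultimately obtain \<delta> where \<delta>: "\<delta> > 0" "cball 0 \<delta> \<subseteq> T'" "\<And>t. t \<in> cball 0 \<delta> - {0} \<Longrightarrow> R (0 + t *s p) \<noteq> 0"
    by (rule nonzero_punctured_cball[OF _ T']) auto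
  have pV: "\<xi> *s p \<in> V" if "norm \<xi> \<le> \<delta>" for \<xi> using \<delta>(2) that by (auto simp: T'_def)
  have inU: "\<xi> *s p + y *s v \<in> U" if "norm \<xi> \<le> \<delta>" "norm y \<le> \<epsilon>" for \<xi> y
    using subV[OF pV[OF that(1)]] S(3) that(2) by (auto simp: subset_iff)
  have cont: "continuous_on (UNIV \<times> (cball 0 \<delta> \<times> cball 0 \<epsilon>)) (\<lambda>z. u (fst (snd z) *s p + snd (snd z) *s v))"
    if "continuous_on U u" for u :: "complex ^ 'n \<Rightarrow> complex"
    by (rule continuous_on_compose2[OF that]) (use inU in \<open>auto intro!: continuous_intros\<close>)
  have cont': "continuous_on (UNIV \<times> (cball 0 \<delta> \<times> cball 0 \<epsilon>))
      (\<lambda>z. F (fst z) (fst (snd z) *s p + snd (snd z) *s v))"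
    "continuous_on (UNIV \<times> (cball 0 \<delta> \<times> cball 0 \<epsilon>))
      (\<lambda>z. h (fst (snd z) *s p + snd (snd z) *s v) * k (fst z) (fst (snd z) *s p + snd (snd z) *s v))"
    unfolding F_def k_def
    by (intro continuous_intros cont hol holomorphic_cn_imp_continuous_on)+
  \<comment> \<open>The two parts of the boundary of the bidisc: on \<open>K1\<close> the function
    \<open>F q\<close> must not vanish, on \<open>K2\<close> the product \<open>h k\<close> must
    stay away from 0 wherever \<open>F q\<close> vanishes.\<close>
  define K1 where "K1 = cball (0 :: complex) \<delta> \<times> sphere (0 :: complex) \<epsilon>"
  define K2 where "K2 = sphere (0 :: complex) \<delta> \<times> cball (0 :: complex) \<epsilon>"
  have K: "compact K1" "compact K2" "K1 \<subseteq> cball 0 \<delta> \<times> cball 0 \<epsilon>" "K2 \<subseteq> cball 0 \<delta> \<times> cball 0 \<epsilon>"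
    unfolding K1_def K2_def by (auto intro: compact_Times)
  obtain d1 where d1: "d1 > 0"
    "\<And>q z. q \<in> ball q0 d1 \<Longrightarrow> z \<in> K1 \<Longrightarrow> F q (fst z *s p + snd z *s v) \<noteq> 0"
  proof (rule compact_nonzero_nhd[OF open_UNIV UNIV_I K(1), of "\<lambda>q z. F q (fst z *s p + snd z *s v)" q0])
    show "continuous_on (UNIV \<times> K1) (\<lambda>(q, z). F q (fst z *s p + snd z *s v))"
      unfolding split_beta using cont'(1) by (rule continuous_on_subset) (use K(3) in auto)
    show "F q0 (fst z *s p + snd z *s v) \<noteq> 0" if "z \<in> K1" for z
      using that by (intro nzV pV) (auto simp: K1_def)
  qed auto
  \<comment> \<open>The zeros of \<open>F q\<close> move with \<open>q\<close>, so instead of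
    bounding \<open>h k\<close> on them the sum of both norms is bounded below on the fixed set
    \<open>K2\<close>; where \<open>F q\<close> vanishes it reduces to the norm of
    \<open>h k\<close>.\<close>
  define B where "B q z = complex_of_real (norm (F q (fst z *s p + snd z *s v))
      + norm (h (fst z *s p + snd z *s v) * k q (fst z *s p + snd z *s v)))" for q z
  obtain d2 c where d2: "d2 > 0" "c > 0" "\<And>q z. q \<in> ball q0 d2 \<Longrightarrow> z \<in> K2 \<Longrightarrow> c \<le> norm (B q z)"
  proof (rule compact_bounded_below_nhd[OF open_UNIV UNIV_I K(2), of B q0])
    have sub: "UNIV \<times> K2 \<subseteq> UNIV \<times> (cball 0 \<delta> \<times> cball 0 \<epsilon>)" using K(4) by auto
    show "continuous_on (UNIV \<times> K2) (\<lambda>(q, z). B q z)"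
      unfolding split_beta B_def
      by (intro continuous_intros continuous_on_subset[OF cont'(1) sub]
          continuous_on_subset[OF cont'(2) sub])
    show "B q0 z \<noteq> 0" if z: "z \<in> K2" for z
    proof
      assume "B q0 z = 0"
      then have "norm (F q0 (fst z *s p + snd z *s v))
        + norm (h (fst z *s p + snd z *s v) * k q0 (fst z *s p + snd z *s v)) = 0"
        unfolding B_def of_real_eq_0_iff .
      then have 0: "F q0 (fst z *s p + snd z *s v) = 0"
          "h (fst z *s p + snd z *s v) * k q0 (fst z *s p + snd z *s v) = 0"
        by (simp_all add: add_nonneg_eq_0_iff)
      have z': "norm (fst z) = \<delta>" "norm (snd z) \<le> \<epsilon>" using z by (auto simp: K2_def)
      then have zV: "fst z *s p \<in> V" using pV by simp
      have "norm (snd z) \<noteq> \<epsilon>" using 0(1) nzV[OF zV, of "snd z"] by auto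
      then have "R (fst z *s p) = 0" using R(2)[OF zV] 0 z'(2) by auto
      moreover have "R (fst z *s p) \<noteq> 0" using \<delta>(3)[of "fst z"] z'(1) \<delta>(1) by auto
      ultimately show False by simp
    qed
  qed auto
  have solve: "\<exists>z\<in>U. h z * f z = s * fst q \<and> h z * g z = s * snd q"
    if q: "q \<in> ball q0 (min d1 d2)" "norm q = 1" and s: "norm s < c / 2" for q s
  proof -
    have "\<exists>\<xi> y. norm \<xi> \<le> \<delta> \<and> norm y \<le> \<epsilon> \<and> F q (\<xi> *s p + y *s v) = 0 \<and>
        h (\<xi> *s p + y *s v) * k q (\<xi> *s p + y *s v) = s"
    proof (rule value_attained_on_zero_curve[where \<phi> = "\<lambda>x y. h (x + y *s v) * k q (x + y *s v)" and c = c
            and X = V and S = S and F = "\<lambda>x y. F q (x + y *s v)"])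
      show "hol_family (\<lambda>x y. F q (x + y *s v)) V S" by (rule famV[OF holF])
      show "hol_family (\<lambda>x y. h (x + y *s v) * k q (x + y *s v)) V S"
        by (intro hol_family_mult famV hol(1) holk)
      show "F q (\<xi> *s p + y *s v) \<noteq> 0" if "norm \<xi> \<le> \<delta>" "norm y = \<epsilon>" for \<xi> y
        using d1(2)[of q "(\<xi>, y)"] q(1) that by (auto simp: K1_def)
      show "c \<le> norm (h (\<xi> *s p + y *s v) * k q (\<xi> *s p + y *s v))"
        if "norm \<xi> = \<delta>" "norm y \<le> \<epsilon>" "F q (\<xi> *s p + y *s v) = 0" for \<xi> y
        using d2(3)[of q "(\<xi>, y)"] q(1) that by (auto simp: K2_def B_def)
    qed (use V pV \<delta>(1) S \<epsilon>(1) F0 zero(1) s in auto)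
    then obtain \<xi> y where z: "norm \<xi> \<le> \<delta>" "norm y \<le> \<epsilon>" "F q (\<xi> *s p + y *s v) = 0"
      "h (\<xi> *s p + y *s v) * k q (\<xi> *s p + y *s v) = s" by blast
    show ?thesis
      using f_eq[OF q(2), of "\<xi> *s p + y *s v"] g_eq[OF q(2), of "\<xi> *s p + y *s v"] z(3,4)
      by (intro bexI[OF _ inU[OF z(1,2)]]) (auto simp: mult_ac)
  qed
  then show ?thesis using d1(1) d2(1,2)
    by (intro exI[of _ "ball q0 (min d1 d2)"] exI[of _ "c / 2"]) auto
qed

text \<open>Finitely many of the sets \<open>N q\<close> cover the unit sphere, and the least of
  their radii (capped at 1) is the radius of a ball in the image.\<close>

lemma locally_open_product:
  fixes h f g :: "complex ^ 'n \<Rightarrow> complex"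
  assumes U0: "open U0" "0 \<in> U0" and hol: "holomorphic_cn h U0" "holomorphic_cn f U0" "holomorphic_cn g U0"
    and zero: "h 0 = 0" "f 0 = 0" "g 0 = 0"
    and no_factor: "no_common_factor f g"
    and dim: "\<And>q. norm q = 1 \<Longrightarrow> set_dim_at0 {z. h z = 0 \<and> across q (f z) (g z) = 0} < ereal (real CARD('n) - 1)"
  shows "locally_open0 (\<lambda>z. h z * f z) (\<lambda>z. h z * g z)"
  unfolding locally_open0_def
proof (intro allI impI)
  fix U :: "(complex ^ 'n) set" assume U: "open U \<and> 0 \<in> U"
  define solvable where "solvable q0 N c \<longleftrightarrow> open N \<and> q0 \<in> N \<and> 0 < c \<and> (\<forall>q\<in>N. norm q = 1 \<longrightarrow>
    (\<forall>s. norm s < c \<longrightarrow> (\<exists>z\<in>U. h z * f z = s * fst q \<and> h z * g z = s * snd q)))"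
    for q0 :: "complex \<times> complex" and N and c :: real
  have "\<exists>N c. solvable q0 N c"
    if q0: "q0 \<in> sphere 0 1" for q0
  proof -
    have n: "norm q0 = 1" using q0 by simp
    obtain U1 where U1: "open U1" "0 \<in> U1" and no_graph: "\<And>v W b. v \<noteq> 0 \<Longrightarrow> open W \<Longrightarrow> W \<noteq> {} \<Longrightarrow>
        holomorphic_cn b W \<Longrightarrow> \<not> {x + b x *s v | x. x \<in> W} \<subseteq> {z. h z = 0 \<and> across q0 (f z) (g z) = 0} \<inter> U1"
      by (rule set_dim_at0_less_imp_no_graph[OF dim[OF n]]) blast
    define U2 where "U2 = U \<inter> U0 \<inter> U1"
    have U2: "open U2" "0 \<in> U2" using U U0 U1 by (auto simp: U2_def)
    have "U2 \<subseteq> U0" by (auto simp: U2_def)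
    note hol2 = holomorphic_cn_subset[OF hol(1) this] holomorphic_cn_subset[OF hol(2) this]
      holomorphic_cn_subset[OF hol(3) this]
    have "\<exists>N c. open N \<and> q0 \<in> N \<and> 0 < c \<and> (\<forall>q\<in>N. norm q = 1 \<longrightarrow>
      (\<forall>s. norm s < c \<longrightarrow> (\<exists>z\<in>U2. h z * f z = s * fst q \<and> h z * g z = s * snd q)))"
    proof (rule locally_solvable[where f = f and g = g, OF U2 hol2 zero no_factor _ n])
      show "\<not> {x + b x *s v | x. x \<in> W} \<subseteq> {z \<in> U2. h z = 0 \<and> across q0 (f z) (g z) = 0}"
        if "v \<noteq> 0" "open W" "W \<noteq> {}" "holomorphic_cn b W" for v W b
      proof
        assume "{x + b x *s v | x. x \<in> W} \<subseteq> {z \<in> U2. h z = 0 \<and> across q0 (f z) (g z) = 0}"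
        also have "\<dots> \<subseteq> {z. h z = 0 \<and> across q0 (f z) (g z) = 0} \<inter> U1" by (auto simp: U2_def)
        finally show False using no_graph[OF that] by blast
      qed
    qed
    then obtain N c where "open N" "q0 \<in> N" "0 < c" and solve: "\<forall>q\<in>N. norm q = 1 \<longrightarrow>
        (\<forall>s. norm s < c \<longrightarrow> (\<exists>z\<in>U2. h z * f z = s * fst q \<and> h z * g z = s * snd q))"
      by (elim exE conjE) (rule that)
    moreover have "\<exists>z\<in>U. h z * f z = s * fst q \<and> h z * g z = s * snd q"
      if "q \<in> N" "norm q = 1" "norm s < c" for q s
      using solve that by (auto simp: U2_def)
    ultimately have "solvable q0 N c" by (simp add: solvable_def)
    then show ?thesis by blast
  qed
  then obtain N c where Nc: "\<And>q. q \<in> sphere 0 1 \<Longrightarrow> solvable q (N q) (c q)" by metis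
  then have N: "open (N q)" "q \<in> N q" and c: "0 < c q" if "q \<in> sphere 0 1" for q
    using that by (simp_all add: solvable_def)
  have solve: "\<exists>z\<in>U. h z * f z = s * fst q \<and> h z * g z = s * snd q"
    if "q0 \<in> sphere 0 1" "q \<in> N q0" "norm q = 1" "norm s < c q0" for q0 q s
    using Nc[OF that(1)] that(2-4) by (simp add: solvable_def)
  have "compact (sphere (0 :: complex \<times> complex) 1)" by simp
  then obtain C where C: "C \<subseteq> sphere 0 1" "finite C" "sphere (0 :: complex \<times> complex) 1 \<subseteq> (\<Union>q\<in>C. N q)"
    by (rule compactE_image[of _ "sphere 0 1" N]) (use N in auto)
  define c0 where "c0 = Min (insert 1 (c ` C))"
  have c0: "0 < c0" "\<And>q. q \<in> C \<Longrightarrow> c0 \<le> c q" using C(1,2) c by (auto simp: c0_def)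
  have "ball 0 c0 \<subseteq> (\<lambda>z. (h z * f z, h z * g z)) ` U"
  proof
    fix w :: "complex \<times> complex" assume w: "w \<in> ball 0 c0"
    show "w \<in> (\<lambda>z. (h z * f z, h z * g z)) ` U"
    proof (cases "w = 0")
      case True
      then show ?thesis using U zero by (auto simp: image_iff zero_prod_def intro!: bexI[of _ 0])
    next
      case False
      define q where "q = w /\<^sub>R norm w"
      have "norm q = 1" using False by (simp add: q_def)
      then obtain q0 where q0: "q0 \<in> C" "q \<in> N q0" using C(3) by auto
      have "norm (complex_of_real (norm w)) < c q0" using w c0(2)[OF q0(1)] by simp
      from solve[OF _ q0(2) \<open>norm q = 1\<close> this] q0(1) C(1)
      obtain z where z: "z \<in> U" "h z * f z = of_real (norm w) * fst q" "h z * g z = of_real (norm w) * snd q"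
        by blast
      have "of_real (norm w) * fst q = fst w" "of_real (norm w) * snd q = snd w"
        using False by (simp_all add: q_def scaleR_conv_of_real)
      then have "w = (h z * f z, h z * g z)" using z(2,3) by (simp add: prod_eq_iff)
      then show ?thesis using z(1) by blast
    qed
  qed
  then show "(0, 0) \<in> interior ((\<lambda>z. (h z * f z, h z * g z)) ` U)"
    using c0(1) unfolding mem_interior zero_prod_def by blast
qed

section \<open>Passage from germs to representatives\<close>

lemma hol_germ_representative:
  fixes x :: "'n::finite hol_germ"
  obtains u U where "x = abs_hol_germ u" "open U" "0 \<in> U" "holomorphic_cn u U"
proof -
  have "x = abs_hol_germ (rep_hol_germ x)" "germ_rel (rep_hol_germ x) (rep_hol_germ x)"
    using Quotient_abs_rep[OF Quotient_hol_germ] Quotient_rep_reflp[OF Quotient_hol_germ] by metis+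
  then show ?thesis using that unfolding germ_rel_def holomorphic_near0_def by metis
qed

lemma germ_rel_reflI:
  assumes "open U" "0 \<in> U" "holomorphic_cn u U"
  shows "germ_rel u u"
  using assms unfolding germ_rel_refl_iff holomorphic_near0_def by blast

lemma abs_hol_germ_eqI:
  assumes "open U" "0 \<in> U" "holomorphic_cn u U" "\<And>z. z \<in> U \<Longrightarrow> u z = w z"
  shows "abs_hol_germ u = abs_hol_germ w"
proof (rule Quotient_rel_abs[OF Quotient_hol_germ])
  have "holomorphic_cn w U" by (rule holomorphic_cn_cong[OF assms(1,3,4)])
  moreover have "\<forall>\<^sub>F z in nhds 0. u z = w z" unfolding eventually_nhds using assms by blast
  ultimately show "germ_rel u w"
    using assms unfolding germ_rel_def holomorphic_near0_def by blast
qed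

lemma germ_at0_one: "germ_at0 (1 :: 'n::finite hol_germ) = 1"
  by transfer simp

lemma germ_at0_diff: "germ_at0 (a - b) = germ_at0 a - germ_at0 b"
  by transfer simp

lemma germ_at0_mult: "germ_at0 (a * b) = germ_at0 a * germ_at0 b"
  by transfer simp

text \<open>\<open>h * d\<close> is a common divisor, so \<open>h = h * d * e\<close>, that is,
  \<open>h * (1 - d * e) = 0\<close>. If \<open>d\<close> vanished at 0, then
  \<open>1 - d * e\<close> would be a unit and \<open>h\<close> would be 0. Inverting this unit
  takes the place of cancelling \<open>h\<close>, so the absence of zero divisors does not have to
  be proved.\<close>

lemma common_divisor_unit:
  fixes f g h :: "'n::finite hol_germ"
  assumes gcd: "is_gcd h (h * f) (h * g)" and "h \<noteq> 0" and d: "d dvd f" "d dvd g"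
  shows "d \<notin> max_ideal"
proof
  assume "d \<in> max_ideal"
  have "h * d dvd h * f" "h * d dvd h * g" using d by (simp_all add: mult_dvd_mono)
  then have "h * d dvd h" using gcd by (simp add: is_gcd_def)
  then obtain e where e: "h = h * d * e" by (rule dvdE)
  have "germ_at0 (1 - d * e) = 1"
    using \<open>d \<in> max_ideal\<close> by (simp add: germ_at0_one germ_at0_diff germ_at0_mult max_ideal_def)
  then have "(1 - d * e) dvd 1" using max_ideal_iff_not_unit[of "1 - d * e"] by (simp add: max_ideal_def)
  then obtain u where u: "1 = (1 - d * e) * u" by (rule dvdE)
  have "h = h * ((1 - d * e) * u)" using u by simp
  also have "\<dots> = (h - h * d * e) * u" by (simp add: algebra_simps)
  finally show False using e \<open>h \<noteq> 0\<close> by simp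
qed

theorem proposition3p3:
  fixes f g h fhat ghat :: "'n::finite hol_germ"
  assumes "f \<in> max_ideal" and "g \<in> max_ideal"
    and "f = h * fhat" and "g = h * ghat"
    and "is_gcd h f g" and "h \<in> max_ideal"
    and "\<not> fhat dvd 1" and "\<not> ghat dvd 1"
    and "\<And>\<alpha> \<beta>. (\<alpha>, \<beta>) \<noteq> (0, 0) \<Longrightarrow>
           germ_dim (germ_Int (zero_germ h)
             (zero_germ (germ_const \<beta> * fhat + germ_const \<alpha> * ghat)))
           = ereal (real CARD('n) - 2)"
  shows "germ_locally_open f g"
proof -
  obtain h0 Uh where h0: "h = abs_hol_germ h0" "open Uh" "0 \<in> Uh" "holomorphic_cn h0 Uh"
    by (rule hol_germ_representative)
  obtain f0 Uf where f0: "fhat = abs_hol_germ f0" "open Uf" "0 \<in> Uf" "holomorphic_cn f0 Uf"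
    by (rule hol_germ_representative)
  obtain g0 Ug where g0: "ghat = abs_hol_germ g0" "open Ug" "0 \<in> Ug" "holomorphic_cn g0 Ug"
    by (rule hol_germ_representative)
  define U where "U = Uh \<inter> Uf \<inter> Ug"
  have U: "open U" "0 \<in> U" using h0 f0 g0 by (auto simp: U_def)
  have hol: "holomorphic_cn h0 U" "holomorphic_cn f0 U" "holomorphic_cn g0 U"
    using h0(4) f0(4) g0(4) by (auto simp: U_def elim!: holomorphic_cn_subset)
  note rel = germ_rel_reflI[OF U hol(1)] germ_rel_reflI[OF U hol(2)] germ_rel_reflI[OF U hol(3)]
  have fg: "f = abs_hol_germ (\<lambda>z. h0 z * f0 z)" "g = abs_hol_germ (\<lambda>z. h0 z * g0 z)"
    using assms(3,4) h0(1) f0(1) g0(1) rel by (simp_all add: times_hol_germ.abs_eq)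
  have "fhat \<in> max_ideal" "ghat \<in> max_ideal"
    using assms(7,8) by (simp_all add: max_ideal_iff_not_unit)
  then have zero: "h0 0 = 0" "f0 0 = 0" "g0 0 = 0"
    using assms(6) rel by (simp_all add: max_ideal_def h0(1) f0(1) g0(1) germ_at0.abs_eq)
  have dim: "set_dim_at0 {z. h0 z = 0 \<and> \<beta> * f0 z + \<alpha> * g0 z = 0} < ereal (real CARD('n) - 1)"
    if "(\<alpha>, \<beta>) \<noteq> (0, 0)" for \<alpha> \<beta>
  proof -
    have "holomorphic_cn (\<lambda>z. \<beta> * f0 z) U" "holomorphic_cn (\<lambda>z. \<alpha> * g0 z) U"
      by (intro holomorphic_cn_mult holomorphic_cn_const hol)+
    note rel' = germ_rel_reflI[OF U this(1)] germ_rel_reflI[OF U this(2)]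
      germ_rel_reflI[OF U holomorphic_cn_add[OF this]]
    have const: "germ_const c = abs_hol_germ (\<lambda>z. c)" for c :: complex
      by (simp add: germ_const_def)
    have "germ_const \<beta> * fhat + germ_const \<alpha> * ghat = abs_hol_germ (\<lambda>z. \<beta> * f0 z + \<alpha> * g0 z)"
      using rel rel' germ_rel_reflI[OF U holomorphic_cn_const]
      by (simp add: const f0(1) g0(1) times_hol_germ.abs_eq plus_hol_germ.abs_eq)
    then have "germ_dim (germ_Int (zero_germ h) (zero_germ (germ_const \<beta> * fhat + germ_const \<alpha> * ghat)))
        = set_dim_at0 ({z. h0 z = 0} \<inter> {z. \<beta> * f0 z + \<alpha> * g0 z = 0})"
      using rel(1) rel'(3) by (simp add: h0(1) zero_germ.abs_eq germ_Int.abs_eq germ_dim.abs_eq)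
    then have "set_dim_at0 ({z. h0 z = 0} \<inter> {z. \<beta> * f0 z + \<alpha> * g0 z = 0}) = ereal (real CARD('n) - 2)"
      using assms(9)[OF that] by simp
    then show ?thesis by (simp flip: Collect_conj_eq)
  qed
  \<comment> \<open>If \<open>h = 0\<close>, the intersection for \<open>\<alpha> = 0\<close>,
    \<open>\<beta> = 1\<close> is the zero germ of \<open>fhat\<close>, which contains graphs
    arbitrarily near the origin and so has dimension at least n - 1. A gcd equal to 0 would say
    nothing about common divisors of \<open>fhat\<close> and \<open>ghat\<close>.\<close>
  have "h \<noteq> 0"
  proof
    assume "h = 0"
    then have "germ_rel h0 (\<lambda>z. 0)"
      using h0(1) rel(1) germ_rel_reflI[OF U holomorphic_cn_const[of 0]] Quotient_rel[OF Quotient_hol_germ]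
      by (metis zero_hol_germ_def)
    then obtain U1 where U1: "open U1" "0 \<in> U1" "\<And>z. z \<in> U1 \<Longrightarrow> h0 z = 0"
      unfolding germ_rel_def eventually_nhds by blast
    obtain U2 where U2: "open U2" "0 \<in> U2" and no_graph: "\<And>v W b. v \<noteq> 0 \<Longrightarrow> open W \<Longrightarrow> W \<noteq> {} \<Longrightarrow>
        holomorphic_cn b W \<Longrightarrow> \<not> {x + b x *s v | x. x \<in> W} \<subseteq> {z. h0 z = 0 \<and> 1 * f0 z + 0 * g0 z = 0} \<inter> U2"
      by (rule set_dim_at0_less_imp_no_graph[OF dim[of 0 1]]) (simp, blast)
    have "holomorphic_cn f0 (U \<inter> U1 \<inter> U2)" using hol(2) by (rule holomorphic_cn_subset) auto
    then obtain v W b where W: "v \<noteq> 0" "open W" "W \<noteq> {}" "holomorphic_cn b W"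
        "{x + b x *s v | x. x \<in> W} \<subseteq> {z \<in> U \<inter> U1 \<inter> U2. f0 z = 0}"
      by (rule hypersurface_contains_graph[rotated 2]) (use U U1 U2 zero in auto)
    have "{z \<in> U \<inter> U1 \<inter> U2. f0 z = 0} \<subseteq> {z. h0 z = 0 \<and> 1 * f0 z + 0 * g0 z = 0} \<inter> U2"
      using U1(3) by auto
    then show False using no_graph[OF W(1-4)] W(5) by blast
  qed
  have "locally_open0 (\<lambda>z. h0 z * f0 z) (\<lambda>z. h0 z * g0 z)"
  proof (rule locally_open_product[OF U hol zero])
    show "no_common_factor f0 g0"
      unfolding no_common_factor_def
    proof safe
      fix V and D q1 q2 :: "complex ^ 'n \<Rightarrow> complex"
      assume V: "open V" "0 \<in> V" and D: "holomorphic_cn D V" "holomorphic_cn q1 V" "holomorphic_cn q2 V"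
        "D 0 = 0" and eq: "\<forall>x\<in>V. f0 x = D x * q1 x \<and> g0 x = D x * q2 x"
      note relD = germ_rel_reflI[OF V D(1)] germ_rel_reflI[OF V D(2)] germ_rel_reflI[OF V D(3)]
      have "holomorphic_cn (\<lambda>x. D x * q1 x) V" "holomorphic_cn (\<lambda>x. D x * q2 x) V"
        by (intro holomorphic_cn_mult D)+
      then have "fhat = abs_hol_germ (\<lambda>x. D x * q1 x)" "ghat = abs_hol_germ (\<lambda>x. D x * q2 x)"
        unfolding f0(1) g0(1) using V eq by (auto intro!: abs_hol_germ_eqI[symmetric])
      then have "fhat = abs_hol_germ D * abs_hol_germ q1" "ghat = abs_hol_germ D * abs_hol_germ q2"
        using relD by (simp_all add: times_hol_germ.abs_eq)
      then have "abs_hol_germ D dvd fhat" "abs_hol_germ D dvd ghat" by simp_all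
      with common_divisor_unit[of h fhat ghat] \<open>h \<noteq> 0\<close> assms(3-5)
      have "abs_hol_germ D \<notin> max_ideal" by simp
      then show False using D(4) relD(1) by (simp add: max_ideal_def germ_at0.abs_eq)
    qed
  next
    fix q :: "complex \<times> complex" assume "norm q = 1"
    \<comment> \<open>The choice \<open>\<alpha> = - fst q\<close>, \<open>\<beta> = snd q\<close>
      turns \<open>\<beta> * f0 z + \<alpha> * g0 z\<close> into
      \<open>across q (f0 z) (g0 z)\<close>.\<close>
    then have "(- fst q, snd q) \<noteq> (0, 0)" by (auto simp: norm_prod_def)
    from dim[OF this]
    show "set_dim_at0 {z. h0 z = 0 \<and> across q (f0 z) (g0 z) = 0} < ereal (real CARD('n) - 1)"
      by (simp add: across_def)
  qed
  moreover have "germ_rel (\<lambda>z. h0 z * f0 z) (\<lambda>z. h0 z * f0 z)" "germ_rel (\<lambda>z. h0 z * g0 z) (\<lambda>z. h0 z * g0 z)"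
    by (rule germ_rel_reflI[OF U], intro holomorphic_cn_mult hol)+
  ultimately show ?thesis unfolding fg by (simp add: germ_locally_open.abs_eq)
qed

end
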